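(* Let $\mathcal{M}_0=\{p_\mu : \mu\in M_0\}$ and $\mathcal{M}_1=\{p_\mu:\mu\in M_1\}$ be nested exponential families in their mean-value parameterization, with $M_0\subseteq M_1$ of the product form described in the context. Let the loss $d_{\mathrm{gen}}(\cdot\|\cdot)$ be any one of: squared error, standardized squared error, Rényi divergence of order $1/2$, squared Hellinger distance, or Kullback-Leibler divergence. Assume: (1) the estimators $\breve\mu_0$ (with range $M_0$) and $\breve\mu_1$ (with range $M_1$) are sufficiently efficient relative to $d_{\mathrm{gen}}$; (2) the switch criterion $\delta_{\mathrm{sw}}$ is constructed from Bayes marginal distributions $p_{B,0}$ and $p_{B,1}$ based on priors $\omega_0,\omega_1$ that admit strictly positive, continuous (proper) densities; (3) the switch distribution $p_{\mathrm{sw},1}$ is defined relative to a probability mass function $\pi$ with support $\{1,2,4,8,\ldots\}$ such that, for some $\kappa>1$, $\pi(2^i)$ is of order $i^{-\kappa}$ (i.e. there are constants $0<a\le b<\infty$ with $a\,i^{-\kappa}\le \pi(2^i)\le b\, i^{-\kappa}$ for all $i\ge 1$). Then for every CINECSI subset $M_1'$ of $M_1$, $$\sup_{\mu_1\in M_1'} R(\mu_1,\delta_{\mathrm{sw}},n)=O\left(\frac{\log\log n}{n}\right),$$ where $R(\mu,\delta_{\mathrm{sw}},n)$ is the risk at sample size $n$ of post-model-selection estimation based on $\delta_{\mathrm{sw}}$, $\breve\mu_0,\breve\mu_1$, defined relative to the loss $d_{\mathrm{gen}}$.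
   Context: Models. Observations $X_1,X_2,\ldots$ are i.i.d. with values in $\mathcal X$. $\mathcal{M}_1=\{p_\mu:\mu\in M_1\}$ is an $m_1$-dimensional exponential family ($m_1>0$): a set of densities on $\mathcal X$ relative to a fixed underlying measure, of the form $e^{\theta^T\phi(x)-\psi(\theta)}r(x)$, $\theta\in\Theta\subset\mathbb{R}^{m_1}$ open and connected, in a minimal representation, and parameterized by the mean value $\mu=\mathbb{E}_\theta[\phi(X)]$. The family need not be full. $\mathcal{M}_0=\{p_\mu:\mu\in M_0\}\subset\mathcal{M}_1$ is an $m_0$-dimensional exponential family, $0\le m_0<m_1$, whose parameterization coincides with that of $\mathcal{M}_1$ (free parameters: the means of the first $m_0$ components of $\phi$; the last $m_1-m_0$ components are fixed): $$M_1=(\zeta_{1,1},\eta_{1,1})\times\cdots\times(\zeta_{1,m_1},\eta_{1,m_1}),$$ $$M_0=(\zeta_{0,1},\eta_{0,1})\times\cdots\times(\zeta_{0,m_0},\eta_{0,m_0})\times\{\nu_{m_0+1}\}\times\cdots\times\{\nu_{m_1}\},$$ where $-\infty\le\zeta_{1,j}\le\zeta_{0,j}<\eta_{0,j}\le\eta_{1,j}\le\infty$ for $j\le m_0$ and $-\infty\le\zeta_{1,j}<\nu_j<\eta_{1,j}\le\infty$ for $j>m_0$. Write $p_\mu(x^n)=\prod_{i=1}^n p_\mu(x_i)$; $\mathbb{P}_\mu,\mathbb{E}_\mu$ denote probability and expectation when $X_1,\ldots,X_n$ are i.i.d. $\sim p_\mu$. Sample sizes are assumed to satisfy $n\ge3$.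 Projection. For $\mu_1=(\mu_{1,1},\ldots,\mu_{1,m_1})^T\in M_1$, $\Pi_0(\mu_1)=(\mu_{1,1},\ldots,\mu_{1,m_0},\nu_{m_0+1},\ldots,\nu_{m_1})^T$, abbreviated $\mu_0$. CINECSI. A CINECSI subset of a set $M$ is a connected subset of the interior of $M$ that is itself compact and has nonempty interior. Losses. Squared error: $\|\mu'-\mu\|_2^2$. Standardized squared error: $d_{ST}(\mu'\|\mu)=(\mu-\mu')^TI(\mu')(\mu-\mu')$ with $I$ the Fisher information matrix (in the mean-value parameterization). Rényi divergence of order $1/2$: $d_R(\mu',\mu)=-2\log\mathbb{E}_{\mu'}[(p_\mu(X)/p_{\mu'}(X))^{1/2}]$. Squared Hellinger: $d_{H^2}(\mu',\mu)=2(1-\mathbb{E}_{\mu'}[(p_\mu(X)/p_{\mu'}(X))^{1/2}])$. KL: $D(\mu'\|\mu)=\mathbb{E}_{\mu'}[\log(p_{\mu'}(X)/p_\mu(X))]$. Sufficiently efficient. Estimators $\breve\mu_0,\breve\mu_1$ (functions of samples of arbitrary size $n$) with ranges $M_0$, $M_1$ are sufficiently efficient with respect to $d_{\mathrm{gen}}$ if for every CINECSI subset $M_1'$ of $M_1$ there are constants $C,C'>0$ such that for all $n$, with $\mu_0=\Pi_0(\mu_1)$, $$\sup_{\mu_1\in M_1'}\mathbb{E}_{\mu_1}[d_{\mathrm{gen}}(\mu_0\|\breve\mu_0(X^n))]\le C\sup_{\mu_1\in M_1'}\mathbb{E}_{\mu_1}[d_{\mathrm{gen}}(\mu_1\|\breve\mu_1(X^n))]\le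 \frac{C'}{n}.$$ Bayes marginals. $\omega_1$ is a prior density on $M_1$ and $p_{B,1}(x^n)=\int_{M_1}\omega_1(\mu)p_\mu(x^n)\,d\mu$. If $m_0=0$, $M_0=\{\nu\}$ and $p_{B,0}=p_\nu$. If $m_0>0$, let $\Pi_0'$ map $\mu\in M_0$ to its first $m_0$ components, put $p_{\Pi_0'(\mu)}=p_\mu$, let $\omega_0$ be a prior density on $\Pi_0'(M_0)\subset\mathbb{R}^{m_0}$, and $p_{B,0}(x^n)=\int_{\Pi_0'(M_0)}\omega_0(\mu')p_{\mu'}(x^n)\,d\mu'$. Conditional densities are $p_{B,1}(x_t,\ldots,x_n\mid x^{t-1})=p_{B,1}(x^n)/p_{B,1}(x^{t-1})$. Switch distribution and criterion. For $t\ge1$, $\bar p_t(x^n)=p_{B,0}(x^{t-1})\,p_{B,1}(x_t,\ldots,x_n\mid x^{t-1})$ if $t\le n$ (so $\bar p_1=p_{B,1}$) and $\bar p_t(x^n)=p_{B,0}(x^n)$ if $t>n$. Then $p_{\mathrm{sw},1}(x^n)=\sum_{t=1}^\infty\pi(t)\bar p_t(x^n)$, and $\delta_{\mathrm{sw}}(x^n)=1$ if $p_{\mathrm{sw},1}(x^n)/p_{B,0}(x^n)>1$ and $\delta_{\mathrm{sw}}(x^n)=0$ otherwise. Risk. $R(\mu,\delta_{\mathrm{sw}},n)=\mathbb{E}_\mu[d_{\mathrm{gen}}(\mu\|\breve\mu_{\breve k}(X^n))]$ with $\breve k=\delta_{\mathrm{sw}}(X^n)$. *)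

theory Defs
  imports "HOL-Probability.Probability"
begin

section \<open>Coordinates\<close>

text \<open>
  The index type \<open>'m\<close> plays the role of \<open>{1, \<dots>, m\<^sub>1}\<close>. Since \<open>m\<^sub>0\<close> is a number that may be \<open>0\<close>,
  Euclidean space of dimension \<open>m\<^sub>0\<close> is represented by the coordinate subspace of \<open>real ^ 'm\<close> spanned
  by the first \<open>m\<^sub>0\<close> coordinates, with its own relative topology and Lebesgue measure.
\<close>

definition first_coords :: "nat \<Rightarrow> 'm::{finite,linorder} set" where
  "first_coords k = {i. card {j. j < i} < k}"

definition coord_space :: "'m::finite set \<Rightarrow> (real ^ 'm) set" where
  "coord_space F = {v. \<forall>i. i \<notin> F \<longrightarrow> v $ i = 0}"

definition restrict_coords :: "'m::finite set \<Rightarrow> real ^ 'm \<Rightarrow> real ^ 'm" where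
  "restrict_coords F v = (\<chi> i. if i \<in> F then v $ i else 0)"

definition lborel_coords :: "'m::finite set \<Rightarrow> (real ^ 'm) measure" where
  "lborel_coords F =
     distr (Pi\<^sub>M F (\<lambda>_. lborel)) borel (\<lambda>f. \<chi> i. if i \<in> F then f i else 0)"

definition open_box :: "('m::finite \<Rightarrow> ereal) \<Rightarrow> ('m \<Rightarrow> ereal) \<Rightarrow> (real ^ 'm) set" where
  "open_box \<zeta> \<eta> = {\<mu>. \<forall>i. \<zeta> i < ereal (\<mu> $ i) \<and> ereal (\<mu> $ i) < \<eta> i}"

definition flat_box ::
  "'m::finite set \<Rightarrow> ('m \<Rightarrow> ereal) \<Rightarrow> ('m \<Rightarrow> ereal) \<Rightarrow> real ^ 'm \<Rightarrow> (real ^ 'm) set" where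
  "flat_box F \<zeta> \<eta> \<nu> =
     {\<mu>. (\<forall>i\<in>F. \<zeta> i < ereal (\<mu> $ i) \<and> ereal (\<mu> $ i) < \<eta> i) \<and> (\<forall>i. i \<notin> F \<longrightarrow> \<mu> $ i = \<nu> $ i)}"

text \<open>Applied to a vector of the coordinate space \<open>F\<close>, this map is also the inverse of
  \<^const>\<open>restrict_coords\<close> on \<open>flat_box F \<zeta> \<eta> \<nu>\<close>.\<close>

definition proj0 :: "'m::finite set \<Rightarrow> real ^ 'm \<Rightarrow> real ^ 'm \<Rightarrow> real ^ 'm" where
  "proj0 F \<nu> \<mu> = (\<chi> i. if i \<in> F then \<mu> $ i else \<nu> $ i)"

definition cinecsi :: "(real ^ 'm::finite) set \<Rightarrow> (real ^ 'm) set \<Rightarrow> bool" where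
  "cinecsi K M \<longleftrightarrow> connected K \<and> K \<subseteq> interior M \<and> compact K \<and> interior K \<noteq> {}"


section \<open>Exponential families\<close>

text \<open>Densities are relative to the fixed measure \<open>\<Lambda>\<close>; the canonical parameter \<open>\<theta>\<close> is taken from
  the coordinate space \<open>F\<close>, so that only the components of the statistic with index in \<open>F\<close> matter.
  The case \<open>F = UNIV\<close> is the family of full dimension.\<close>

definition log_partition ::
  "'x measure \<Rightarrow> ('x \<Rightarrow> real ^ 'm::finite) \<Rightarrow> ('x \<Rightarrow> real) \<Rightarrow> real ^ 'm \<Rightarrow> real" where
  "log_partition \<Lambda> \<phi> r \<theta> = ln (\<integral>x. exp (\<theta> \<bullet> \<phi> x) * r x \<partial>\<Lambda>)"

definition canonical_density ::
  "'x measure \<Rightarrow> ('x \<Rightarrow> real ^ 'm::finite) \<Rightarrow> ('x \<Rightarrow> real) \<Rightarrow> real ^ 'm \<Rightarrow> 'x \<Rightarrow> real" where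
  "canonical_density \<Lambda> \<phi> r \<theta> x = exp (\<theta> \<bullet> \<phi> x - log_partition \<Lambda> \<phi> r \<theta>) * r x"

definition mean_value ::
  "'m::finite set \<Rightarrow> 'x measure \<Rightarrow> ('x \<Rightarrow> real ^ 'm) \<Rightarrow> ('x \<Rightarrow> real) \<Rightarrow> real ^ 'm \<Rightarrow> real ^ 'm" where
  "mean_value F \<Lambda> \<phi> r \<theta> =
     (\<chi> i. if i \<in> F then \<integral>x. canonical_density \<Lambda> \<phi> r \<theta> x * \<phi> x $ i \<partial>\<Lambda> else 0)"

text \<open>The last conjunct is minimality of the representation: no nontrivial affine relation
  between the components of the statistic holds almost everywhere.\<close>

definition exponential_family ::
  "'m::finite set \<Rightarrow> 'x measure \<Rightarrow> ('x \<Rightarrow> real ^ 'm) \<Rightarrow> ('x \<Rightarrow> real) \<Rightarrow> (real ^ 'm) set \<Rightarrow> bool" where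
  "exponential_family F \<Lambda> \<phi> r \<Theta> \<longleftrightarrow>
     \<phi> \<in> borel_measurable \<Lambda> \<and> r \<in> borel_measurable \<Lambda> \<and> (\<forall>x\<in>space \<Lambda>. 0 \<le> r x) \<and>
     openin (top_of_set (coord_space F)) \<Theta> \<and> connected \<Theta> \<and> \<Theta> \<noteq> {} \<and>
     (\<forall>\<theta>\<in>\<Theta>. integrable \<Lambda> (\<lambda>x. exp (\<theta> \<bullet> \<phi> x) * r x) \<and> 0 < (\<integral>x. exp (\<theta> \<bullet> \<phi> x) * r x \<partial>\<Lambda>)) \<and>
     (\<forall>a\<in>coord_space F. \<forall>c. (AE x in density \<Lambda> (\<lambda>x. ennreal (r x)). a \<bullet> \<phi> x = c) \<longrightarrow> a = 0)"

text \<open>The density with mean value \<open>\<mu>\<close>; minimality makes \<^const>\<open>mean_value\<close> injective on \<open>\<Theta>\<close>.\<close>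

definition mean_density ::
  "'m::finite set \<Rightarrow> 'x measure \<Rightarrow> ('x \<Rightarrow> real ^ 'm) \<Rightarrow> ('x \<Rightarrow> real) \<Rightarrow> (real ^ 'm) set
     \<Rightarrow> real ^ 'm \<Rightarrow> 'x \<Rightarrow> real" where
  "mean_density F \<Lambda> \<phi> r \<Theta> \<mu> =
     canonical_density \<Lambda> \<phi> r (the_inv_into \<Theta> (mean_value F \<Lambda> \<phi> r) \<mu>)"


section \<open>Samples, losses and estimators\<close>

text \<open>From here on \<open>p \<mu>\<close> is the density with parameter \<open>\<mu>\<close>. A sample of size \<open>n\<close> is a function on
  \<open>{1..n}\<close>; for \<open>k \<le> n\<close> the same function also serves as the initial segment of length \<open>k\<close>.\<close>

definition model_measure :: "'x measure \<Rightarrow> ('v \<Rightarrow> 'x \<Rightarrow> real) \<Rightarrow> 'v \<Rightarrow> 'x measure" where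
  "model_measure \<Lambda> p \<mu> = density \<Lambda> (\<lambda>x. ennreal (p \<mu> x))"

definition likelihood :: "('v \<Rightarrow> 'x \<Rightarrow> real) \<Rightarrow> 'v \<Rightarrow> nat \<Rightarrow> (nat \<Rightarrow> 'x) \<Rightarrow> real" where
  "likelihood p \<mu> n x = (\<Prod>i\<in>{1..n}. p \<mu> (x i))"

text \<open>Expectations of nonnegative quantities take values in \<open>[0, \<infinity>]\<close>.\<close>

definition sample_expectation ::
  "'x measure \<Rightarrow> ('v \<Rightarrow> 'x \<Rightarrow> real) \<Rightarrow> 'v \<Rightarrow> nat \<Rightarrow> ((nat \<Rightarrow> 'x) \<Rightarrow> real) \<Rightarrow> ennreal" where
  "sample_expectation \<Lambda> p \<mu> n f =
     (\<integral>\<^sup>+x. ennreal (f x) \<partial>(Pi\<^sub>M {1..n} (\<lambda>_. model_measure \<Lambda> p \<mu>)))"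

definition score ::
  "(real ^ 'm::finite \<Rightarrow> 'x \<Rightarrow> real) \<Rightarrow> real ^ 'm \<Rightarrow> 'm \<Rightarrow> 'x \<Rightarrow> real" where
  "score p \<mu> i x = deriv (\<lambda>t::real. ln (p (\<mu> + t *\<^sub>R axis i 1) x)) 0"

definition fisher_information ::
  "'x measure \<Rightarrow> (real ^ 'm::finite \<Rightarrow> 'x \<Rightarrow> real) \<Rightarrow> real ^ 'm \<Rightarrow> real ^ 'm ^ 'm" where
  "fisher_information \<Lambda> p \<mu> =
     (\<chi> i j. \<integral>x. score p \<mu> i x * score p \<mu> j x \<partial>(model_measure \<Lambda> p \<mu>))"

definition squared_error :: "real ^ 'm::finite \<Rightarrow> real ^ 'm \<Rightarrow> real" where
  "squared_error \<mu>' \<mu> = (norm (\<mu>' - \<mu>))\<^sup>2"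

definition standardized_squared_error ::
  "'x measure \<Rightarrow> (real ^ 'm::finite \<Rightarrow> 'x \<Rightarrow> real) \<Rightarrow> real ^ 'm \<Rightarrow> real ^ 'm \<Rightarrow> real" where
  "standardized_squared_error \<Lambda> p \<mu>' \<mu> = (\<mu> - \<mu>') \<bullet> (fisher_information \<Lambda> p \<mu>' *v (\<mu> - \<mu>'))"

definition affinity :: "'x measure \<Rightarrow> ('v \<Rightarrow> 'x \<Rightarrow> real) \<Rightarrow> 'v \<Rightarrow> 'v \<Rightarrow> real" where
  "affinity \<Lambda> p \<mu>' \<mu> = (\<integral>x. sqrt (p \<mu> x / p \<mu>' x) \<partial>(model_measure \<Lambda> p \<mu>'))"

definition renyi_half :: "'x measure \<Rightarrow> ('v \<Rightarrow> 'x \<Rightarrow> real) \<Rightarrow> 'v \<Rightarrow> 'v \<Rightarrow> real" where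
  "renyi_half \<Lambda> p \<mu>' \<mu> = - 2 * ln (affinity \<Lambda> p \<mu>' \<mu>)"

definition squared_hellinger :: "'x measure \<Rightarrow> ('v \<Rightarrow> 'x \<Rightarrow> real) \<Rightarrow> 'v \<Rightarrow> 'v \<Rightarrow> real" where
  "squared_hellinger \<Lambda> p \<mu>' \<mu> = 2 * (1 - affinity \<Lambda> p \<mu>' \<mu>)"

definition kullback_leibler :: "'x measure \<Rightarrow> ('v \<Rightarrow> 'x \<Rightarrow> real) \<Rightarrow> 'v \<Rightarrow> 'v \<Rightarrow> real" where
  "kullback_leibler \<Lambda> p \<mu>' \<mu> = (\<integral>x. ln (p \<mu>' x / p \<mu> x) \<partial>(model_measure \<Lambda> p \<mu>'))"

definition estimator ::
  "'x measure \<Rightarrow> (real ^ 'm::finite) set \<Rightarrow> (nat \<Rightarrow> (nat \<Rightarrow> 'x) \<Rightarrow> real ^ 'm) \<Rightarrow> bool" where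
  "estimator \<Lambda> M e \<longleftrightarrow>
     (\<forall>n. e n \<in> borel_measurable (Pi\<^sub>M {1..n} (\<lambda>_. \<Lambda>)) \<and> (\<forall>x\<in>space (Pi\<^sub>M {1..n} (\<lambda>_. \<Lambda>)). e n x \<in> M))"

text \<open>Sample sizes start at \<open>3\<close>, so that \<open>ln (ln n)\<close> is positive.\<close>

definition sufficiently_efficient ::
  "'x measure \<Rightarrow> (real ^ 'm::finite \<Rightarrow> 'x \<Rightarrow> real) \<Rightarrow> (real ^ 'm \<Rightarrow> real ^ 'm \<Rightarrow> real) \<Rightarrow> 'm set \<Rightarrow> real ^ 'm
     \<Rightarrow> (real ^ 'm) set \<Rightarrow> (nat \<Rightarrow> (nat \<Rightarrow> 'x) \<Rightarrow> real ^ 'm) \<Rightarrow> (nat \<Rightarrow> (nat \<Rightarrow> 'x) \<Rightarrow> real ^ 'm) \<Rightarrow> bool" where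
  "sufficiently_efficient \<Lambda> p d F \<nu> M1 e0 e1 \<longleftrightarrow>
     (\<forall>K. cinecsi K M1 \<longrightarrow>
       (\<exists>C>0. \<exists>C'>0. \<forall>n\<ge>3.
          (SUP \<mu>\<in>K. sample_expectation \<Lambda> p \<mu> n (\<lambda>x. d (proj0 F \<nu> \<mu>) (e0 n x)))
            \<le> ennreal C * (SUP \<mu>\<in>K. sample_expectation \<Lambda> p \<mu> n (\<lambda>x. d \<mu> (e1 n x))) \<and>
          ennreal C * (SUP \<mu>\<in>K. sample_expectation \<Lambda> p \<mu> n (\<lambda>x. d \<mu> (e1 n x)))
            \<le> ennreal (C' / real n)))"


section \<open>Bayes marginals and the switch criterion\<close>

definition positive_prior :: "'v::topological_space measure \<Rightarrow> 'v set \<Rightarrow> ('v \<Rightarrow> real) \<Rightarrow> bool" where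
  "positive_prior Q S \<omega> \<longleftrightarrow>
     continuous_on S \<omega> \<and> (\<forall>\<mu>\<in>S. 0 < \<omega> \<mu>) \<and> (\<integral>\<^sup>+\<mu>\<in>S. ennreal (\<omega> \<mu>) \<partial>Q) = 1"

definition bayes1 ::
  "(real ^ 'm::finite \<Rightarrow> 'x \<Rightarrow> real) \<Rightarrow> (real ^ 'm) set \<Rightarrow> (real ^ 'm \<Rightarrow> real)
     \<Rightarrow> nat \<Rightarrow> (nat \<Rightarrow> 'x) \<Rightarrow> ennreal" where
  "bayes1 p M1 \<omega>1 n x = (\<integral>\<^sup>+\<mu>\<in>M1. ennreal (\<omega>1 \<mu> * likelihood p \<mu> n x) \<partial>lborel)"

definition bayes0 ::
  "(real ^ 'm::finite \<Rightarrow> 'x \<Rightarrow> real) \<Rightarrow> 'm set \<Rightarrow> real ^ 'm \<Rightarrow> (real ^ 'm) set \<Rightarrow> (real ^ 'm \<Rightarrow> real)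
     \<Rightarrow> nat \<Rightarrow> (nat \<Rightarrow> 'x) \<Rightarrow> ennreal" where
  "bayes0 p F \<nu> M0 \<omega>0 n x =
     (if F = {} then ennreal (likelihood p \<nu> n x)
      else \<integral>\<^sup>+\<mu>\<in>restrict_coords F ` M0. ennreal (\<omega>0 \<mu> * likelihood p (proj0 F \<nu> \<mu>) n x)
             \<partial>lborel_coords F)"

definition switch_component ::
  "(nat \<Rightarrow> (nat \<Rightarrow> 'x) \<Rightarrow> ennreal) \<Rightarrow> (nat \<Rightarrow> (nat \<Rightarrow> 'x) \<Rightarrow> ennreal)
     \<Rightarrow> nat \<Rightarrow> nat \<Rightarrow> (nat \<Rightarrow> 'x) \<Rightarrow> ennreal" where
  "switch_component pB0 pB1 t n x =
     (if t \<le> n then pB0 (t - 1) x * (pB1 n x / pB1 (t - 1) x) else pB0 n x)"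

definition switch_distribution ::
  "nat pmf \<Rightarrow> (nat \<Rightarrow> (nat \<Rightarrow> 'x) \<Rightarrow> ennreal) \<Rightarrow> (nat \<Rightarrow> (nat \<Rightarrow> 'x) \<Rightarrow> ennreal)
     \<Rightarrow> nat \<Rightarrow> (nat \<Rightarrow> 'x) \<Rightarrow> ennreal" where
  "switch_distribution \<pi> pB0 pB1 n x =
     (\<Sum>k. ennreal (pmf \<pi> (Suc k)) * switch_component pB0 pB1 (Suc k) n x)"

definition switch_criterion ::
  "nat pmf \<Rightarrow> (nat \<Rightarrow> (nat \<Rightarrow> 'x) \<Rightarrow> ennreal) \<Rightarrow> (nat \<Rightarrow> (nat \<Rightarrow> 'x) \<Rightarrow> ennreal)
     \<Rightarrow> nat \<Rightarrow> (nat \<Rightarrow> 'x) \<Rightarrow> nat" where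
  "switch_criterion \<pi> pB0 pB1 n x =
     (if switch_distribution \<pi> pB0 pB1 n x / pB0 n x > 1 then 1 else 0)"

definition post_selection_risk ::
  "'x measure \<Rightarrow> (real ^ 'm::finite \<Rightarrow> 'x \<Rightarrow> real) \<Rightarrow> (real ^ 'm \<Rightarrow> real ^ 'm \<Rightarrow> real)
     \<Rightarrow> (nat \<Rightarrow> (nat \<Rightarrow> 'x) \<Rightarrow> real ^ 'm) \<Rightarrow> (nat \<Rightarrow> (nat \<Rightarrow> 'x) \<Rightarrow> real ^ 'm)
     \<Rightarrow> real ^ 'm \<Rightarrow> (nat \<Rightarrow> (nat \<Rightarrow> 'x) \<Rightarrow> nat) \<Rightarrow> nat \<Rightarrow> ennreal" where
  "post_selection_risk \<Lambda> p d e0 e1 \<mu> \<delta> n =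
     sample_expectation \<Lambda> p \<mu> n (\<lambda>x. d \<mu> (if \<delta> n x = 0 then e0 n x else e1 n x))"

end

theory Submission
  imports Defs
begin

text \<open>
  Write \<open>\<Delta> = \<parallel>\<mu> - \<Pi>\<^sub>0 \<mu>\<parallel>\<close>. Every loss satisfies \<open>d(\<mu>, \<mu>') \<le> A (\<Delta>\<^sup>2 + d(\<Pi>\<^sub>0 \<mu>, \<mu>'))\<close> uniformly on
  compact sets, so by efficiency of the estimators the risk is \<open>O(1/n) + A \<Delta>\<^sup>2 P(\<delta>\<^sub>s\<^sub>w = 0)\<close>, and only
  the case \<open>n \<Delta>\<^sup>2 \<ge> A' ln (ln n)\<close> is of interest. Let \<open>t = 2\<^sup>i\<close> be the switch point with
  \<open>n/4 < t \<le> n/2\<close> and suppose that the sums of \<open>\<phi>(X\<^sub>i) - \<mu>\<close> over \<open>i < t\<close> and over \<open>i \<le> n\<close> are both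
  at most \<open>s n \<Delta>\<close> for a small constant \<open>s\<close>. Then, deterministically: on the block from \<open>t\<close> to \<open>n\<close>
  every element of \<open>M\<^sub>0\<close> has likelihood at most \<open>exp (- c n \<Delta>\<^sup>2)\<close> times that of \<open>\<mu>\<close>, because it is
  at distance at least \<open>\<Delta>\<close> from \<open>\<mu>\<close>; the Bayes marginals \<open>p\<^sub>B\<^sub>,\<^sub>1\<close> of both initial segments, relative
  to \<open>p\<^sub>\<mu>\<close>, are of order \<open>n\<close> to the power \<open>- m\<^sub>1/2\<close> up to factors \<open>exp (\<plusminus> C s n \<Delta>\<^sup>2)\<close>, so the powers of
  \<open>n\<close> cancel in the conditional density; and \<open>\<pi>(t)\<close> is at least of order \<open>(ln n)\<close> to the power
  \<open>- \<kappa>\<close>. Hence \<open>\<delta>\<^sub>s\<^sub>w = 1\<close>. By Chebyshev the exceptional event has probability \<open>O(1/(n \<Delta>\<^sup>2))\<close>.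
\<close>

section \<open>Analytic preliminaries\<close>

text \<open>Chebyshev suffices because the probability of the exceptional event is multiplied by
  \<open>\<Delta>\<^sup>2\<close> in the risk: the product is O(1/n) whatever \<Delta> is. The
  factor log log n is due to \<pi>(t) alone, being the logarithm of a power of ln n. Cutting at a
  fixed fraction of n makes this possible: the block keeps a gain exponential in
  \<open>n \<Delta>\<^sup>2\<close>, and the initial segment is long enough for its marginal to
  carry the same power of n as that of the whole sample.

  Uniformity shapes the estimates. The true parameter and its projection stay in a compact set, but
  the estimates, the elements of M0 and the integration variable of the marginals range over all of
  their models, and \<Theta> need be neither convex nor the full natural domain. Most bounds
  therefore have one argument in a compact set and one free, and rest on a lower bound for the
  Bregman divergence that is quadratic nearby and linear far away.

  The exceptional event is never formed as a set: the loss is bounded pointwise by a measurable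
  majorant that contains the squared deviations, and only the majorant is integrated.\<close>

lemma exp_taylor2:
  fixes y :: real
  shows "y\<^sup>2 / 2 * exp (- \<bar>y\<bar>) \<le> exp y - 1 - y" "exp y - 1 - y \<le> y\<^sup>2 / 2 * exp \<bar>y\<bar>"
proof -
  obtain t where t: "\<bar>t\<bar> \<le> \<bar>y\<bar>" "exp y = (\<Sum>m<2. y ^ m / fact m) + exp t / fact 2 * y ^ 2"
    using Maclaurin_exp_le[of y 2] by blast
  have eq: "exp y - 1 - y = y\<^sup>2 / 2 * exp t"
    using t(2) by (simp add: numeral_2_eq_2)
  show "y\<^sup>2 / 2 * exp (- \<bar>y\<bar>) \<le> exp y - 1 - y" "exp y - 1 - y \<le> y\<^sup>2 / 2 * exp \<bar>y\<bar>"
    unfolding eq using t(1) by (auto intro!: mult_left_mono)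
qed

text \<open>Rescaling by \<open>1 / c\<close> maps the simple functions below \<open>c * f\<close>
  to simple functions below \<open>f\<close>. No measurability of \<open>f\<close> enters, so a
  likelihood can be pulled out of a Bayes marginal without first proving its integrand measurable in
  the parameter.\<close>

lemma nn_integral_cmult_le:
  fixes f :: "'a \<Rightarrow> ennreal"
  assumes "0 < c"
  shows "(\<integral>\<^sup>+x. ennreal c * f x \<partial>M) \<le> ennreal c * (\<integral>\<^sup>+x. f x \<partial>M)"
  unfolding nn_integral_def[of M "\<lambda>x. ennreal c * f x"]
proof (rule SUP_least, clarify)
  fix g :: "'a \<Rightarrow> ennreal"
  assume g: "simple_function M g" "g \<le> (\<lambda>x. ennreal c * f x)"
  have cc: "ennreal c * (ennreal (1 / c) * z) = z" for z :: ennreal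
    using assms by (simp add: mult.assoc[symmetric] ennreal_mult'[symmetric])
  have cc': "ennreal (1 / c) * (ennreal c * z) = z" for z :: ennreal
    using assms by (simp add: mult.assoc[symmetric] ennreal_mult'[symmetric])
  have s: "simple_function M (\<lambda>x. ennreal (1 / c) * g x)"
    using g(1) by (intro simple_function_mult) auto
  have "integral\<^sup>S M g = integral\<^sup>S M (\<lambda>x. ennreal c * (ennreal (1 / c) * g x))"
    by (simp add: cc)
  also have "\<dots> = ennreal c * integral\<^sup>S M (\<lambda>x. ennreal (1 / c) * g x)"
    by (rule simple_integral_mult[OF s])
  also have "integral\<^sup>S M (\<lambda>x. ennreal (1 / c) * g x) = (\<integral>\<^sup>+x. ennreal (1 / c) * g x \<partial>M)"
    by (rule nn_integral_eq_simple_integral[symmetric, OF s])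
  also have "\<dots> \<le> (\<integral>\<^sup>+x. f x \<partial>M)"
  proof (rule nn_integral_mono)
    fix x
    have "ennreal (1 / c) * g x \<le> ennreal (1 / c) * (ennreal c * f x)"
      using g(2) by (intro mult_left_mono) (auto simp: le_fun_def)
    then show "ennreal (1 / c) * g x \<le> f x" by (simp add: cc')
  qed
  finally show "integral\<^sup>S M g \<le> ennreal c * (\<integral>\<^sup>+x. f x \<partial>M)"
    by (simp add: mult_left_mono)
qed

lemma compact_uniform_constant:
  fixes T :: "'a::metric_space set" and P :: "real \<Rightarrow> 'a \<Rightarrow> bool"
  assumes T: "compact T"
    and loc: "\<And>x. x \<in> T \<Longrightarrow> \<exists>e>0. \<exists>k>0. \<forall>y\<in>ball x e. P k y"
    and anti: "\<And>k k' y. P k y \<Longrightarrow> 0 < k' \<Longrightarrow> k' \<le> k \<Longrightarrow> P k' y"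
  shows "\<exists>k>0. \<forall>y\<in>T. P k y"
proof -
  obtain e k where ek: "\<And>x. x \<in> T \<Longrightarrow> 0 < e x \<and> 0 < k x \<and> (\<forall>y\<in>ball x (e x). P (k x) y)"
    using loc by metis
  have "T \<subseteq> (\<Union>x\<in>T. ball x (e x))" using ek by force
  then obtain C where C: "C \<subseteq> T" "finite C" "T \<subseteq> (\<Union>x\<in>C. ball x (e x))"
    using compactE_image[OF T, of T "\<lambda>x. ball x (e x)"] by auto
  \<comment> \<open>The element 1 keeps the minimum defined when \<open>T\<close>, and with it the
    finite subcover, is empty.\<close>
  define k0 where "k0 = Min (insert 1 (k ` C))"
  have k0: "0 < k0" unfolding k0_def using C ek by (subst Min_gr_iff) auto
  have "P k0 y" if y: "y \<in> T" for y
  proof -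
    obtain x where x: "x \<in> C" "y \<in> ball x (e x)" using C(3) y by blast
    have "k0 \<le> k x" unfolding k0_def using x C(2) by (intro Min_le) auto
    then show ?thesis using anti[OF _ k0] ek[of x] x C(1) by blast
  qed
  then show ?thesis using k0 by blast
qed

text \<open>The integrand factors over the basis, and each factor is a multiple of the normal
  density with variance \<open>1 / (2 * \<alpha>)\<close>.\<close>

lemma gaussian_nn_integral_finite:
  assumes "0 < \<alpha>"
  shows "(\<integral>\<^sup>+(x::'a::euclidean_space). ennreal (exp (- \<alpha> * (norm x)\<^sup>2)) \<partial>lborel) < \<infinity>"
proof -
  define \<sigma> where "\<sigma> = sqrt (1 / (2 * \<alpha>))"
  have \<sigma>: "0 < \<sigma>" "\<sigma>\<^sup>2 = 1 / (2 * \<alpha>)" using assms by (auto simp: \<sigma>_def)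
  have one: "(\<integral>\<^sup>+(x::real). ennreal (exp (- \<alpha> * x\<^sup>2)) \<partial>lborel) < \<infinity>"
  proof -
    have "integrable lborel (\<lambda>x. sqrt (2 * pi * \<sigma>\<^sup>2) * normal_density 0 \<sigma> x)"
      using integrable_normal_density[OF \<sigma>(1)] by simp
    also have "(\<lambda>x. sqrt (2 * pi * \<sigma>\<^sup>2) * normal_density 0 \<sigma> x) = (\<lambda>x. exp (- \<alpha> * x\<^sup>2))"
      using \<sigma> assms by (auto simp: normal_density_def fun_eq_iff)
    finally have "integrable lborel (\<lambda>x::real. exp (- \<alpha> * x\<^sup>2))" .
    then show ?thesis by (simp add: integrable_iff_bounded)
  qed
  have "(\<integral>\<^sup>+(x::'a). ennreal (exp (- \<alpha> * (norm x)\<^sup>2)) \<partial>lborel) =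
        (\<integral>\<^sup>+(x::'a). (\<Prod>b\<in>Basis. ennreal (exp (- \<alpha> * (x \<bullet> b)\<^sup>2))) \<partial>lborel)"
  proof (rule nn_integral_cong)
    fix x :: 'a
    have "(norm x)\<^sup>2 = (\<Sum>b\<in>Basis. (x \<bullet> b)\<^sup>2)"
      unfolding power2_norm_eq_inner by (subst euclidean_inner) (simp add: power2_eq_square)
    then have "exp (- \<alpha> * (norm x)\<^sup>2) = (\<Prod>b\<in>Basis. exp (- \<alpha> * (x \<bullet> b)\<^sup>2))"
      by (simp add: sum_distrib_left exp_sum sum_negf[symmetric])
    then show "ennreal (exp (- \<alpha> * (norm x)\<^sup>2)) = (\<Prod>b\<in>Basis. ennreal (exp (- \<alpha> * (x \<bullet> b)\<^sup>2)))"
      by (simp add: prod_ennreal)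
  qed
  also have "\<dots> = (\<Prod>b\<in>(Basis :: 'a set). (\<integral>\<^sup>+x. ennreal (exp (- \<alpha> * x\<^sup>2)) \<partial>lborel))"
    by (rule nn_integral_lborel_prod) auto
  also have "\<dots> < \<infinity>" using one by (simp add: power_less_top_ennreal)
  finally show ?thesis .
qed

text \<open>The substitution \<open>x = c + y / sqrt n\<close>. This is the source of the power of n
  in the upper bound for the marginals.\<close>

lemma gaussian_nn_integral_scaled:
  fixes c :: "'a::euclidean_space"
  assumes "0 < \<alpha>" "0 < n"
  shows "(\<integral>\<^sup>+x. ennreal (exp (- \<alpha> * n * (norm (x - c))\<^sup>2)) \<partial>lborel) =
    ennreal ((1 / sqrt n) ^ DIM('a)) * (\<integral>\<^sup>+(x::'a). ennreal (exp (- \<alpha> * (norm x)\<^sup>2)) \<partial>lborel)"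
proof -
  have s: "1 / sqrt n \<noteq> 0" "0 \<le> 1 / sqrt n" using assms by auto
  have "(\<integral>\<^sup>+x. ennreal (exp (- \<alpha> * n * (norm (x - c))\<^sup>2)) \<partial>lborel) =
     (\<integral>\<^sup>+x. ennreal (exp (- \<alpha> * n * (norm (x - c))\<^sup>2)) \<partial>(density (distr lborel borel (\<lambda>x::'a. c + (1 / sqrt n) *\<^sub>R x)) (\<lambda>_. ennreal (\<bar>1 / sqrt n\<bar>^DIM('a)))))"
    using lborel_affine[OF s(1), of c] by simp
  also have "\<dots> = ennreal ((1 / sqrt n) ^ DIM('a)) * (\<integral>\<^sup>+(x::'a). ennreal (exp (- \<alpha> * n * (norm ((1 / sqrt n) *\<^sub>R x))\<^sup>2)) \<partial>lborel)"
    using s by (simp add: nn_integral_density nn_integral_distr nn_integral_cmult)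
  also have "(\<lambda>x::'a. exp (- \<alpha> * n * (norm ((1 / sqrt n) *\<^sub>R x))\<^sup>2)) = (\<lambda>x. exp (- \<alpha> * (norm x)\<^sup>2))"
    using assms by (auto simp: fun_eq_iff power_mult_distrib power_divide)
  finally show ?thesis .
qed

text \<open>The inequality y \<le> exp y at \<open>y = e * t / j\<close>, raised to the power j. It
  lets a small part of an exponential moment absorb any polynomial factor.\<close>

lemma power_le_exp:
  fixes e t :: real
  assumes "0 < e" "0 \<le> t" "0 < j"
  shows "t ^ j \<le> (real j / e) ^ j * exp (e * t)"
proof -
  have "e * t / j \<le> exp (e * t / j)" using exp_ge_add_one_self[of "e * t / j"] by linarith
  then have "(e * t / j) ^ j \<le> exp (e * t / j) ^ j"
    using assms by (intro power_mono) auto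
  also have "\<dots> = exp (e * t)" using assms by (simp add: exp_of_nat_mult[symmetric])
  finally have "(real j / e) ^ j * (e * t / j) ^ j \<le> (real j / e) ^ j * exp (e * t)"
    using assms by (intro mult_left_mono) auto
  then show ?thesis using assms by (simp add: power_mult_distrib[symmetric])
qed

lemma has_derivative_at_quadratic:
  fixes f :: "'a::real_normed_vector \<Rightarrow> 'b::real_normed_vector"
  assumes L: "bounded_linear L" and e: "0 < e"
    and b: "\<And>u. norm u < e \<Longrightarrow> norm (f (x + u) - f x - L u) \<le> K * (norm u)\<^sup>2"
  shows "(f has_derivative L) (at x)"
  unfolding has_derivative_at
proof (intro conjI L)
  have lim: "((\<lambda>h::'a. \<bar>K\<bar> * norm h) \<longlongrightarrow> 0) (at 0)"
    by (intro tendsto_mult_right_zero tendsto_norm_zero tendsto_ident_at)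
  show "((\<lambda>h. norm (f (x + h) - f x - L h) / norm h) \<longlongrightarrow> 0) (at 0)"
  proof (rule Lim_null_comparison[OF _ lim])
    show "\<forall>\<^sub>F h in at 0. norm (norm (f (x + h) - f x - L h) / norm h) \<le> \<bar>K\<bar> * norm h"
      unfolding eventually_at
    proof (intro exI[of _ e] conjI e ballI impI)
      fix h :: 'a assume h: "h \<noteq> 0 \<and> dist h 0 < e"
      then have "norm (f (x + h) - f x - L h) \<le> K * (norm h)\<^sup>2" using b by simp
      also have "\<dots> \<le> \<bar>K\<bar> * (norm h)\<^sup>2" by (intro mult_right_mono) auto
      finally show "norm (norm (f (x + h) - f x - L h) / norm h) \<le> \<bar>K\<bar> * norm h"
        using h by (simp add: divide_le_eq power2_eq_square mult.assoc)
    qed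
  qed
qed

lemma nn_integral_cmult_pos:
  fixes f :: "'a \<Rightarrow> ennreal"
  assumes c: "0 < c"
  shows "(\<integral>\<^sup>+x. ennreal c * f x \<partial>M) = ennreal c * (\<integral>\<^sup>+x. f x \<partial>M)"
proof (rule antisym)
  show "(\<integral>\<^sup>+x. ennreal c * f x \<partial>M) \<le> ennreal c * (\<integral>\<^sup>+x. f x \<partial>M)" by (rule nn_integral_cmult_le[OF c])
  have cc: "ennreal c * (ennreal (1 / c) * z) = z" "ennreal (1 / c) * (ennreal c * z) = z" for z :: ennreal
    using c by (simp_all add: mult.assoc[symmetric] ennreal_mult'[symmetric])
  have "(\<integral>\<^sup>+x. f x \<partial>M) = (\<integral>\<^sup>+x. ennreal (1 / c) * (ennreal c * f x) \<partial>M)" by (simp only: cc)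
  also have "\<dots> \<le> ennreal (1 / c) * (\<integral>\<^sup>+x. ennreal c * f x \<partial>M)" using c by (intro nn_integral_cmult_le) simp
  finally have "ennreal c * (\<integral>\<^sup>+x. f x \<partial>M) \<le> ennreal c * (ennreal (1 / c) * (\<integral>\<^sup>+x. ennreal c * f x \<partial>M))"
    by (rule mult_left_mono) simp
  then show "ennreal c * (\<integral>\<^sup>+x. f x \<partial>M) \<le> (\<integral>\<^sup>+x. ennreal c * f x \<partial>M)" by (simp only: cc)
qed

lemma second_moment_sum:
  fixes f :: "'a \<Rightarrow> real"
  assumes N: "prob_space N" and I: "finite I" and J: "J \<subseteq> I"
    and f: "integrable N f" "(\<integral>x. f x \<partial>N) = 0" and f2: "integrable N (\<lambda>x. (f x)\<^sup>2)"
  shows "integrable (Pi\<^sub>M I (\<lambda>_. N)) (\<lambda>x. (\<Sum>i\<in>J. f (x i))\<^sup>2)"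
    "(\<integral>x. (\<Sum>i\<in>J. f (x i))\<^sup>2 \<partial>Pi\<^sub>M I (\<lambda>_. N)) = card J * (\<integral>x. (f x)\<^sup>2 \<partial>N)"
proof -
  interpret N: prob_space N by fact
  interpret P: product_prob_space "\<lambda>_. N" I by unfold_locales
  have fin: "finite J" using J I by (rule finite_subset)
  have *: "integrable (Pi\<^sub>M I (\<lambda>_. N)) (\<lambda>x. f (x i) * f (x k))"
    "(\<integral>x. f (x i) * f (x k) \<partial>Pi\<^sub>M I (\<lambda>_. N)) = (if i = k then \<integral>x. (f x)\<^sup>2 \<partial>N else 0)"
    if ik: "i \<in> J" "k \<in> J" for i k
  proof -
    \<comment> \<open>Turns the product of two factors into a product over all of \<open>I\<close>:
      the factor at l is f, f squared or 1, according to how often l occurs among i and k. The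
      diagonal and off-diagonal terms then share one argument.\<close>
    define g where "g l y = (if l = i then f y else 1) * (if l = k then f y else 1)" for l y
    have eq: "f (x i) * f (x k) = (\<Prod>l\<in>I. g l (x l))" for x
      using ik J I unfolding g_def by (subst prod.distrib) (auto simp: prod.delta)
    have ig: "integrable N (g l)" for l
      using f(1) f2 by (cases "l = i"; cases "l = k") (auto simp: g_def[abs_def] power2_eq_square)
    show "integrable (Pi\<^sub>M I (\<lambda>_. N)) (\<lambda>x. f (x i) * f (x k))"
      unfolding eq by (rule P.product_integrable_prod[OF I ig])
    have "(\<integral>x. f (x i) * f (x k) \<partial>Pi\<^sub>M I (\<lambda>_. N)) = (\<Prod>l\<in>I. \<integral>y. g l y \<partial>N)"
      unfolding eq by (rule P.product_integral_prod[OF I ig])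
    also have "\<dots> = (if i = k then \<integral>x. (f x)\<^sup>2 \<partial>N else 0)"
    proof (cases "i = k")
      case True
      have "(\<integral>y. g l y \<partial>N) = (if l = i then \<integral>x. (f x)\<^sup>2 \<partial>N else 1)" for l
        using True by (simp add: g_def power2_eq_square N.prob_space)
      then show ?thesis using True ik J I by (auto simp: prod.delta)
    next
      case False
      have "(\<integral>y. g i y \<partial>N) = 0" using False f(2) by (simp add: g_def)
      then show ?thesis using False ik J I by (auto intro!: prod_zero)
    qed
    finally show "(\<integral>x. f (x i) * f (x k) \<partial>Pi\<^sub>M I (\<lambda>_. N)) = (if i = k then \<integral>x. (f x)\<^sup>2 \<partial>N else 0)" .
  qed
  have sq: "(\<Sum>i\<in>J. f (x i))\<^sup>2 = (\<Sum>i\<in>J. \<Sum>k\<in>J. f (x i) * f (x k))" for x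
    by (simp add: power2_eq_square sum_product)
  show "integrable (Pi\<^sub>M I (\<lambda>_. N)) (\<lambda>x. (\<Sum>i\<in>J. f (x i))\<^sup>2)"
    unfolding sq using * by (intro Bochner_Integration.integrable_sum) auto
  have "(\<integral>x. (\<Sum>i\<in>J. f (x i))\<^sup>2 \<partial>Pi\<^sub>M I (\<lambda>_. N)) = (\<Sum>i\<in>J. \<Sum>k\<in>J. if i = k then \<integral>x. (f x)\<^sup>2 \<partial>N else 0)"
    unfolding sq using *
    by (subst Bochner_Integration.integral_sum, force)
      (intro sum.cong refl, subst Bochner_Integration.integral_sum, auto)
  then show "(\<integral>x. (\<Sum>i\<in>J. f (x i))\<^sup>2 \<partial>Pi\<^sub>M I (\<lambda>_. N)) = card J * (\<integral>x. (f x)\<^sup>2 \<partial>N)"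
    using fin by (simp add: sum.delta)
qed

lemma (in prob_space) nn_integral_affine:
  fixes f1 f2 f3 f4 :: "'a \<Rightarrow> ennreal"
  assumes [measurable]: "f1 \<in> borel_measurable M" "f2 \<in> borel_measurable M" "f3 \<in> borel_measurable M" "f4 \<in> borel_measurable M"
  shows "(\<integral>\<^sup>+x. f1 x + a * f2 x + b + c * (f3 x + f4 x) \<partial>M) =
    (\<integral>\<^sup>+x. f1 x \<partial>M) + a * (\<integral>\<^sup>+x. f2 x \<partial>M) + b + c * ((\<integral>\<^sup>+x. f3 x \<partial>M) + (\<integral>\<^sup>+x. f4 x \<partial>M))"
  by (simp add: nn_integral_add nn_integral_cmult emeasure_space_1)

section \<open>Exponential families in canonical coordinates\<close>

text \<open>The carrier density is already absorbed into \<open>R\<close>, so that members of the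
  family are \<open>exp (\<theta> \<bullet> \<phi> x)\<close> up to normalisation and minimality is
  a statement about \<open>R\<close> alone.\<close>

locale exp_family =
  fixes R :: "'x measure" and \<phi> :: "'x \<Rightarrow> 'v::euclidean_space" and \<Theta> :: "'v set"
  assumes phi_measurable [measurable]: "\<phi> \<in> borel_measurable R"
    and open_Theta: "open \<Theta>"
    and Theta_nonempty: "\<Theta> \<noteq> {}"
    and integrable_exp: "\<And>\<theta>. \<theta> \<in> \<Theta> \<Longrightarrow> integrable R (\<lambda>x. exp (\<theta> \<bullet> \<phi> x))"
    and partition_pos: "\<And>\<theta>. \<theta> \<in> \<Theta> \<Longrightarrow> 0 < (\<integral>x. exp (\<theta> \<bullet> \<phi> x) \<partial>R)"
    and minimal: "\<And>a c. AE x in R. a \<bullet> \<phi> x = c \<Longrightarrow> a = 0"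
begin

text \<open>The set \<open>\<Theta>\<close> need not be convex, so convexity of \<open>psi\<close> is used on the natural parameter domain.\<close>

definition natdom :: "'v set" where "natdom = {\<theta>. integrable R (\<lambda>x. exp (\<theta> \<bullet> \<phi> x))}"
definition psi :: "'v \<Rightarrow> real" where "psi \<theta> = ln (\<integral>x. exp (\<theta> \<bullet> \<phi> x) \<partial>R)"
definition w :: "'v \<Rightarrow> 'x \<Rightarrow> real" where "w \<theta> x = exp (\<theta> \<bullet> \<phi> x - psi \<theta>)"
definition mv :: "'v \<Rightarrow> 'v" where "mv \<theta> = (\<integral>x. w \<theta> x *\<^sub>R \<phi> x \<partial>R)"
text \<open>The Bregman divergence of the log-partition function; \<open>kullback_leibler_eq\<close>
  identifies it with the Kullback-Leibler divergence, its arguments in the same order.\<close>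

definition breg :: "'v \<Rightarrow> 'v \<Rightarrow> real" where "breg \<theta> \<theta>' = psi \<theta>' - psi \<theta> - (\<theta>' - \<theta>) \<bullet> mv \<theta>"
definition var :: "'v \<Rightarrow> 'v \<Rightarrow> real" where "var \<theta> v = (\<integral>x. w \<theta> x * (v \<bullet> (\<phi> x - mv \<theta>))\<^sup>2 \<partial>R)"

text \<open>One constant bounds everything, so that the property is antitone in it and local constants
  can be merged over a compact set.\<close>

definition quad :: "real \<Rightarrow> 'v \<Rightarrow> bool" where
  "quad k \<theta> \<longleftrightarrow> cball \<theta> k \<subseteq> \<Theta> \<and>
     (\<forall>u. norm u \<le> k \<longrightarrow> k * (norm u)\<^sup>2 \<le> breg \<theta> (\<theta> + u) \<and> breg \<theta> (\<theta> + u) \<le> (norm u)\<^sup>2 / k) \<and>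
     (\<forall>v. k * (norm v)\<^sup>2 \<le> var \<theta> v \<and> var \<theta> v \<le> (norm v)\<^sup>2 / k)"

section \<open>Normalised weights and convexity of the log-partition function\<close>

lemma w_measurable [measurable]: "w \<theta> \<in> borel_measurable R"
  unfolding w_def by measurable

lemma w_pos: "0 < w \<theta> x" and w_nonneg [simp]: "0 \<le> w \<theta> x"
  by (auto simp: w_def)

lemma Theta_natdom: "\<Theta> \<subseteq> natdom"
  using integrable_exp by (auto simp: natdom_def)

lemma AE_False: "\<not> (AE x in R. False)"
proof
  assume ae: "AE x in R. False"
  obtain \<theta> where \<theta>: "\<theta> \<in> \<Theta>" using Theta_nonempty by blast
  have "(\<integral>x. exp (\<theta> \<bullet> \<phi> x) \<partial>R) = (\<integral>x. 0 \<partial>R)"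
    using ae by (intro integral_cong_AE) (auto elim: eventually_mono)
  then show False using partition_pos[OF \<theta>] by simp
qed

lemma integral_pos_R:
  fixes f :: "'x \<Rightarrow> real"
  assumes "integrable R f" "\<And>x. 0 < f x"
  shows "0 < (\<integral>x. f x \<partial>R)"
proof -
  have "(\<integral>x. f x \<partial>R) \<noteq> 0"
  proof
    assume "(\<integral>x. f x \<partial>R) = 0"
    then have "AE x in R. f x = 0"
      using integral_nonneg_eq_0_iff_AE[OF assms(1)] assms(2) by (auto intro: less_imp_le)
    then have "AE x in R. False" using assms(2) by (auto elim!: eventually_mono simp: less_le)
    then show False using AE_False by simp
  qed
  moreover have "0 \<le> (\<integral>x. f x \<partial>R)" using assms(2) by (auto intro!: integral_nonneg_AE simp: less_imp_le)
  ultimately show ?thesis by simp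
qed

lemma exp_psi: "\<theta> \<in> natdom \<Longrightarrow> exp (psi \<theta>) = (\<integral>x. exp (\<theta> \<bullet> \<phi> x) \<partial>R)"
  unfolding psi_def natdom_def using integral_pos_R[of "\<lambda>x. exp (\<theta> \<bullet> \<phi> x)"] by simp

lemma w_altdef: "\<theta> \<in> natdom \<Longrightarrow> w \<theta> x = exp (\<theta> \<bullet> \<phi> x) / (\<integral>x. exp (\<theta> \<bullet> \<phi> x) \<partial>R)"
  by (simp add: w_def exp_diff exp_psi)

lemma integrable_w: "\<theta> \<in> natdom \<Longrightarrow> integrable R (w \<theta>)"
  and integral_w: "\<theta> \<in> natdom \<Longrightarrow> (\<integral>x. w \<theta> x \<partial>R) = 1"
proof -
  assume \<theta>: "\<theta> \<in> natdom"
  have i: "integrable R (\<lambda>x. exp (\<theta> \<bullet> \<phi> x))" using \<theta> by (simp add: natdom_def)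
  show "integrable R (w \<theta>)" unfolding w_altdef[OF \<theta>, abs_def] using i by simp
  show "(\<integral>x. w \<theta> x \<partial>R) = 1" unfolding w_altdef[OF \<theta>, abs_def]
    using integral_pos_R[OF i] by simp
qed

lemma w_ratio: "w \<theta>' x = w \<theta> x * exp ((\<theta>' - \<theta>) \<bullet> \<phi> x - (psi \<theta>' - psi \<theta>))"
  by (simp add: w_def exp_add[symmetric] inner_diff_left)

text \<open>Hoelder's inequality, read off from the pointwise convexity of exp. The domination
  \<open>le\<close> does both jobs: it makes the intermediate parameter belong to
  \<open>natdom\<close>, and its integral is the bound on \<open>psi\<close>.\<close>

lemma psi_convex: "convex_on natdom psi"
proof (rule convex_onI)
  have main: "(1 - t) *\<^sub>R x + t *\<^sub>R y \<in> natdom \<and> psi ((1 - t) *\<^sub>R x + t *\<^sub>R y) \<le> (1 - t) * psi x + t * psi y"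
    if t: "0 \<le> t" "t \<le> 1" and xy: "x \<in> natdom" "y \<in> natdom" for t x y
  proof -
    let ?m = "(1 - t) *\<^sub>R x + t *\<^sub>R y" and ?p = "(1 - t) * psi x + t * psi y"
    have le: "exp (?m \<bullet> \<phi> z - ?p) \<le> (1 - t) * w x z + t * w y z" for z
    proof -
      have "?m \<bullet> \<phi> z - ?p = (1 - t) *\<^sub>R (x \<bullet> \<phi> z - psi x) + t *\<^sub>R (y \<bullet> \<phi> z - psi y)"
        by (simp add: inner_add_left algebra_simps)
      then show ?thesis unfolding w_def
        using convex_onD[OF exp_convex, of t "x \<bullet> \<phi> z - psi x" "y \<bullet> \<phi> z - psi y"] t by simp
    qed
    have i: "integrable R (\<lambda>z. (1 - t) * w x z + t * w y z)"
      using integrable_w xy by auto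
    have i2: "integrable R (\<lambda>z. exp (?m \<bullet> \<phi> z - ?p))"
      by (rule Bochner_Integration.integrable_bound[OF i]) (use le t in auto)
    then have "integrable R (\<lambda>z. exp ?p * exp (?m \<bullet> \<phi> z - ?p))" by simp
    then have dom: "?m \<in> natdom" by (simp add: natdom_def exp_diff)
    have "exp (psi ?m) / exp ?p = (\<integral>z. exp (?m \<bullet> \<phi> z - ?p) \<partial>R)"
      by (simp add: exp_psi[OF dom] exp_diff)
    also have "\<dots> \<le> (\<integral>z. (1 - t) * w x z + t * w y z \<partial>R)"
      by (rule integral_mono[OF i2 i le])
    also have "\<dots> = 1" using xy by (simp add: integrable_w integral_w)
    finally have "exp (psi ?m) \<le> exp ?p" by (simp add: divide_le_eq)
    then show ?thesis using dom by simp
  qed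
  show "psi ((1 - t) *\<^sub>R x + t *\<^sub>R y) \<le> (1 - t) * psi x + t * psi y"
    if "0 < t" "t < 1" "x \<in> natdom" "y \<in> natdom" for t x y using main[of t x y] that by simp
  show "convex natdom"
    unfolding convex_alt using main by blast
qed

section \<open>Exponential and polynomial moments of the statistic\<close>

text \<open>The norm is at most the dimension times the largest coordinate in absolute value. With
  \<open>e = \<epsilon> / DIM('v)\<close> the integrand is thus dominated by the sum of the
  integrable exponentials at the points \<open>\<theta> + \<epsilon> *\<^sub>R b\<close> and
  \<open>\<theta> - \<epsilon> *\<^sub>R b\<close>.\<close>

lemma exponential_moment:
  assumes "\<theta> \<in> \<Theta>"
  obtains e where "0 < e" "cball \<theta> e \<subseteq> \<Theta>" "integrable R (\<lambda>x. exp (\<theta> \<bullet> \<phi> x + e * norm (\<phi> x)))"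
proof -
  obtain \<epsilon> where \<epsilon>: "0 < \<epsilon>" "cball \<theta> \<epsilon> \<subseteq> \<Theta>"
    using open_Theta assms open_contains_cball by blast
  define e where "e = \<epsilon> / DIM('v)"
  have e: "0 < e" "e \<le> \<epsilon>" using \<epsilon>(1) by (auto simp: e_def field_simps)
  have inT: "\<theta> + \<epsilon> *\<^sub>R b \<in> \<Theta>" "\<theta> - \<epsilon> *\<^sub>R b \<in> \<Theta>" if "b \<in> Basis" for b
    using \<epsilon> that by (auto intro!: subsetD[OF \<epsilon>(2)] simp: dist_norm)
  have i: "integrable R (\<lambda>x. \<Sum>b\<in>Basis. exp ((\<theta> + \<epsilon> *\<^sub>R b) \<bullet> \<phi> x) + exp ((\<theta> - \<epsilon> *\<^sub>R b) \<bullet> \<phi> x))"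
    using integrable_exp inT by (intro Bochner_Integration.integrable_sum Bochner_Integration.integrable_add) auto
  have "integrable R (\<lambda>x. exp (\<theta> \<bullet> \<phi> x + e * norm (\<phi> x)))"
  proof (rule Bochner_Integration.integrable_bound[OF i])
    show "AE x in R. norm (exp (\<theta> \<bullet> \<phi> x + e * norm (\<phi> x))) \<le>
      norm (\<Sum>b\<in>Basis. exp ((\<theta> + \<epsilon> *\<^sub>R b) \<bullet> \<phi> x) + exp ((\<theta> - \<epsilon> *\<^sub>R b) \<bullet> \<phi> x))"
    proof (rule AE_I2)
      fix x
      let ?m = "Max ((\<lambda>b. \<bar>\<phi> x \<bullet> b\<bar>) ` Basis)"
      have "?m \<in> (\<lambda>b. \<bar>\<phi> x \<bullet> b\<bar>) ` Basis" by (rule Max_in) auto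
      then obtain b where b: "b \<in> Basis" "?m = \<bar>\<phi> x \<bullet> b\<bar>" by blast
      have "norm (\<phi> x) \<le> (\<Sum>c\<in>Basis. \<bar>\<phi> x \<bullet> c\<bar>)" by (rule norm_le_l1)
      also have "\<dots> \<le> of_nat (card (Basis::'v set)) * \<bar>\<phi> x \<bullet> b\<bar>"
        unfolding b(2)[symmetric] by (rule sum_bounded_above) auto
      finally have n: "e * norm (\<phi> x) \<le> \<epsilon> * \<bar>\<phi> x \<bullet> b\<bar>"
        using \<epsilon>(1) by (auto simp: e_def field_simps)
      have "exp (\<theta> \<bullet> \<phi> x + e * norm (\<phi> x)) \<le> exp (\<theta> \<bullet> \<phi> x + \<epsilon> * \<bar>\<phi> x \<bullet> b\<bar>)" using n by simp
      also have "\<dots> \<le> exp ((\<theta> + \<epsilon> *\<^sub>R b) \<bullet> \<phi> x) + exp ((\<theta> - \<epsilon> *\<^sub>R b) \<bullet> \<phi> x)"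
        by (cases "0 \<le> \<phi> x \<bullet> b") (auto simp: inner_add_left inner_diff_left inner_commute[of b])
      also have "\<dots> \<le> (\<Sum>b\<in>Basis. exp ((\<theta> + \<epsilon> *\<^sub>R b) \<bullet> \<phi> x) + exp ((\<theta> - \<epsilon> *\<^sub>R b) \<bullet> \<phi> x))"
        by (rule member_le_sum[OF b(1)]) auto
      finally show "norm (exp (\<theta> \<bullet> \<phi> x + e * norm (\<phi> x))) \<le>
        norm (\<Sum>b\<in>Basis. exp ((\<theta> + \<epsilon> *\<^sub>R b) \<bullet> \<phi> x) + exp ((\<theta> - \<epsilon> *\<^sub>R b) \<bullet> \<phi> x))" by simp
    qed
  qed auto
  moreover have "cball \<theta> e \<subseteq> \<Theta>" using e \<epsilon>(2) by (meson order_trans subset_cball)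
  ultimately show ?thesis using that e(1) by blast
qed

lemma integrable_poly:
  fixes f :: "'x \<Rightarrow> 'b::{banach, second_countable_topology}"
  assumes \<theta>: "\<theta> \<in> \<Theta>" and f [measurable]: "f \<in> borel_measurable R"
    and b: "\<And>x. norm (f x) \<le> B * (1 + norm (\<phi> x)) ^ j"
  shows "integrable R (\<lambda>x. w \<theta> x *\<^sub>R f x)"
proof -
  obtain e where e: "0 < e" "integrable R (\<lambda>x. exp (\<theta> \<bullet> \<phi> x + e * norm (\<phi> x)))"
    using exponential_moment[OF \<theta>] by blast
  define B' where "B' = \<bar>B\<bar> * (real (Suc j) / e) ^ Suc j * exp e * exp (- psi \<theta>)"
  have B'0: "0 \<le> B'" using e(1) by (simp add: B'_def)
  have "integrable R (\<lambda>x. B' * exp (\<theta> \<bullet> \<phi> x + e * norm (\<phi> x)))" using e by simp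
  then show ?thesis
  proof (rule Bochner_Integration.integrable_bound)
    show "AE x in R. norm (w \<theta> x *\<^sub>R f x) \<le> norm (B' * exp (\<theta> \<bullet> \<phi> x + e * norm (\<phi> x)))"
    proof (rule AE_I2)
      fix x
      \<comment> \<open>The exponent is raised by one because \<open>power_le_exp\<close> needs a
        positive exponent, while j may be 0.\<close>
      have "(1 + norm (\<phi> x)) ^ j \<le> (1 + norm (\<phi> x)) ^ Suc j" by (rule power_increasing) auto
      also have "\<dots> \<le> (real (Suc j) / e) ^ Suc j * exp (e * (1 + norm (\<phi> x)))"
        using power_le_exp[OF e(1), of "1 + norm (\<phi> x)" "Suc j"] by simp
      finally have p: "(1 + norm (\<phi> x)) ^ j \<le> (real (Suc j) / e) ^ Suc j * exp (e * (1 + norm (\<phi> x)))" .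
      have "norm (f x) \<le> \<bar>B\<bar> * (1 + norm (\<phi> x)) ^ j"
        using b[of x] by (rule order_trans) (auto intro!: mult_right_mono)
      also have "\<dots> \<le> \<bar>B\<bar> * ((real (Suc j) / e) ^ Suc j * exp (e * (1 + norm (\<phi> x))))"
        using p by (intro mult_left_mono) auto
      finally have "w \<theta> x * norm (f x) \<le> w \<theta> x * (\<bar>B\<bar> * ((real (Suc j) / e) ^ Suc j * exp (e * (1 + norm (\<phi> x)))))"
        by (intro mult_left_mono) auto
      also have "\<dots> = B' * exp (\<theta> \<bullet> \<phi> x + e * norm (\<phi> x))"
        by (simp add: B'_def w_def exp_add exp_diff exp_minus algebra_simps divide_inverse)
      finally show "norm (w \<theta> x *\<^sub>R f x) \<le> norm (B' * exp (\<theta> \<bullet> \<phi> x + e * norm (\<phi> x)))"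
        using B'0 by simp
    qed
  qed auto
qed

lemma integrable_phi: "\<theta> \<in> \<Theta> \<Longrightarrow> integrable R (\<lambda>x. w \<theta> x *\<^sub>R \<phi> x)"
  by (rule integrable_poly[where B=1 and j=1]) auto

lemma integrable_w_Theta: "\<theta> \<in> \<Theta> \<Longrightarrow> integrable R (w \<theta>)"
  and integral_w_Theta: "\<theta> \<in> \<Theta> \<Longrightarrow> (\<integral>x. w \<theta> x \<partial>R) = 1"
  using integrable_w integral_w Theta_natdom by blast+

lemma centered:
  assumes "\<theta> \<in> \<Theta>"
  shows "integrable R (\<lambda>x. w \<theta> x * (u \<bullet> (\<phi> x - mv \<theta>)))" "(\<integral>x. w \<theta> x * (u \<bullet> (\<phi> x - mv \<theta>)) \<partial>R) = 0"
proof -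
  have eq: "w \<theta> x * (u \<bullet> (\<phi> x - mv \<theta>)) = u \<bullet> (w \<theta> x *\<^sub>R \<phi> x) - w \<theta> x * (u \<bullet> mv \<theta>)" for x
    by (simp add: algebra_simps)
  show "integrable R (\<lambda>x. w \<theta> x * (u \<bullet> (\<phi> x - mv \<theta>)))"
    unfolding eq using integrable_phi[OF assms] integrable_w_Theta[OF assms]
    by (intro Bochner_Integration.integrable_diff integrable_inner_right integrable_mult_left) auto
  have "(\<integral>x. w \<theta> x * (u \<bullet> (\<phi> x - mv \<theta>)) \<partial>R) =
      (\<integral>x. u \<bullet> (w \<theta> x *\<^sub>R \<phi> x) \<partial>R) - (\<integral>x. w \<theta> x * (u \<bullet> mv \<theta>) \<partial>R)"
    unfolding eq using integrable_phi[OF assms] integrable_w_Theta[OF assms]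
    by (intro Bochner_Integration.integral_diff integrable_inner_right integrable_mult_left) auto
  also have "(\<integral>x. u \<bullet> (w \<theta> x *\<^sub>R \<phi> x) \<partial>R) = u \<bullet> mv \<theta>"
    unfolding mv_def using integrable_phi[OF assms] by (intro integral_inner_right) auto
  also have "(\<integral>x. w \<theta> x * (u \<bullet> mv \<theta>) \<partial>R) = u \<bullet> mv \<theta>"
    using integral_w_Theta[OF assms] by simp
  finally show "(\<integral>x. w \<theta> x * (u \<bullet> (\<phi> x - mv \<theta>)) \<partial>R) = 0" by simp
qed

section \<open>Bregman divergence as a cumulant generating function\<close>

text \<open>Tilting the weight at \<theta> by the exponential of the centred statistic gives a
  multiple of the weight at \<theta>', so \<open>breg\<close> is the logarithm of a moment
  generating function. Bounds on \<open>breg\<close> can therefore come from Taylor bounds for exp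
  under the integral.\<close>

lemma exp_breg:
  assumes \<theta>: "\<theta> \<in> \<Theta>" and \<theta>': "\<theta>' \<in> natdom"
  shows "integrable R (\<lambda>x. w \<theta> x * exp ((\<theta>' - \<theta>) \<bullet> (\<phi> x - mv \<theta>)))"
    "(\<integral>x. w \<theta> x * exp ((\<theta>' - \<theta>) \<bullet> (\<phi> x - mv \<theta>)) \<partial>R) = exp (breg \<theta> \<theta>')"
proof -
  have eq: "w \<theta> x * exp ((\<theta>' - \<theta>) \<bullet> (\<phi> x - mv \<theta>)) = exp (breg \<theta> \<theta>') * w \<theta>' x" for x
    by (simp add: w_def breg_def exp_add[symmetric] inner_diff_left inner_diff_right)
  show "integrable R (\<lambda>x. w \<theta> x * exp ((\<theta>' - \<theta>) \<bullet> (\<phi> x - mv \<theta>)))"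
    unfolding eq using integrable_w[OF \<theta>'] by simp
  show "(\<integral>x. w \<theta> x * exp ((\<theta>' - \<theta>) \<bullet> (\<phi> x - mv \<theta>)) \<partial>R) = exp (breg \<theta> \<theta>')"
    unfolding eq using integral_w[OF \<theta>'] by simp
qed

text \<open>The inequality exp y \<ge> 1 + y, integrated with y centred. The second argument is
  taken from \<open>natdom\<close> and not from \<Theta> because midpoints can leave
  \<Theta>.\<close>

lemma breg_nonneg:
  assumes \<theta>: "\<theta> \<in> \<Theta>" and \<theta>': "\<theta>' \<in> natdom"
  shows "0 \<le> breg \<theta> \<theta>'"
proof -
  have "1 = (\<integral>x. w \<theta> x + w \<theta> x * ((\<theta>' - \<theta>) \<bullet> (\<phi> x - mv \<theta>)) \<partial>R)"
    using centered[OF \<theta>] integrable_w_Theta[OF \<theta>] integral_w_Theta[OF \<theta>] by simp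
  also have "\<dots> \<le> (\<integral>x. w \<theta> x * exp ((\<theta>' - \<theta>) \<bullet> (\<phi> x - mv \<theta>)) \<partial>R)"
  proof (rule integral_mono)
    show "w \<theta> x + w \<theta> x * ((\<theta>' - \<theta>) \<bullet> (\<phi> x - mv \<theta>)) \<le> w \<theta> x * exp ((\<theta>' - \<theta>) \<bullet> (\<phi> x - mv \<theta>))" for x
      using mult_left_mono[OF exp_ge_add_one_self, of "w \<theta> x" "(\<theta>' - \<theta>) \<bullet> (\<phi> x - mv \<theta>)"]
      by (simp add: algebra_simps)
  qed (use centered[OF \<theta>] integrable_w_Theta[OF \<theta>] exp_breg(1)[OF \<theta> \<theta>'] in auto)
  also have "\<dots> = exp (breg \<theta> \<theta>')" by (rule exp_breg[OF \<theta> \<theta>'])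
  finally show ?thesis by simp
qed

section \<open>Local quadratic bounds, uniform on compact sets\<close>

text \<open>The bound has to be uniform in the centre m. With an additional coordinate -1 in the
  statistic, \<open>v \<bullet> (\<phi> x - m)\<close> becomes the pairing with
  \<open>(v, v \<bullet> m)\<close>, whose last entry is treated as free in a bounded interval. The
  resulting form is continuous on a compact set, and a zero of it would be an affine relation
  between the components of \<phi>, excluded by minimality.\<close>

lemma weighted_quadratic_form_pos:
  assumes W [measurable]: "W \<in> borel_measurable R" and pos: "\<And>x. 0 < W x"
    and int: "integrable R (\<lambda>x. W x * (1 + norm (\<phi> x))\<^sup>2)" and B: "0 \<le> B"
  shows "\<exists>q>0. \<forall>v m. norm m \<le> B \<longrightarrow> q * (norm v)\<^sup>2 \<le> (\<integral>x. W x * (v \<bullet> (\<phi> x - m))\<^sup>2 \<partial>R)"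
proof -
  define \<Phi> :: "'x \<Rightarrow> 'v \<times> real" where "\<Phi> x = (\<phi> x, -1)" for x
  have [measurable]: "\<Phi> \<in> borel_measurable R" unfolding \<Phi>_def by measurable
  have nPhi: "norm (\<Phi> x) \<le> 1 + norm (\<phi> x)" for x
    unfolding \<Phi>_def using norm_Pair_le[of "\<phi> x" "-1::real"] by simp
  define T where "T z = (\<integral>x. (W x * (z \<bullet> \<Phi> x)) *\<^sub>R \<Phi> x \<partial>R)" for z
  define Q where "Q z = (\<integral>x. W x * (z \<bullet> \<Phi> x)\<^sup>2 \<partial>R)" for z
  have iT: "integrable R (\<lambda>x. (W x * (z \<bullet> \<Phi> x)) *\<^sub>R \<Phi> x)" for z
  proof (rule Bochner_Integration.integrable_bound)
    show "integrable R (\<lambda>x. norm z * (W x * (1 + norm (\<phi> x))\<^sup>2))" using int by simp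
    show "AE x in R. norm ((W x * (z \<bullet> \<Phi> x)) *\<^sub>R \<Phi> x) \<le> norm (norm z * (W x * (1 + norm (\<phi> x))\<^sup>2))"
    proof (rule AE_I2)
      fix x
      have "norm ((W x * (z \<bullet> \<Phi> x)) *\<^sub>R \<Phi> x) = W x * (\<bar>z \<bullet> \<Phi> x\<bar> * norm (\<Phi> x))"
        using pos[of x] by (simp add: abs_mult)
      also have "\<dots> \<le> W x * ((norm z * (1 + norm (\<phi> x))) * (1 + norm (\<phi> x)))"
        using pos[of x] nPhi[of x]
        by (intro mult_left_mono mult_mono order_trans[OF Cauchy_Schwarz_ineq2]) auto
      finally show "norm ((W x * (z \<bullet> \<Phi> x)) *\<^sub>R \<Phi> x) \<le> norm (norm z * (W x * (1 + norm (\<phi> x))\<^sup>2))"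
        using pos[of x] by (simp add: power2_eq_square algebra_simps)
    qed
  qed measurable
  have QT: "Q z = z \<bullet> T z" for z
  proof -
    have "z \<bullet> T z = (\<integral>x. z \<bullet> ((W x * (z \<bullet> \<Phi> x)) *\<^sub>R \<Phi> x) \<partial>R)"
      unfolding T_def by (rule integral_inner_right[symmetric]) (use iT in auto)
    then show ?thesis by (simp add: Q_def power2_eq_square algebra_simps)
  qed
  have linT: "linear T"
  proof (rule linearI)
    show "T (a + b) = T a + T b" for a b
      unfolding T_def by (subst Bochner_Integration.integral_add[symmetric])
        (auto intro: iT simp: inner_add_left algebra_simps)
    show "T (c *\<^sub>R a) = c *\<^sub>R T a" for c a
      unfolding T_def by (subst integral_scaleR_right[symmetric]) (auto simp: algebra_simps)
  qed
  have iQ: "integrable R (\<lambda>x. W x * (z \<bullet> \<Phi> x)\<^sup>2)" for z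
  proof -
    have "integrable R (\<lambda>x. z \<bullet> ((W x * (z \<bullet> \<Phi> x)) *\<^sub>R \<Phi> x))"
      by (rule integrable_inner_right) (use iT in auto)
    then show ?thesis by (simp add: power2_eq_square algebra_simps)
  qed
  define S :: "('v \<times> real) set" where "S = sphere 0 1 \<times> cball 0 B"
  have S: "compact S" unfolding S_def by (intro compact_Times) auto
  obtain b :: 'v where b: "b \<in> Basis" using nonempty_Basis by blast
  have "(b, 0) \<in> S" using b B by (auto simp: S_def)
  then have "S \<noteq> {}" by blast
  moreover have "continuous_on S Q"
    unfolding QT[abs_def] by (intro continuous_intros linear_continuous_on linear_conv_bounded_linear[THEN iffD1] linT)
  ultimately obtain z0 where z0: "z0 \<in> S" "\<And>z. z \<in> S \<Longrightarrow> Q z0 \<le> Q z"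
    using continuous_attains_inf[OF S] by blast
  obtain v0 a0 where z0': "z0 = (v0, a0)" by (cases z0)
  have "Q z0 \<noteq> 0"
  proof
    assume "Q z0 = 0"
    then have "AE x in R. W x * (z0 \<bullet> \<Phi> x)\<^sup>2 = 0"
      unfolding Q_def using integral_nonneg_eq_0_iff_AE[OF iQ[of z0] AE_I2] pos by (simp add: less_imp_le)
    then have "AE x in R. v0 \<bullet> \<phi> x = a0"
      by eventually_elim (use pos in \<open>auto simp: z0' \<Phi>_def less_le\<close>)
    then have "v0 = 0" by (rule minimal)
    then show False using z0(1) by (simp add: S_def z0')
  qed
  moreover have "0 \<le> Q z0" unfolding Q_def using pos by (auto intro!: integral_nonneg_AE simp: less_imp_le)
  ultimately have q: "0 < Q z0" by simp
  have "Q z0 * (norm v)\<^sup>2 \<le> (\<integral>x. W x * (v \<bullet> (\<phi> x - m))\<^sup>2 \<partial>R)" if m: "norm m \<le> B" for v m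
  proof (cases "v = 0")
    case False
    define u where "u = v /\<^sub>R norm v"
    have u: "norm u = 1" "v = norm v *\<^sub>R u" using False by (auto simp: u_def)
    have "\<bar>u \<bullet> m\<bar> \<le> B" using Cauchy_Schwarz_ineq2[of u m] u(1) m by simp
    then have "Q z0 \<le> Q (u, u \<bullet> m)" using u(1) by (intro z0) (auto simp: S_def)
    then have "Q z0 * (norm v)\<^sup>2 \<le> (norm v)\<^sup>2 * Q (u, u \<bullet> m)"
      by (subst mult.commute) (intro mult_left_mono zero_le_power2)
    also have "\<dots> = (\<integral>x. (norm v)\<^sup>2 * (W x * (u \<bullet> \<phi> x - u \<bullet> m)\<^sup>2) \<partial>R)"
      unfolding Q_def by (simp add: \<Phi>_def)
    also have "\<dots> = (\<integral>x. W x * (v \<bullet> (\<phi> x - m))\<^sup>2 \<partial>R)"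
    proof (rule Bochner_Integration.integral_cong[OF refl])
      fix x
      have "v \<bullet> (\<phi> x - m) = norm v * (u \<bullet> \<phi> x - u \<bullet> m)"
        by (subst u(2)) (simp only: inner_scaleR_left inner_diff_right right_diff_distrib)
      then show "(norm v)\<^sup>2 * (W x * (u \<bullet> \<phi> x - u \<bullet> m)\<^sup>2) = W x * (v \<bullet> (\<phi> x - m))\<^sup>2"
        by (simp only: power_mult_distrib mult.left_commute)
    qed
    finally show ?thesis .
  qed simp
  then show ?thesis using q by blast
qed

text \<open>Near \<open>\<theta>0\<close> all weights lie between two fixed functions, up to
  constants. Expanding exp to second order in \<open>exp_breg\<close>, where the linear term
  integrates to 0, then bounds \<open>breg\<close> from both sides by second moments against these
  functions; the lower one is positive definite by
  \<open>weighted_quadratic_form_pos\<close>.\<close>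

lemma local_quad:
  assumes \<theta>0: "\<theta>0 \<in> \<Theta>"
  shows "\<exists>e>0. \<exists>k>0. \<forall>\<theta>\<in>ball \<theta>0 e. quad k \<theta>"
proof -
  obtain e where e: "0 < e" "cball \<theta>0 e \<subseteq> \<Theta>" "integrable R (\<lambda>x. exp (\<theta>0 \<bullet> \<phi> x + e * norm (\<phi> x)))"
    using exponential_moment[OF \<theta>0] by blast
  \<comment> \<open>The exponential moment is spent in portions of r: one on the change of the
    weight, one on the Taylor remainder and one on polynomial factors. The last quarter is
    slack.\<close>
  define r where "r = e / 4"
  have r: "0 < r" "e = 4 * r" using e(1) by (auto simp: r_def)
  have poly: "integrable R (\<lambda>x. exp (\<theta>0 \<bullet> \<phi> x + t * norm (\<phi> x)) * (1 + norm (\<phi> x)) ^ j)"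
    if t: "t \<le> 2 * r" and j: "0 < j" for t j
  proof (rule Bochner_Integration.integrable_bound)
    let ?C = "(real j / r) ^ j * exp r"
    show "integrable R (\<lambda>x. ?C * exp (\<theta>0 \<bullet> \<phi> x + e * norm (\<phi> x)))" using e(3) by simp
    show "AE x in R. norm (exp (\<theta>0 \<bullet> \<phi> x + t * norm (\<phi> x)) * (1 + norm (\<phi> x)) ^ j)
       \<le> norm (?C * exp (\<theta>0 \<bullet> \<phi> x + e * norm (\<phi> x)))"
    proof (rule AE_I2)
      fix x
      have "exp (\<theta>0 \<bullet> \<phi> x + t * norm (\<phi> x)) * (1 + norm (\<phi> x)) ^ j
         \<le> exp (\<theta>0 \<bullet> \<phi> x + 3 * r * norm (\<phi> x)) * ((real j / r) ^ j * exp (r * (1 + norm (\<phi> x))))"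
      proof (rule mult_mono)
        have "t * norm (\<phi> x) \<le> 3 * r * norm (\<phi> x)" using t r by (intro mult_right_mono) auto
        then show "exp (\<theta>0 \<bullet> \<phi> x + t * norm (\<phi> x)) \<le> exp (\<theta>0 \<bullet> \<phi> x + 3 * r * norm (\<phi> x))" by simp
        show "(1 + norm (\<phi> x)) ^ j \<le> (real j / r) ^ j * exp (r * (1 + norm (\<phi> x)))"
          using power_le_exp[OF r(1) _ j, of "1 + norm (\<phi> x)"] by simp
      qed auto
      also have "\<dots> = ?C * exp (\<theta>0 \<bullet> \<phi> x + e * norm (\<phi> x))"
        by (simp add: r(2) algebra_simps exp_add[symmetric])
      finally show "norm (exp (\<theta>0 \<bullet> \<phi> x + t * norm (\<phi> x)) * (1 + norm (\<phi> x)) ^ j)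
         \<le> norm (?C * exp (\<theta>0 \<bullet> \<phi> x + e * norm (\<phi> x)))" using r(1) by simp
    qed
  qed measurable
  have int_t: "integrable R (\<lambda>x. exp (\<theta>0 \<bullet> \<phi> x + t * norm (\<phi> x)))" if t: "t \<le> 2 * r" for t
  proof (rule Bochner_Integration.integrable_bound[OF poly[OF t zero_less_one]], goal_cases)
    case 2
    show ?case
      by (rule AE_I2) (auto simp: mult_le_cancel_left1)
  qed measurable
  \<comment> \<open>Bounds for the partition functions of all parameters in the ball; they turn
    bounds on unnormalised weights into bounds on \<open>w\<close>.\<close>
  define Zlo Zhi where "Zlo = (\<integral>x. exp (\<theta>0 \<bullet> \<phi> x + (- r) * norm (\<phi> x)) \<partial>R)"
    and "Zhi = (\<integral>x. exp (\<theta>0 \<bullet> \<phi> x + r * norm (\<phi> x)) \<partial>R)"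
  have Zpos: "0 < Zlo" "0 < Zhi"
    unfolding Zlo_def Zhi_def using r int_t[of r] int_t[of "- r"] by (auto intro!: integral_pos_R)
  have inner: "\<theta>0 \<bullet> \<phi> x + (- r) * norm (\<phi> x) \<le> \<theta> \<bullet> \<phi> x" "\<theta> \<bullet> \<phi> x \<le> \<theta>0 \<bullet> \<phi> x + r * norm (\<phi> x)"
    if "\<theta> \<in> cball \<theta>0 r" for \<theta> x
  proof -
    have "\<bar>(\<theta> - \<theta>0) \<bullet> \<phi> x\<bar> \<le> r * norm (\<phi> x)"
      using that by (intro order_trans[OF Cauchy_Schwarz_ineq2] mult_right_mono)
        (auto simp: dist_norm norm_minus_commute)
    then show "\<theta>0 \<bullet> \<phi> x + (- r) * norm (\<phi> x) \<le> \<theta> \<bullet> \<phi> x" "\<theta> \<bullet> \<phi> x \<le> \<theta>0 \<bullet> \<phi> x + r * norm (\<phi> x)"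
      by (auto simp: inner_diff_left abs_le_iff)
  qed
  have in_Theta: "\<theta> \<in> \<Theta>" if "\<theta> \<in> cball \<theta>0 (2 * r)" for \<theta>
    using that e(2) r by auto
  have w_lo: "exp (\<theta>0 \<bullet> \<phi> x + (- r) * norm (\<phi> x)) / Zhi \<le> w \<theta> x"
    and w_hi: "w \<theta> x \<le> exp (\<theta>0 \<bullet> \<phi> x + r * norm (\<phi> x)) / Zlo" if \<theta>: "\<theta> \<in> cball \<theta>0 r" for \<theta> x
  proof -
    have T: "\<theta> \<in> \<Theta>" using in_Theta \<theta> r by auto
    have d: "\<theta> \<in> natdom" using T Theta_natdom by blast
    have Z: "Zlo \<le> (\<integral>x. exp (\<theta> \<bullet> \<phi> x) \<partial>R)" "(\<integral>x. exp (\<theta> \<bullet> \<phi> x) \<partial>R) \<le> Zhi"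
      unfolding Zlo_def Zhi_def using r integrable_exp[OF T] inner[OF \<theta>] int_t[of r] int_t[of "- r"]
      by (auto intro!: integral_mono)
    show "exp (\<theta>0 \<bullet> \<phi> x + (- r) * norm (\<phi> x)) / Zhi \<le> w \<theta> x"
      unfolding w_altdef[OF d] using Z Zpos inner(1)[OF \<theta>, of x] by (intro frac_le) auto
    show "w \<theta> x \<le> exp (\<theta>0 \<bullet> \<phi> x + r * norm (\<phi> x)) / Zlo"
      unfolding w_altdef[OF d] using Z Zpos inner(2)[OF \<theta>, of x] by (intro frac_le) auto
  qed
  define B where "B = (\<integral>x. exp (\<theta>0 \<bullet> \<phi> x + r * norm (\<phi> x)) * (1 + norm (\<phi> x)) ^ 1 \<partial>R) / Zlo"
  have iB: "integrable R (\<lambda>x. exp (\<theta>0 \<bullet> \<phi> x + r * norm (\<phi> x)) * (1 + norm (\<phi> x)) ^ 1)"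
    using r by (intro poly) auto
  have B0: "0 \<le> B" unfolding B_def using Zpos by (auto intro!: divide_nonneg_pos integral_nonneg_AE)
  have mv_le: "norm (mv \<theta>) \<le> B" if \<theta>: "\<theta> \<in> cball \<theta>0 r" for \<theta>
  proof -
    have T: "\<theta> \<in> \<Theta>" using in_Theta \<theta> r by auto
    have "norm (mv \<theta>) \<le> (\<integral>x. norm (w \<theta> x *\<^sub>R \<phi> x) \<partial>R)"
      unfolding mv_def by (rule integral_norm_bound)
    also have "\<dots> \<le> (\<integral>x. exp (\<theta>0 \<bullet> \<phi> x + r * norm (\<phi> x)) * (1 + norm (\<phi> x)) ^ 1 / Zlo \<partial>R)"
    proof (rule integral_mono)
      show "integrable R (\<lambda>x. norm (w \<theta> x *\<^sub>R \<phi> x))" using integrable_phi[OF T] by (rule integrable_norm)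
      show "norm (w \<theta> x *\<^sub>R \<phi> x) \<le> exp (\<theta>0 \<bullet> \<phi> x + r * norm (\<phi> x)) * (1 + norm (\<phi> x)) ^ 1 / Zlo" for x
        using mult_mono[OF w_hi[OF \<theta>, of x], of "norm (\<phi> x)" "1 + norm (\<phi> x)"] Zpos by simp
    qed (use iB in auto)
    finally show ?thesis unfolding B_def by simp
  qed
  \<comment> \<open>An integrable majorant, common to the whole ball, of the weight times the
    second-order remainder per unit of \<open>(norm v)\<^sup>2\<close>: \<open>w_hi\<close> bounds
    the weight and \<open>mv_le\<close> the centre.\<close>
  define H where "H x = exp (\<theta>0 \<bullet> \<phi> x + r * norm (\<phi> x)) / Zlo *
      ((norm (\<phi> x) + B)\<^sup>2 * exp (r * (norm (\<phi> x) + B)))" for x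
  have [measurable]: "H \<in> borel_measurable R" unfolding H_def by measurable
  have H0: "0 \<le> H x" for x using Zpos by (auto simp: H_def)
  have iH: "integrable R H"
  proof (rule Bochner_Integration.integrable_bound)
    let ?C = "(1 + B)\<^sup>2 * exp (r * B) / Zlo"
    show "integrable R (\<lambda>x. ?C * (exp (\<theta>0 \<bullet> \<phi> x + (2 * r) * norm (\<phi> x)) * (1 + norm (\<phi> x)) ^ 2))"
      using poly[of "2 * r" 2] by simp
    show "AE x in R. norm (H x) \<le> norm (?C * (exp (\<theta>0 \<bullet> \<phi> x + (2 * r) * norm (\<phi> x)) * (1 + norm (\<phi> x)) ^ 2))"
    proof (rule AE_I2)
      fix x
      have "norm (\<phi> x) + B \<le> (1 + B) * (1 + norm (\<phi> x))" using B0 by (simp add: algebra_simps)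
      then have "(norm (\<phi> x) + B)\<^sup>2 \<le> ((1 + B) * (1 + norm (\<phi> x)))\<^sup>2" using B0 by (intro power_mono) auto
      then have "H x \<le> exp (\<theta>0 \<bullet> \<phi> x + r * norm (\<phi> x)) / Zlo *
          (((1 + B) * (1 + norm (\<phi> x)))\<^sup>2 * exp (r * (norm (\<phi> x) + B)))"
        unfolding H_def using Zpos by (intro mult_left_mono mult_right_mono) auto
      also have "\<dots> = ?C * (exp (\<theta>0 \<bullet> \<phi> x + (2 * r) * norm (\<phi> x)) * (1 + norm (\<phi> x)) ^ 2)"
      proof -
        have "exp (\<theta>0 \<bullet> \<phi> x + (2 * r) * norm (\<phi> x)) = exp (\<theta>0 \<bullet> \<phi> x + r * norm (\<phi> x)) * exp (r * norm (\<phi> x))"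
          "exp (r * (norm (\<phi> x) + B)) = exp (r * norm (\<phi> x)) * exp (r * B)"
          by (simp_all add: exp_add[symmetric] algebra_simps)
        then show ?thesis by (simp add: power_mult_distrib)
      qed
      finally show "norm (H x) \<le> norm (?C * (exp (\<theta>0 \<bullet> \<phi> x + (2 * r) * norm (\<phi> x)) * (1 + norm (\<phi> x)) ^ 2))"
        using H0[of x] Zpos by simp
    qed
  qed measurable
  define C where "C = integral\<^sup>L R H"
  have C0: "0 \<le> C" unfolding C_def using H0 by (auto intro: integral_nonneg_AE)
  \<comment> \<open>The matching minorant: one \<open>- r\<close> comes from \<open>w_lo\<close>,
    the other from the remainder factor.\<close>
  define W where "W x = exp (\<theta>0 \<bullet> \<phi> x + (- 2 * r) * norm (\<phi> x))" for x
  have W: "W \<in> borel_measurable R" "\<And>x. 0 < W x" unfolding W_def by auto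
  obtain q where q: "0 < q" "\<And>v m. norm m \<le> B \<Longrightarrow> q * (norm v)\<^sup>2 \<le> (\<integral>x. W x * (v \<bullet> (\<phi> x - m))\<^sup>2 \<partial>R)"
    using weighted_quadratic_form_pos[OF W _ B0] poly[of "- 2 * r" 2] r unfolding W_def by auto
  define c where "c = q * exp (- r * B) / Zhi"
  have c: "0 < c" using q Zpos by (auto simp: c_def)
  have core: "c * (norm v)\<^sup>2 \<le> (\<integral>x. w \<theta> x * ((v \<bullet> (\<phi> x - mv \<theta>))\<^sup>2 * exp (- r * (norm (\<phi> x) + B))) \<partial>R)"
    "integrable R (\<lambda>x. w \<theta> x * ((v \<bullet> (\<phi> x - mv \<theta>))\<^sup>2 * exp (r * (norm (\<phi> x) + B))))"
    "(\<integral>x. w \<theta> x * ((v \<bullet> (\<phi> x - mv \<theta>))\<^sup>2 * exp (r * (norm (\<phi> x) + B))) \<partial>R) \<le> C * (norm v)\<^sup>2"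
    "integrable R (\<lambda>x. w \<theta> x * ((v \<bullet> (\<phi> x - mv \<theta>))\<^sup>2 * exp (- r * (norm (\<phi> x) + B))))"
    if \<theta>: "\<theta> \<in> cball \<theta>0 r" for \<theta> v
  proof -
    have le: "w \<theta> x * ((v \<bullet> (\<phi> x - mv \<theta>))\<^sup>2 * exp (r * (norm (\<phi> x) + B))) \<le> (norm v)\<^sup>2 * H x" for x
    proof -
      have "\<bar>v \<bullet> (\<phi> x - mv \<theta>)\<bar> \<le> norm v * (norm (\<phi> x) + B)"
        using mv_le[OF \<theta>] by (intro order_trans[OF Cauchy_Schwarz_ineq2] mult_left_mono
          order_trans[OF norm_triangle_ineq4]) auto
      then have "(v \<bullet> (\<phi> x - mv \<theta>))\<^sup>2 \<le> (norm v * (norm (\<phi> x) + B))\<^sup>2"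
        using B0 by (simp add: abs_le_square_iff[symmetric])
      then have "w \<theta> x * ((v \<bullet> (\<phi> x - mv \<theta>))\<^sup>2 * exp (r * (norm (\<phi> x) + B))) \<le>
        exp (\<theta>0 \<bullet> \<phi> x + r * norm (\<phi> x)) / Zlo * ((norm v * (norm (\<phi> x) + B))\<^sup>2 * exp (r * (norm (\<phi> x) + B)))"
        using w_hi[OF \<theta>, of x] Zpos by (intro mult_mono) auto
      then show ?thesis by (simp add: H_def power_mult_distrib mult_ac)
    qed
    have iv: "integrable R (\<lambda>x. (norm v)\<^sup>2 * H x)" using iH by simp
    show i1: "integrable R (\<lambda>x. w \<theta> x * ((v \<bullet> (\<phi> x - mv \<theta>))\<^sup>2 * exp (r * (norm (\<phi> x) + B))))"
      by (rule Bochner_Integration.integrable_bound[OF iv]) (use le H0 in auto)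
    show "(\<integral>x. w \<theta> x * ((v \<bullet> (\<phi> x - mv \<theta>))\<^sup>2 * exp (r * (norm (\<phi> x) + B))) \<partial>R) \<le> C * (norm v)\<^sup>2"
      using integral_mono[OF i1 iv le] by (simp add: C_def mult.commute)
    show i2: "integrable R (\<lambda>x. w \<theta> x * ((v \<bullet> (\<phi> x - mv \<theta>))\<^sup>2 * exp (- r * (norm (\<phi> x) + B))))"
    proof (rule Bochner_Integration.integrable_bound[OF i1])
      show "AE x in R. norm (w \<theta> x * ((v \<bullet> (\<phi> x - mv \<theta>))\<^sup>2 * exp (- r * (norm (\<phi> x) + B)))) \<le>
        norm (w \<theta> x * ((v \<bullet> (\<phi> x - mv \<theta>))\<^sup>2 * exp (r * (norm (\<phi> x) + B))))"
      proof (rule AE_I2)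
        fix x
        have "- r * (norm (\<phi> x) + B) \<le> r * (norm (\<phi> x) + B)"
          using r B0 by (intro mult_right_mono) auto
        then show "norm (w \<theta> x * ((v \<bullet> (\<phi> x - mv \<theta>))\<^sup>2 * exp (- r * (norm (\<phi> x) + B)))) \<le>
          norm (w \<theta> x * ((v \<bullet> (\<phi> x - mv \<theta>))\<^sup>2 * exp (r * (norm (\<phi> x) + B))))"
          unfolding norm_mult by (intro mult_left_mono) auto
      qed
    qed measurable
    have le2: "exp (- r * B) / Zhi * (W x * (v \<bullet> (\<phi> x - mv \<theta>))\<^sup>2) \<le>
       w \<theta> x * ((v \<bullet> (\<phi> x - mv \<theta>))\<^sup>2 * exp (- r * (norm (\<phi> x) + B)))" for x
    proof -
      have "exp (- r * B) / Zhi * (W x * (v \<bullet> (\<phi> x - mv \<theta>))\<^sup>2) =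
        exp (\<theta>0 \<bullet> \<phi> x + (- r) * norm (\<phi> x)) / Zhi * ((v \<bullet> (\<phi> x - mv \<theta>))\<^sup>2 * exp (- r * (norm (\<phi> x) + B)))"
        by (simp add: W_def exp_add[symmetric] algebra_simps)
      also have "\<dots> \<le> w \<theta> x * ((v \<bullet> (\<phi> x - mv \<theta>))\<^sup>2 * exp (- r * (norm (\<phi> x) + B)))"
        by (intro mult_right_mono w_lo[OF \<theta>]) auto
      finally show ?thesis .
    qed
    have i3: "integrable R (\<lambda>x. exp (- r * B) / Zhi * (W x * (v \<bullet> (\<phi> x - mv \<theta>))\<^sup>2))"
    proof (rule Bochner_Integration.integrable_bound[OF i2])
      show "AE x in R. norm (exp (- r * B) / Zhi * (W x * (v \<bullet> (\<phi> x - mv \<theta>))\<^sup>2)) \<le>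
        norm (w \<theta> x * ((v \<bullet> (\<phi> x - mv \<theta>))\<^sup>2 * exp (- r * (norm (\<phi> x) + B))))"
        using le2 Zpos W(2) by (intro AE_I2) (auto simp: abs_mult less_imp_le abs_of_pos)
    qed (use W(1) in measurable)
    have "c * (norm v)\<^sup>2 \<le> exp (- r * B) / Zhi * (\<integral>x. W x * (v \<bullet> (\<phi> x - mv \<theta>))\<^sup>2 \<partial>R)"
      using mult_left_mono[OF q(2)[OF mv_le[OF \<theta>], of v], of "exp (- r * B) / Zhi"] Zpos
      by (simp add: c_def algebra_simps)
    also have "\<dots> = (\<integral>x. exp (- r * B) / Zhi * (W x * (v \<bullet> (\<phi> x - mv \<theta>))\<^sup>2) \<partial>R)" by simp
    also have "\<dots> \<le> (\<integral>x. w \<theta> x * ((v \<bullet> (\<phi> x - mv \<theta>))\<^sup>2 * exp (- r * (norm (\<phi> x) + B))) \<partial>R)"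
      by (rule integral_mono[OF i3 i2 le2])
    finally show "c * (norm v)\<^sup>2 \<le> (\<integral>x. w \<theta> x * ((v \<bullet> (\<phi> x - mv \<theta>))\<^sup>2 * exp (- r * (norm (\<phi> x) + B))) \<partial>R)" .
  qed
  \<comment> \<open>\<open>r\<close> keeps the balls inside \<Theta>, \<open>c\<close> gives the
    lower bound for \<open>var\<close> and \<open>1 / (C + 1)\<close> both upper bounds. The third
    entry is for the lower bound on \<open>breg\<close>: the integral only yields
    \<open>exp breg \<ge> 1 + z\<close> with \<open>z = c / 2 * (norm u)\<^sup>2\<close>, and
    \<open>ln (1 + z) \<ge> z / (1 + z)\<close> is used with
    \<open>z \<le> c / 2 * r\<^sup>2\<close>.\<close>
  define k where "k = Min {r, c, c / 2 / (1 + c / 2 * r\<^sup>2), 1 / (C + 1)}"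
  have k: "0 < k" "k \<le> r" "k \<le> c" "k \<le> c / 2 / (1 + c / 2 * r\<^sup>2)" "k \<le> 1 / (C + 1)"
    using r c C0 unfolding k_def by (auto simp: add_pos_nonneg intro!: divide_pos_pos)
  have Ck: "C * z\<^sup>2 \<le> z\<^sup>2 / k" for z :: real
  proof -
    have "C \<le> 1 / k" using k(1,5) C0 by (simp add: field_simps)
    then show ?thesis using mult_right_mono[of C "1/k" "z\<^sup>2"] by simp
  qed
  have "quad k \<theta>" if "\<theta> \<in> ball \<theta>0 r" for \<theta>
    unfolding quad_def
  proof (intro conjI allI impI)
    have \<theta>: "\<theta> \<in> cball \<theta>0 r" using that by simp
    show sub: "cball \<theta> k \<subseteq> \<Theta>"
    proof
      fix z assume "z \<in> cball \<theta> k"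
      then have "dist \<theta>0 z \<le> r + r" using \<theta> k(2) dist_triangle[of \<theta>0 z \<theta>] by auto
      then show "z \<in> \<Theta>" by (intro in_Theta) auto
    qed
    have T: "\<theta> \<in> \<Theta>" using in_Theta \<theta> r by auto
    have iv: "integrable R (\<lambda>x. w \<theta> x * (v \<bullet> (\<phi> x - mv \<theta>))\<^sup>2)" for v
      by (rule Bochner_Integration.integrable_bound[OF core(2)[OF \<theta>, of v]])
        (use r B0 in \<open>auto simp: abs_mult mult_le_cancel_left1 intro!: mult_left_mono\<close>)
    show "k * (norm v)\<^sup>2 \<le> var \<theta> v" for v
    proof -
      have "k * (norm v)\<^sup>2 \<le> c * (norm v)\<^sup>2" using k by (intro mult_right_mono) auto
      also note core(1)[OF \<theta>, of v]
      also have "(\<integral>x. w \<theta> x * ((v \<bullet> (\<phi> x - mv \<theta>))\<^sup>2 * exp (- r * (norm (\<phi> x) + B))) \<partial>R) \<le> var \<theta> v"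
        unfolding var_def
        using r B0 by (intro integral_mono[OF core(4)[OF \<theta>] iv] mult_left_mono mult_left_le) auto
      finally show ?thesis .
    qed
    show "var \<theta> v \<le> (norm v)\<^sup>2 / k" for v
    proof -
      have "var \<theta> v \<le> (\<integral>x. w \<theta> x * ((v \<bullet> (\<phi> x - mv \<theta>))\<^sup>2 * exp (r * (norm (\<phi> x) + B))) \<partial>R)"
        unfolding var_def
        using r B0 by (intro integral_mono[OF iv core(2)[OF \<theta>]] mult_left_mono) (auto simp: mult_le_cancel_left1)
      also note core(3)[OF \<theta>, of v]
      also note Ck
      finally show ?thesis .
    qed
    fix u :: 'v assume u: "norm u \<le> k"
    have dom: "\<theta> + u \<in> natdom"
      using sub u Theta_natdom by (force simp: dist_norm)
    define Y where "Y x = u \<bullet> (\<phi> x - mv \<theta>)" for x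
    have Yb: "\<bar>Y x\<bar> \<le> r * (norm (\<phi> x) + B)" for x
      unfolding Y_def using u k(2) mv_le[OF \<theta>] r(1)
      by (intro order_trans[OF Cauchy_Schwarz_ineq2] mult_mono order_trans[OF norm_triangle_ineq4]) auto
    have eY: "integrable R (\<lambda>x. w \<theta> x * exp (Y x))" "(\<integral>x. w \<theta> x * exp (Y x) \<partial>R) = exp (breg \<theta> (\<theta> + u))"
      unfolding Y_def using exp_breg[OF T dom] by simp_all
    have cY: "integrable R (\<lambda>x. w \<theta> x * Y x)" "(\<integral>x. w \<theta> x * Y x \<partial>R) = 0"
      unfolding Y_def using centered[OF T] by auto
    have split: "(\<integral>x. w \<theta> x * (exp (Y x) - 1 - Y x) \<partial>R) = exp (breg \<theta> (\<theta> + u)) - 1"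
      "integrable R (\<lambda>x. w \<theta> x * (exp (Y x) - 1 - Y x))"
      unfolding right_diff_distrib mult_1_right
      using eY cY integrable_w_Theta[OF T] integral_w_Theta[OF T] by auto
    have up: "exp (breg \<theta> (\<theta> + u)) - 1 \<le> C * (norm u)\<^sup>2"
    proof -
      have "exp (breg \<theta> (\<theta> + u)) - 1 \<le> (\<integral>x. w \<theta> x * ((u \<bullet> (\<phi> x - mv \<theta>))\<^sup>2 * exp (r * (norm (\<phi> x) + B))) \<partial>R)"
        unfolding split(1)[symmetric] Y_def[symmetric]
      proof (intro integral_mono[OF split(2) core(2)[OF \<theta>, of u, folded Y_def]] mult_left_mono)
        fix x
        have "exp (Y x) - 1 - Y x \<le> (Y x)\<^sup>2 / 2 * exp \<bar>Y x\<bar>" by (rule exp_taylor2)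
        also have "\<dots> \<le> (Y x)\<^sup>2 * exp (r * (norm (\<phi> x) + B))"
          using Yb[of x] by (intro mult_mono) auto
        finally show "exp (Y x) - 1 - Y x \<le> (Y x)\<^sup>2 * exp (r * (norm (\<phi> x) + B))" .
      qed auto
      also note core(3)[OF \<theta>, of u]
      finally show ?thesis .
    qed
    have lo: "c / 2 * (norm u)\<^sup>2 \<le> exp (breg \<theta> (\<theta> + u)) - 1"
    proof -
      have "c / 2 * (norm u)\<^sup>2 \<le> (\<integral>x. w \<theta> x * ((u \<bullet> (\<phi> x - mv \<theta>))\<^sup>2 * exp (- r * (norm (\<phi> x) + B))) / 2 \<partial>R)"
        using core(1)[OF \<theta>, of u] by simp
      also have "\<dots> \<le> exp (breg \<theta> (\<theta> + u)) - 1"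
        unfolding split(1)[symmetric] Y_def[symmetric]
      proof (rule integral_mono[OF _ split(2)])
        show "integrable R (\<lambda>x. w \<theta> x * ((Y x)\<^sup>2 * exp (- r * (norm (\<phi> x) + B))) / 2)"
          unfolding Y_def using core(4)[OF \<theta>, of u] by simp
        fix x
        have "(Y x)\<^sup>2 * exp (- r * (norm (\<phi> x) + B)) / 2 \<le> (Y x)\<^sup>2 / 2 * exp (- \<bar>Y x\<bar>)"
          using Yb[of x] mult_left_mono[of "exp (- r * (norm (\<phi> x) + B))" "exp (- \<bar>Y x\<bar>)" "(Y x)\<^sup>2"] by simp
        also have "\<dots> \<le> exp (Y x) - 1 - Y x" by (rule exp_taylor2)
        finally have "w \<theta> x * ((Y x)\<^sup>2 * exp (- r * (norm (\<phi> x) + B)) / 2) \<le> w \<theta> x * (exp (Y x) - 1 - Y x)"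
          by (rule mult_left_mono) auto
        then show "w \<theta> x * ((Y x)\<^sup>2 * exp (- r * (norm (\<phi> x) + B))) / 2 \<le> w \<theta> x * (exp (Y x) - 1 - Y x)"
          by simp
      qed
      finally show ?thesis .
    qed
    show "breg \<theta> (\<theta> + u) \<le> (norm u)\<^sup>2 / k"
    proof -
      have "breg \<theta> (\<theta> + u) \<le> exp (breg \<theta> (\<theta> + u)) - 1"
        using exp_ge_add_one_self[of "breg \<theta> (\<theta> + u)"] by linarith
      also note up
      also note Ck
      finally show ?thesis .
    qed
    show "k * (norm u)\<^sup>2 \<le> breg \<theta> (\<theta> + u)"
    proof -
      let ?z = "c / 2 * (norm u)\<^sup>2"
      have z0: "0 \<le> ?z" using c by simp
      have zr: "?z \<le> c / 2 * r\<^sup>2" using u k c by (intro mult_left_mono power_mono) auto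
      have "k * (norm u)\<^sup>2 \<le> c / 2 / (1 + c / 2 * r\<^sup>2) * (norm u)\<^sup>2"
        using k by (intro mult_right_mono) auto
      also have "\<dots> = ?z / (1 + c / 2 * r\<^sup>2)" by simp
      also have "\<dots> \<le> ?z / (1 + ?z)" using z0 zr by (intro divide_left_mono) (auto intro!: mult_pos_pos add_pos_nonneg)
      also have "\<dots> = 1 - 1 / (1 + ?z)" using z0 by (simp add: field_simps)
      also have "\<dots> \<le> ln (1 + ?z)"
        using ln_le_minus_one[of "1 / (1 + ?z)"] z0 by (simp add: ln_div)
      also have "\<dots> \<le> ln (exp (breg \<theta> (\<theta> + u)))"
        using lo z0 by (subst ln_le_cancel_iff) auto
      finally show ?thesis by simp
    qed
  qed
  then show ?thesis using r(1) k(1) by blast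
qed

lemma quad_mono:
  assumes "quad k \<theta>" "0 < k'" "k' \<le> k"
  shows "quad k' \<theta>"
  unfolding quad_def
proof (intro conjI allI impI)
  have up: "z\<^sup>2 / k \<le> z\<^sup>2 / k'" for z :: real using assms by (intro divide_left_mono) auto
  have lo: "k' * z\<^sup>2 \<le> k * z\<^sup>2" for z :: real using assms by (intro mult_right_mono) auto
  show "cball \<theta> k' \<subseteq> \<Theta>" using assms unfolding quad_def by (meson order_trans subset_cball)
  show "k' * (norm v)\<^sup>2 \<le> var \<theta> v" "var \<theta> v \<le> (norm v)\<^sup>2 / k'" for v
    using assms(1) up[of "norm v"] lo[of "norm v"] unfolding quad_def by (meson order_trans)+
  fix u :: 'v assume u: "norm u \<le> k'"
  have "k * (norm u)\<^sup>2 \<le> breg \<theta> (\<theta> + u) \<and> breg \<theta> (\<theta> + u) \<le> (norm u)\<^sup>2 / k"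
    using assms u unfolding quad_def by auto
  then show "k' * (norm u)\<^sup>2 \<le> breg \<theta> (\<theta> + u)" "breg \<theta> (\<theta> + u) \<le> (norm u)\<^sup>2 / k'"
    using up[of "norm u"] lo[of "norm u"] by linarith+
qed

lemma quad_exists:
  assumes "\<theta> \<in> \<Theta>"
  obtains k where "0 < k" "quad k \<theta>"
  using local_quad[OF assms] by (metis centre_in_ball)

lemma uniform_quad:
  assumes "compact T" "T \<subseteq> \<Theta>"
  shows "\<exists>k>0. \<forall>\<theta>\<in>T. quad k \<theta>"
  by (rule compact_uniform_constant[OF assms(1)]) (use local_quad assms(2) quad_mono in blast)+

lemma quadD:
  assumes "quad k \<theta>" "0 < k"
  shows "\<theta> \<in> \<Theta>" "cball \<theta> k \<subseteq> \<Theta>"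
    "norm (\<theta>' - \<theta>) \<le> k \<Longrightarrow> k * (norm (\<theta>' - \<theta>))\<^sup>2 \<le> breg \<theta> \<theta>'"
    "norm (\<theta>' - \<theta>) \<le> k \<Longrightarrow> breg \<theta> \<theta>' \<le> (norm (\<theta>' - \<theta>))\<^sup>2 / k"
    "k * (norm v)\<^sup>2 \<le> var \<theta> v" "var \<theta> v \<le> (norm v)\<^sup>2 / k"
  using assms unfolding quad_def by (auto dest: spec[of _ "\<theta>' - \<theta>"])

section \<open>Global growth of the divergence and the mean map\<close>

text \<open>Quadratic growth up to radius k, combined with convexity in the second argument along
  the segment from \<theta>, forces linear growth beyond. \<theta>' is free in
  \<open>natdom\<close>, so constants valid for \<theta> in a compact set control every
  alternative.\<close>

lemma breg_lower:
  assumes q: "quad k \<theta>" and k: "0 < k" and \<theta>': "\<theta>' \<in> natdom"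
  shows "k * min (norm (\<theta>' - \<theta>)) k * norm (\<theta>' - \<theta>) \<le> breg \<theta> \<theta>'"
proof (cases "norm (\<theta>' - \<theta>) \<le> k")
  case True
  then show ?thesis using quadD(3)[OF q k True] by (simp add: min_def power2_eq_square mult.assoc)
next
  case False
  define l where "l = k / norm (\<theta>' - \<theta>)"
  have n0: "0 < norm (\<theta>' - \<theta>)" "k < norm (\<theta>' - \<theta>)" using False k by linarith+
  have l: "0 < l" "l < 1" unfolding l_def using n0 k by (simp_all del: zero_less_norm_iff)
  have n: "norm (l *\<^sub>R (\<theta>' - \<theta>)) = k" using n0 k by (auto simp: l_def)
  have T: "\<theta> \<in> natdom" using quadD(1)[OF q k] Theta_natdom by blast
  have "k * k\<^sup>2 \<le> breg \<theta> (\<theta> + l *\<^sub>R (\<theta>' - \<theta>))"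
    using quadD(3)[OF q k, of "\<theta> + l *\<^sub>R (\<theta>' - \<theta>)"] n by simp
  also have "\<theta> + l *\<^sub>R (\<theta>' - \<theta>) = (1 - l) *\<^sub>R \<theta> + l *\<^sub>R \<theta>'" by (simp add: algebra_simps)
  also have "breg \<theta> \<dots> \<le> l * breg \<theta> \<theta>'"
  proof -
    have "psi ((1 - l) *\<^sub>R \<theta> + l *\<^sub>R \<theta>') \<le> (1 - l) * psi \<theta> + l * psi \<theta>'"
      using convex_onD[OF psi_convex, of l \<theta> \<theta>'] l T \<theta>' by simp
    moreover have "((1 - l) *\<^sub>R \<theta> + l *\<^sub>R \<theta>' - \<theta>) \<bullet> mv \<theta> = l * ((\<theta>' - \<theta>) \<bullet> mv \<theta>)"
      by (simp add: algebra_simps)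
    ultimately show ?thesis unfolding breg_def by (simp add: algebra_simps)
  qed
  finally have "k * k\<^sup>2 / l \<le> breg \<theta> \<theta>'" using l by (simp add: field_simps)
  also have "k * k\<^sup>2 / l = k * k * norm (\<theta>' - \<theta>)" using k by (simp add: l_def power2_eq_square)
  finally show ?thesis using False by (simp add: min_def)
qed

lemma breg_sym: "breg \<theta> \<theta>' + breg \<theta>' \<theta> = (mv \<theta>' - mv \<theta>) \<bullet> (\<theta>' - \<theta>)"
  by (simp add: breg_def algebra_simps inner_commute)

text \<open>The symmetrised divergence is the pairing of the difference of means with the difference
  of parameters, so Cauchy-Schwarz turns growth of \<open>breg\<close> into separation of means. As
  \<theta>' is free in \<Theta>, this yields injectivity on all of \<Theta>, which need not be
  convex.\<close>

lemma mv_separation: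
  assumes q: "quad k \<theta>" and k: "0 < k" and \<theta>': "\<theta>' \<in> \<Theta>"
  shows "k * min (norm (\<theta>' - \<theta>)) k \<le> norm (mv \<theta>' - mv \<theta>)"
proof (cases "\<theta>' = \<theta>")
  case False
  have T: "\<theta> \<in> natdom" "\<theta>' \<in> natdom" using quadD(1)[OF q k] \<theta>' Theta_natdom by auto
  have "k * min (norm (\<theta>' - \<theta>)) k * norm (\<theta>' - \<theta>) \<le> breg \<theta> \<theta>' + breg \<theta>' \<theta>"
    using breg_lower[OF q k T(2)] breg_nonneg[OF \<theta>' T(1)] by linarith
  also have "\<dots> \<le> norm (mv \<theta>' - mv \<theta>) * norm (\<theta>' - \<theta>)"
    unfolding breg_sym by (rule norm_cauchy_schwarz)
  finally show ?thesis using False by simp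
qed (use k in simp)

text \<open>Let h point in the direction of the difference of means and have length n, the distance
  of the parameters. The three-point identity and nonnegativity bound
  \<open>h \<bullet> (mv \<theta>' - mv \<theta>)\<close> by
  \<open>breg \<theta> (\<theta>' + h)\<close>, which is at most \<open>(2 * n)\<^sup>2 / k\<close>.
  The radius \<open>k / 2\<close> keeps \<open>\<theta>' + h\<close> within k of \<theta>.\<close>

lemma mv_lipschitz:
  assumes q: "quad k \<theta>" and k: "0 < k" and u: "norm (\<theta>' - \<theta>) \<le> k / 2"
  shows "norm (mv \<theta>' - mv \<theta>) \<le> 4 / k * norm (\<theta>' - \<theta>)"
proof (cases "mv \<theta>' = mv \<theta> \<or> \<theta>' = \<theta>")
  case False
  define n where "n = norm (\<theta>' - \<theta>)"
  define h where "h = (n / norm (mv \<theta>' - mv \<theta>)) *\<^sub>R (mv \<theta>' - mv \<theta>)"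
  have h: "norm h = n" "h \<bullet> (mv \<theta>' - mv \<theta>) = n * norm (mv \<theta>' - mv \<theta>)"
    using False by (auto simp: h_def n_def dot_square_norm power2_eq_square)
  have n: "0 < n" using False by (simp add: n_def)
  have d1: "norm (\<theta>' + h - \<theta>) \<le> 2 * n"
    using norm_triangle_ineq[of "\<theta>' - \<theta>" h] h(1) by (simp add: n_def algebra_simps)
  have T: "\<theta> \<in> \<Theta>" "\<theta>' \<in> \<Theta>" "\<theta>' + h \<in> \<Theta>"
    using quadD(1,2)[OF q k] u d1 k by (auto simp: n_def dist_norm norm_minus_commute subset_iff)
  have nd: "\<theta>' \<in> natdom" "\<theta>' + h \<in> natdom" using T Theta_natdom by auto
  have "0 \<le> breg \<theta>' (\<theta>' + h)" "0 \<le> breg \<theta> \<theta>'" using breg_nonneg T nd by auto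
  moreover have "breg \<theta>' (\<theta>' + h) + breg \<theta> \<theta>' = breg \<theta> (\<theta>' + h) - h \<bullet> (mv \<theta>' - mv \<theta>)"
    by (simp add: breg_def algebra_simps)
  ultimately have "n * norm (mv \<theta>' - mv \<theta>) \<le> breg \<theta> (\<theta>' + h)" using h by linarith
  also have "\<dots> \<le> (norm (\<theta>' + h - \<theta>))\<^sup>2 / k"
    using d1 u by (intro quadD(4)[OF q k]) (auto simp: n_def)
  also have "\<dots> \<le> (2 * n)\<^sup>2 / k" using d1 k by (intro divide_right_mono power_mono) auto
  finally have "n * norm (mv \<theta>' - mv \<theta>) \<le> n * (4 / k * n)" by (simp add: power2_eq_square mult_ac)
  then show ?thesis using n unfolding n_def[symmetric] by (simp only: mult_le_cancel_left_pos)
qed (use k in auto)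

section \<open>The inverse of the mean map\<close>

lemma inj_mv: "inj_on mv \<Theta>"
proof (rule inj_onI)
  fix x y assume xy: "x \<in> \<Theta>" "y \<in> \<Theta>" "mv x = mv y"
  obtain e k where "0 < e" "0 < k" "\<forall>z\<in>ball x e. quad k z" using local_quad[OF xy(1)] by blast
  then have "k * min (norm (y - x)) k \<le> 0" "0 < k" using mv_separation[of k x y] xy by auto
  then have "norm (y - x) \<le> 0" by (auto simp: mult_le_0_iff min_def split: if_splits)
  then show "x = y" by simp
qed

definition th :: "'v \<Rightarrow> 'v" where "th = the_inv_into \<Theta> mv"

lemma th_mv: "\<theta> \<in> \<Theta> \<Longrightarrow> th (mv \<theta>) = \<theta>"
  unfolding th_def by (rule the_inv_into_f_f[OF inj_mv])

lemma th_in: "\<mu> \<in> mv ` \<Theta> \<Longrightarrow> th \<mu> \<in> \<Theta>" and mv_th: "\<mu> \<in> mv ` \<Theta> \<Longrightarrow> mv (th \<mu>) = \<mu>"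
  by (auto simp: th_mv)

lemma continuous_mv: "continuous_on \<Theta> mv"
  unfolding continuous_on_eq_continuous_at[OF open_Theta]
proof
  fix \<theta> assume T: "\<theta> \<in> \<Theta>"
  obtain k where k: "0 < k" and q: "quad k \<theta>" by (rule quad_exists[OF T])
  show "isCont mv \<theta>"
    unfolding continuous_at_eps_delta
  proof (intro allI impI)
    fix r :: real assume r: "0 < r"
    show "\<exists>d>0. \<forall>x. dist x \<theta> < d \<longrightarrow> dist (mv x) (mv \<theta>) < r"
    proof (intro exI[of _ "min (k / 2) (r * k / 4)"] conjI allI impI)
      fix x assume "dist x \<theta> < min (k / 2) (r * k / 4)"
      then have "norm (x - \<theta>) \<le> k / 2" "norm (x - \<theta>) < r * k / 4" by (auto simp: dist_norm)
      have "k * norm (mv x - mv \<theta>) < k * r"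
      proof -
        have "k * norm (mv x - mv \<theta>) \<le> k * (4 / k * norm (x - \<theta>))"
          using mv_lipschitz[OF q k, of x] k \<open>norm (x - \<theta>) \<le> k / 2\<close> by (intro mult_left_mono) auto
        also have "\<dots> < k * r" using \<open>norm (x - \<theta>) < r * k / 4\<close> k by (simp add: mult.commute)
        finally show ?thesis .
      qed
      then show "dist (mv x) (mv \<theta>) < r" using k by (simp add: dist_norm)
    qed (use k r in auto)
  qed
qed

lemma open_mv: "open (mv ` \<Theta>)"
  by (rule invariance_of_domain[OF continuous_mv open_Theta inj_mv])

lemma continuous_th: "continuous_on (mv ` \<Theta>) th"
  unfolding continuous_on_eq_continuous_at[OF open_mv]
proof
  fix \<mu> assume \<mu>: "\<mu> \<in> mv ` \<Theta>"
  obtain k where k: "0 < k" and q: "quad k (th \<mu>)" by (rule quad_exists[OF th_in[OF \<mu>]])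
  obtain s where s: "0 < s" "ball \<mu> s \<subseteq> mv ` \<Theta>" using open_mv \<mu> open_contains_ball by blast
  show "isCont th \<mu>"
    unfolding continuous_at_eps_delta
  proof (intro allI impI)
    fix r :: real assume r: "0 < r"
    show "\<exists>d>0. \<forall>x. dist x \<mu> < d \<longrightarrow> dist (th x) (th \<mu>) < r"
    proof (intro exI[of _ "min s (k * min r k)"] conjI allI impI)
      fix x assume x: "dist x \<mu> < min s (k * min r k)"
      then have xin: "x \<in> mv ` \<Theta>" using s(2) by (auto simp: dist_commute)
      have "k * min (norm (th x - th \<mu>)) k < k * min r k"
        using mv_separation[OF q k th_in[OF xin]] x by (simp add: mv_th xin \<mu> dist_norm)
      then have "min (norm (th x - th \<mu>)) k < min r k" using k by simp
      then show "dist (th x) (th \<mu>) < r" by (auto simp: dist_norm min_def split: if_splits)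
    qed (use k r s in auto)
  qed
qed

section \<open>Derivatives of the log-partition function, the mean map and its inverse\<close>

text \<open>The error of the linear approximation is by definition a value of \<open>breg\<close>,
  for which \<open>quad\<close> supplies a quadratic bound.\<close>

lemma psi_has_derivative:
  assumes "\<theta> \<in> \<Theta>"
  shows "(psi has_derivative (\<lambda>u. u \<bullet> mv \<theta>)) (at \<theta>)"
proof -
  obtain k where k: "0 < k" and q: "quad k \<theta>" by (rule quad_exists[OF assms])
  show ?thesis
  proof (rule has_derivative_at_quadratic[OF bounded_linear_inner_left k, of _ _ _ "1/k"])
    fix u :: 'v assume u: "norm u < k"
    have e: "psi (\<theta> + u) - psi \<theta> - u \<bullet> mv \<theta> = breg \<theta> (\<theta> + u)" by (simp add: breg_def)
    have "\<theta> + u \<in> natdom" using quadD(2)[OF q k] u Theta_natdom by (force simp: dist_norm)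
    then have "0 \<le> breg \<theta> (\<theta> + u)" using breg_nonneg[OF assms] by blast
    then show "norm (psi (\<theta> + u) - psi \<theta> - u \<bullet> mv \<theta>) \<le> 1 / k * (norm u)\<^sup>2"
      unfolding e using quadD(4)[OF q k, of "\<theta> + u"] u by simp
  qed
qed

text \<open>The covariance of \<phi> under \<theta>, kept as a map on vectors and not as a matrix,
  so that it can stand directly for the derivative of \<open>mv\<close>.\<close>

definition cov :: "'v \<Rightarrow> 'v \<Rightarrow> 'v" where
  "cov \<theta> u = (\<integral>x. w \<theta> x *\<^sub>R ((u \<bullet> (\<phi> x - mv \<theta>)) *\<^sub>R (\<phi> x - mv \<theta>)) \<partial>R)"

lemma norm_centered_le: "norm (\<phi> x - mv \<theta>) \<le> (1 + norm (mv \<theta>)) * (1 + norm (\<phi> x))"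
proof -
  have "(1 + norm (mv \<theta>)) * (1 + norm (\<phi> x)) = 1 + norm (mv \<theta>) + norm (\<phi> x) + norm (mv \<theta>) * norm (\<phi> x)"
    by (simp add: algebra_simps)
  moreover have "0 \<le> norm (mv \<theta>) * norm (\<phi> x)" by simp
  ultimately show ?thesis using norm_triangle_ineq4[of "\<phi> x" "mv \<theta>"] by linarith
qed

lemma integrable_cov:
  assumes "\<theta> \<in> \<Theta>"
  shows "integrable R (\<lambda>x. w \<theta> x *\<^sub>R ((u \<bullet> (\<phi> x - mv \<theta>)) *\<^sub>R (\<phi> x - mv \<theta>)))"
proof (rule integrable_poly[OF assms, where B = "norm u * (1 + norm (mv \<theta>))\<^sup>2" and j=2])
  fix x
  have "norm ((u \<bullet> (\<phi> x - mv \<theta>)) *\<^sub>R (\<phi> x - mv \<theta>)) \<le> norm u * norm (\<phi> x - mv \<theta>) * norm (\<phi> x - mv \<theta>)"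
    using Cauchy_Schwarz_ineq2[of u "\<phi> x - mv \<theta>"] by (simp add: mult_right_mono)
  also have "\<dots> = norm u * (norm (\<phi> x - mv \<theta>))\<^sup>2" by (simp add: power2_eq_square)
  also have "\<dots> \<le> norm u * ((1 + norm (mv \<theta>)) * (1 + norm (\<phi> x)))\<^sup>2"
    by (intro mult_left_mono power_mono norm_centered_le) auto
  finally show "norm ((u \<bullet> (\<phi> x - mv \<theta>)) *\<^sub>R (\<phi> x - mv \<theta>)) \<le> norm u * (1 + norm (mv \<theta>))\<^sup>2 * (1 + norm (\<phi> x))\<^sup>2"
    by (simp add: power_mult_distrib mult.assoc)
qed measurable

lemma integrable_inner_cov:
  assumes "\<theta> \<in> \<Theta>"
  shows "integrable R (\<lambda>x. w \<theta> x * ((v \<bullet> (\<phi> x - mv \<theta>)) * (u \<bullet> (\<phi> x - mv \<theta>))))"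
proof -
  have "integrable R (\<lambda>x. v \<bullet> (w \<theta> x *\<^sub>R ((u \<bullet> (\<phi> x - mv \<theta>)) *\<^sub>R (\<phi> x - mv \<theta>))))"
    by (rule integrable_inner_right) (use integrable_cov[OF assms] in auto)
  then show ?thesis by (simp add: mult_ac)
qed

lemma inner_cov:
  assumes "\<theta> \<in> \<Theta>"
  shows "v \<bullet> cov \<theta> u = (\<integral>x. w \<theta> x * ((v \<bullet> (\<phi> x - mv \<theta>)) * (u \<bullet> (\<phi> x - mv \<theta>))) \<partial>R)"
proof -
  have "v \<bullet> cov \<theta> u = (\<integral>x. v \<bullet> (w \<theta> x *\<^sub>R ((u \<bullet> (\<phi> x - mv \<theta>)) *\<^sub>R (\<phi> x - mv \<theta>))) \<partial>R)"
    unfolding cov_def by (rule integral_inner_right[symmetric]) (use integrable_cov[OF assms] in auto)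
  then show ?thesis by (simp add: mult_ac)
qed

lemma var_cov: "\<theta> \<in> \<Theta> \<Longrightarrow> var \<theta> u = u \<bullet> cov \<theta> u"
  by (simp add: inner_cov var_def power2_eq_square)

lemma linear_cov:
  assumes "\<theta> \<in> \<Theta>"
  shows "linear (cov \<theta>)"
proof (rule linearI)
  show "cov \<theta> (a + b) = cov \<theta> a + cov \<theta> b" for a b
    unfolding cov_def
    by (subst Bochner_Integration.integral_add[symmetric, OF integrable_cov[OF assms] integrable_cov[OF assms]])
      (simp add: inner_add_left algebra_simps)
  show "cov \<theta> (c *\<^sub>R a) = c *\<^sub>R cov \<theta> a" for c a
    unfolding cov_def by (subst integral_scaleR_right[symmetric]) (simp add: mult_ac)
qed

text \<open>For \<open>v = cov \<theta> u\<close> these are bounds on the quadratic form of the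
  inverse covariance at v, which is the Fisher information in mean-value coordinates. They are what
  makes the standardized squared error comparable to the squared error.\<close>

lemma var_bounds_cov:
  assumes q: "quad k \<theta>" and k: "0 < k"
  shows "k * (norm (cov \<theta> u))\<^sup>2 \<le> var \<theta> u" "var \<theta> u \<le> (norm (cov \<theta> u))\<^sup>2 / k"
proof -
  note T = quadD(1)[OF q k]
  let ?c = "cov \<theta> u"
  have "(norm ?c)\<^sup>2 = ?c \<bullet> cov \<theta> u" by (simp add: dot_square_norm)
  also have "\<dots> \<le> (\<integral>x. (k * (w \<theta> x * (?c \<bullet> (\<phi> x - mv \<theta>))\<^sup>2) + w \<theta> x * (u \<bullet> (\<phi> x - mv \<theta>))\<^sup>2 / k) / 2 \<partial>R)"
    unfolding inner_cov[OF T]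
  proof (rule integral_mono[OF integrable_inner_cov[OF T]])
    show "integrable R (\<lambda>x. (k * (w \<theta> x * (?c \<bullet> (\<phi> x - mv \<theta>))\<^sup>2) + w \<theta> x * (u \<bullet> (\<phi> x - mv \<theta>))\<^sup>2 / k) / 2)"
      using integrable_inner_cov[OF T, of ?c ?c] integrable_inner_cov[OF T, of u u]
      by (simp add: power2_eq_square)
    fix x
    let ?a = "?c \<bullet> (\<phi> x - mv \<theta>)" and ?b = "u \<bullet> (\<phi> x - mv \<theta>)"
    \<comment> \<open>The arithmetic-geometric mean inequality with weight k. The weight is chosen
      so that \<open>k * var \<theta> ?c\<close> is at most \<open>(norm ?c)\<^sup>2\<close>, half
      of which is then absorbed on the left.\<close>
    have "0 \<le> (k * ?a - ?b)\<^sup>2 / k" using k by simp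
    also have "\<dots> = k * ?a\<^sup>2 - 2 * (?a * ?b) + ?b\<^sup>2 / k"
      using k by (simp add: power2_eq_square field_simps)
    finally have "?a * ?b \<le> (k * ?a\<^sup>2 + ?b\<^sup>2 / k) / 2" by simp
    from mult_left_mono[OF this w_nonneg[of \<theta> x]]
    show "w \<theta> x * (?a * ?b) \<le> (k * (w \<theta> x * ?a\<^sup>2) + w \<theta> x * ?b\<^sup>2 / k) / 2"
      by (simp add: distrib_left mult_ac)
  qed
  also have "\<dots> = (k * var \<theta> ?c + var \<theta> u / k) / 2"
    unfolding var_def using integrable_inner_cov[OF T, of ?c ?c] integrable_inner_cov[OF T, of u u]
    by (simp add: power2_eq_square)
  also have "\<dots> \<le> ((norm ?c)\<^sup>2 + var \<theta> u / k) / 2"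
    using quadD(6)[OF q k, of ?c] k by (simp add: field_simps)
  finally show "k * (norm (cov \<theta> u))\<^sup>2 \<le> var \<theta> u" using k by (simp add: field_simps)
  have "k * (norm u)\<^sup>2 \<le> norm u * norm ?c"
    using quadD(5)[OF q k, of u] norm_cauchy_schwarz[of u ?c] by (simp add: var_cov[OF T])
  then have "norm u \<le> norm ?c / k" using k by (cases "u = 0") (auto simp: power2_eq_square field_simps)
  then have "norm u * norm ?c \<le> norm ?c / k * norm ?c" by (intro mult_right_mono) auto
  then show "var \<theta> u \<le> (norm (cov \<theta> u))\<^sup>2 / k"
    using norm_cauchy_schwarz[of u ?c] by (simp add: var_cov[OF T] power2_eq_square)
qed

text \<open>After tilting, \<open>mv (\<theta> + u) - mv \<theta>\<close> is
  \<open>exp (- b)\<close> times the integral of \<open>exp (Y x)\<close> against the centred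
  statistic. In the expansion of exp the constant term vanishes, the linear term is
  \<open>cov \<theta> u\<close> and the rest is \<open>E\<close>, of order
  \<open>(norm u)\<^sup>2\<close>. The normalisation \<open>exp (- b)\<close> differs from 1 by
  another term of that order.\<close>

lemma mv_has_derivative:
  assumes T: "\<theta> \<in> \<Theta>"
  shows "(mv has_derivative cov \<theta>) (at \<theta>)"
proof -
  obtain k where k: "0 < k" and q: "quad k \<theta>" by (rule quad_exists[OF T])
  obtain e where e: "0 < e" "integrable R (\<lambda>x. exp (\<theta> \<bullet> \<phi> x + e * norm (\<phi> x)))"
    using exponential_moment[OF T] by blast
  define B where "B = norm (mv \<theta>)"
  define r where "r = e / 2"
  have r: "0 < r" "e = 2 * r" using e by (auto simp: r_def)
  \<comment> \<open>Two of the three powers come from the second-order remainder of exp, the third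
    is the centred statistic that it multiplies. Half of the exponential moment pays for the
    remainder, half for the cube.\<close>
  define G where "G x = w \<theta> x * ((norm (\<phi> x) + B) ^ 3 * exp (r * (norm (\<phi> x) + B)))" for x
  have [measurable]: "G \<in> borel_measurable R" unfolding G_def by measurable
  have G0: "0 \<le> G x" for x unfolding G_def B_def by auto
  have iG: "integrable R G"
  proof (rule Bochner_Integration.integrable_bound)
    let ?C = "(3 / r) ^ 3 * exp (e * B) * exp (- psi \<theta>)"
    show "integrable R (\<lambda>x. ?C * exp (\<theta> \<bullet> \<phi> x + e * norm (\<phi> x)))" using e by simp
    show "AE x in R. norm (G x) \<le> norm (?C * exp (\<theta> \<bullet> \<phi> x + e * norm (\<phi> x)))"
    proof (rule AE_I2)
      fix x
      let ?t = "norm (\<phi> x) + B"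
      have "?t ^ 3 \<le> (3 / r) ^ 3 * exp (r * ?t)"
        using power_le_exp[OF r(1), of ?t 3] by (simp add: B_def)
      then have "G x \<le> w \<theta> x * ((3 / r) ^ 3 * exp (r * ?t) * exp (r * ?t))"
        unfolding G_def by (intro mult_left_mono mult_right_mono) auto
      also have "\<dots> = (3 / r) ^ 3 * (w \<theta> x * (exp (r * ?t) * exp (r * ?t)))" by simp
      also have "w \<theta> x * (exp (r * ?t) * exp (r * ?t)) = exp (e * B) * exp (- psi \<theta>) * exp (\<theta> \<bullet> \<phi> x + e * norm (\<phi> x))"
        unfolding w_def r(2) exp_add[symmetric] by (simp add: algebra_simps)
      finally show "norm (G x) \<le> norm (?C * exp (\<theta> \<bullet> \<phi> x + e * norm (\<phi> x)))"
        using G0[of x] r by simp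
    qed
  qed measurable
  define K where "K = integral\<^sup>L R G"
  interpret cov: bounded_linear "cov \<theta>"
    using linear_cov[OF T] by (simp add: linear_conv_bounded_linear)
  obtain L where L: "0 \<le> L" "\<And>u. norm (cov \<theta> u) \<le> norm u * L" using cov.nonneg_bounded by blast
  define m where "m = min (min k r) 1"
  have m: "0 < m" "m \<le> k" "m \<le> r" "m \<le> 1" using k r by (auto simp: m_def)
  show ?thesis
  proof (rule has_derivative_at_quadratic[OF cov.bounded_linear_axioms m(1), of _ _ "L / k + K"])
    fix u :: 'v assume u: "norm u < m"
    have T': "\<theta> + u \<in> \<Theta>" using quadD(2)[OF q k] u m by (force simp: dist_norm)
    define b where "b = breg \<theta> (\<theta> + u)"
    have b: "0 \<le> b" "b \<le> (norm u)\<^sup>2 / k"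
      using breg_nonneg[OF T, of "\<theta> + u"] T' Theta_natdom quadD(4)[OF q k, of "\<theta> + u"] u m
      by (auto simp: b_def)
    define Y where "Y x = u \<bullet> (\<phi> x - mv \<theta>)" for x
    have w': "w (\<theta> + u) x = exp (- b) * (w \<theta> x * exp (Y x))" for x
      by (simp add: w_def b_def breg_def Y_def exp_add[symmetric] algebra_simps)
    have i0: "integrable R (\<lambda>x. w \<theta> x *\<^sub>R (\<phi> x - mv \<theta>))" "integrable R (\<lambda>x. w (\<theta> + u) x *\<^sub>R (\<phi> x - mv \<theta>))"
      using integrable_phi[OF T] integrable_phi[OF T'] integrable_w_Theta[OF T] integrable_w_Theta[OF T']
      by (auto simp: scaleR_diff_right)
    have z0: "(\<integral>x. w \<theta> x *\<^sub>R (\<phi> x - mv \<theta>) \<partial>R) = 0"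
      using integrable_phi[OF T] integrable_w_Theta[OF T] integral_w_Theta[OF T]
      by (simp add: scaleR_diff_right mv_def)
    have "mv (\<theta> + u) - mv \<theta> = (\<integral>x. w (\<theta> + u) x *\<^sub>R (\<phi> x - mv \<theta>) \<partial>R)"
      using integrable_phi[OF T'] integrable_w_Theta[OF T'] integral_w_Theta[OF T']
      by (simp add: scaleR_diff_right mv_def)
    also have "\<dots> = (\<integral>x. exp (- b) *\<^sub>R ((w \<theta> x * exp (Y x)) *\<^sub>R (\<phi> x - mv \<theta>)) \<partial>R)" by (simp add: w')
    also have "\<dots> = exp (- b) *\<^sub>R (\<integral>x. (w \<theta> x * exp (Y x)) *\<^sub>R (\<phi> x - mv \<theta>) \<partial>R)"
      by (rule integral_scaleR_right)
    finally have mve: "mv (\<theta> + u) - mv \<theta> = exp (- b) *\<^sub>R (\<integral>x. (w \<theta> x * exp (Y x)) *\<^sub>R (\<phi> x - mv \<theta>) \<partial>R)" .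
    have i1: "integrable R (\<lambda>x. (w \<theta> x * exp (Y x)) *\<^sub>R (\<phi> x - mv \<theta>))"
    proof -
      have "integrable R (\<lambda>x. exp b *\<^sub>R (w (\<theta> + u) x *\<^sub>R (\<phi> x - mv \<theta>)))"
        using i0(2) by (intro integrable_scaleR_right)
      also have "(\<lambda>x. exp b *\<^sub>R (w (\<theta> + u) x *\<^sub>R (\<phi> x - mv \<theta>))) = (\<lambda>x. (w \<theta> x * exp (Y x)) *\<^sub>R (\<phi> x - mv \<theta>))"
        by (simp add: w' exp_minus fun_eq_iff)
      finally show ?thesis .
    qed
    define E where "E = (\<integral>x. (w \<theta> x * (exp (Y x) - 1 - Y x)) *\<^sub>R (\<phi> x - mv \<theta>) \<partial>R)"
    have i2: "integrable R (\<lambda>x. (w \<theta> x * (exp (Y x) - 1 - Y x)) *\<^sub>R (\<phi> x - mv \<theta>))"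
      and E: "E = (\<integral>x. (w \<theta> x * exp (Y x)) *\<^sub>R (\<phi> x - mv \<theta>) \<partial>R) - cov \<theta> u"
    proof -
      have eq: "(w \<theta> x * (exp (Y x) - 1 - Y x)) *\<^sub>R (\<phi> x - mv \<theta>) =
        (w \<theta> x * exp (Y x)) *\<^sub>R (\<phi> x - mv \<theta>) - w \<theta> x *\<^sub>R (\<phi> x - mv \<theta>) - w \<theta> x *\<^sub>R (Y x *\<^sub>R (\<phi> x - mv \<theta>))" for x
        by (simp add: algebra_simps)
      show "integrable R (\<lambda>x. (w \<theta> x * (exp (Y x) - 1 - Y x)) *\<^sub>R (\<phi> x - mv \<theta>))"
        unfolding eq Y_def[symmetric] using i1 i0 integrable_cov[OF T, of u, folded Y_def]
        by (intro Bochner_Integration.integrable_diff) auto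
      show "E = (\<integral>x. (w \<theta> x * exp (Y x)) *\<^sub>R (\<phi> x - mv \<theta>) \<partial>R) - cov \<theta> u"
        unfolding E_def eq cov_def Y_def[symmetric]
        using i1 i0 integrable_cov[OF T, of u, folded Y_def] z0
        by (simp del: scaleR_scaleR)
    qed
    have "norm E \<le> (\<integral>x. norm ((w \<theta> x * (exp (Y x) - 1 - Y x)) *\<^sub>R (\<phi> x - mv \<theta>)) \<partial>R)"
      unfolding E_def by (rule integral_norm_bound)
    also have "\<dots> \<le> (\<integral>x. (norm u)\<^sup>2 * G x \<partial>R)"
    proof (rule integral_mono[OF integrable_norm[OF i2]])
      show "integrable R (\<lambda>x. (norm u)\<^sup>2 * G x)" using iG by simp
      fix x
      let ?t = "norm (\<phi> x) + B"
      have t: "norm (\<phi> x - mv \<theta>) \<le> ?t" unfolding B_def by (rule norm_triangle_ineq4)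
      have Y: "\<bar>Y x\<bar> \<le> norm u * ?t"
        unfolding Y_def using t by (intro order_trans[OF Cauchy_Schwarz_ineq2] mult_left_mono) auto
      have Y2: "(Y x)\<^sup>2 \<le> (norm u * ?t)\<^sup>2" using Y by (simp add: abs_le_square_iff[symmetric] B_def)
      have "norm u * ?t \<le> r * ?t" using u m by (intro mult_right_mono) (auto simp: B_def)
      then have Yr: "exp \<bar>Y x\<bar> \<le> exp (r * ?t)" using Y by simp
      have "0 \<le> (Y x)\<^sup>2 / 2 * exp (- \<bar>Y x\<bar>)" by simp
      then have nn: "0 \<le> exp (Y x) - 1 - Y x" using exp_taylor2(1)[of "Y x"] by linarith
      have "exp (Y x) - 1 - Y x \<le> (Y x)\<^sup>2 * exp \<bar>Y x\<bar>"
      proof -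
        have "0 \<le> (Y x)\<^sup>2 * exp \<bar>Y x\<bar>" by simp
        moreover have "(Y x)\<^sup>2 / 2 * exp \<bar>Y x\<bar> = ((Y x)\<^sup>2 * exp \<bar>Y x\<bar>) / 2" by simp
        ultimately show ?thesis using exp_taylor2(2)[of "Y x"] by linarith
      qed
      also have "\<dots> \<le> (norm u * ?t)\<^sup>2 * exp (r * ?t)" using Y2 Yr by (intro mult_mono) auto
      finally have h: "exp (Y x) - 1 - Y x \<le> (norm u * ?t)\<^sup>2 * exp (r * ?t)" .
      have "norm ((w \<theta> x * (exp (Y x) - 1 - Y x)) *\<^sub>R (\<phi> x - mv \<theta>)) = w \<theta> x * ((exp (Y x) - 1 - Y x) * norm (\<phi> x - mv \<theta>))"
        using nn by (simp add: abs_mult)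
      also have "\<dots> \<le> w \<theta> x * (((norm u * ?t)\<^sup>2 * exp (r * ?t)) * ?t)"
        using h t nn by (intro mult_left_mono mult_mono) auto
      also have "\<dots> = (norm u)\<^sup>2 * G x"
        by (simp add: G_def power_mult_distrib power2_eq_square power3_eq_cube)
      finally show "norm ((w \<theta> x * (exp (Y x) - 1 - Y x)) *\<^sub>R (\<phi> x - mv \<theta>)) \<le> (norm u)\<^sup>2 * G x" .
    qed
    also have "\<dots> = K * (norm u)\<^sup>2" by (simp add: K_def)
    finally have En: "norm E \<le> K * (norm u)\<^sup>2" .
    have "mv (\<theta> + u) - mv \<theta> - cov \<theta> u = exp (- b) *\<^sub>R E - (1 - exp (- b)) *\<^sub>R cov \<theta> u"
      unfolding mve E by (simp add: algebra_simps)
    then have "norm (mv (\<theta> + u) - mv \<theta> - cov \<theta> u) \<le> norm (exp (- b) *\<^sub>R E) + norm ((1 - exp (- b)) *\<^sub>R cov \<theta> u)"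
      using norm_triangle_ineq4 by metis
    also have "\<dots> = exp (- b) * norm E + (1 - exp (- b)) * norm (cov \<theta> u)"
      using b(1) by simp
    also have "exp (- b) * norm E \<le> K * (norm u)\<^sup>2"
      using En b(1) mult_left_le_one_le[of "norm E" "exp (- b)"] by simp
    also have "(1 - exp (- b)) * norm (cov \<theta> u) \<le> ((norm u)\<^sup>2 / k) * (1 * L)"
    proof (rule mult_mono)
      show "1 - exp (- b) \<le> (norm u)\<^sup>2 / k" using exp_ge_add_one_self[of "- b"] b(2) by linarith
      have "norm u * L \<le> 1 * L" using u m L(1) by (intro mult_right_mono) auto
      then show "norm (cov \<theta> u) \<le> 1 * L" using L(2)[of u] by linarith
    qed (use k in auto)
    finally show "norm (mv (\<theta> + u) - mv \<theta> - cov \<theta> u) \<le> (L / k + K) * (norm u)\<^sup>2"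
      by (simp add: algebra_simps)
  qed
qed

text \<open>\<open>cov\<close> is injective since \<open>var\<close> is positive definite, and in
  finite dimension its left inverse J is two-sided. Differentiability of the inverse then follows
  from that of \<open>mv\<close> together with continuity of \<open>th\<close>.\<close>

lemma th_has_derivative:
  assumes \<mu>: "\<mu> \<in> mv ` \<Theta>"
  obtains J where "linear J" "(th has_derivative J) (at \<mu>)" "\<And>v. cov (th \<mu>) (J v) = v"
proof -
  note T = th_in[OF \<mu>]
  obtain k where k: "0 < k" and q: "quad k (th \<mu>)" by (rule quad_exists[OF T])
  have inj: "inj (cov (th \<mu>))"
  proof (rule linear_injective_0[OF linear_cov[OF T], THEN iffD2], intro allI impI)
    fix x assume "cov (th \<mu>) x = 0"
    then have "k * (norm x)\<^sup>2 \<le> 0" using quadD(5)[OF q k, of x] by (simp add: var_cov[OF T])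
    then show "x = 0" using k by (simp add: mult_le_0_iff)
  qed
  obtain J where J: "linear J" "J \<circ> cov (th \<mu>) = id"
    using linear_injective_left_inverse[OF linear_cov[OF T] inj] by blast
  have surj: "surj (cov (th \<mu>))" by (rule linear_injective_imp_surjective[OF linear_cov[OF T] inj refl])
  have right: "cov (th \<mu>) (J v) = v" for v
  proof -
    obtain z where "v = cov (th \<mu>) z" using surj by (auto simp: surj_def)
    then show ?thesis using J(2) by (metis comp_apply id_apply)
  qed
  have "(th has_derivative J) (at \<mu>)"
  proof (rule has_derivative_inverse_basic)
    show "(mv has_derivative cov (th \<mu>)) (at (th \<mu>))" by (rule mv_has_derivative[OF T])
    show "bounded_linear J" using J(1) by (simp add: linear_conv_bounded_linear)
    show "isCont th \<mu>" using continuous_th \<mu> open_mv continuous_on_eq_continuous_at by blast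
  qed (use J(2) open_mv \<mu> mv_th in auto)
  then show ?thesis using that J(1) right by blast
qed

subsection \<open>Changing the first argument of a divergence\<close>

text \<open>On a compact set distances of parameters are bounded, so the truncation in
  \<open>mv_separation\<close> costs only a constant. The second bound follows since
  \<open>breg\<close> is at most its symmetrisation.\<close>

lemma compact_constants:
  assumes T: "compact T" "T \<subseteq> \<Theta>"
  obtains A where "0 < A"
    "\<And>\<theta> \<theta>'. \<theta> \<in> T \<Longrightarrow> \<theta>' \<in> T \<Longrightarrow> norm (\<theta>' - \<theta>) \<le> A * norm (mv \<theta>' - mv \<theta>)"
    "\<And>\<theta> \<theta>'. \<theta> \<in> T \<Longrightarrow> \<theta>' \<in> T \<Longrightarrow> breg \<theta> \<theta>' \<le> A * (norm (mv \<theta>' - mv \<theta>))\<^sup>2"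
proof -
  obtain k where k: "0 < k" and q: "\<And>\<theta>. \<theta> \<in> T \<Longrightarrow> quad k \<theta>" using uniform_quad[OF T] by blast
  obtain D0 where D0: "\<And>\<theta>. \<theta> \<in> T \<Longrightarrow> norm \<theta> \<le> D0" using compact_imp_bounded[OF T(1)] by (auto simp: bounded_iff)
  define D where "D = max D0 1"
  have D: "1 \<le> D" "\<And>\<theta>. \<theta> \<in> T \<Longrightarrow> norm \<theta> \<le> D" using D0 by (force simp: D_def)+
  \<comment> \<open>Chosen so that \<open>\<kappa> * N \<le> min N k\<close> for every distance N up
    to \<open>2 * D\<close>.\<close>
  define \<kappa> where "\<kappa> = min 1 (k / (2 * D))"
  have \<kappa>: "0 < \<kappa>" "\<kappa> \<le> 1" "\<kappa> * (2 * D) \<le> k" using k D(1) by (auto simp: \<kappa>_def min_def field_simps)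
  have sep: "k * \<kappa> * norm (\<theta>' - \<theta>) \<le> norm (mv \<theta>' - mv \<theta>)" if t: "\<theta> \<in> T" "\<theta>' \<in> T" for \<theta> \<theta>'
  proof -
    have "norm (\<theta>' - \<theta>) \<le> 2 * D" using D(2)[OF t(1)] D(2)[OF t(2)] norm_triangle_ineq4[of \<theta>' \<theta>] by linarith
    then have "\<kappa> * norm (\<theta>' - \<theta>) \<le> \<kappa> * (2 * D)" using \<kappa>(1) by (intro mult_left_mono) auto
    moreover have "\<kappa> * norm (\<theta>' - \<theta>) \<le> 1 * norm (\<theta>' - \<theta>)" using \<kappa>(2) by (intro mult_right_mono) auto
    ultimately have "\<kappa> * norm (\<theta>' - \<theta>) \<le> min (norm (\<theta>' - \<theta>)) k" using \<kappa>(3) by simp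
    then have "k * (\<kappa> * norm (\<theta>' - \<theta>)) \<le> k * min (norm (\<theta>' - \<theta>)) k" using k by (intro mult_left_mono) auto
    then show ?thesis using mv_separation[OF q[OF t(1)] k, of \<theta>'] t T(2) by (auto simp: mult.assoc)
  qed
  define A where "A = 1 / (k * \<kappa>)"
  have A: "0 < A" using k \<kappa> by (simp add: A_def)
  have n: "norm (\<theta>' - \<theta>) \<le> A * norm (mv \<theta>' - mv \<theta>)" if t: "\<theta> \<in> T" "\<theta>' \<in> T" for \<theta> \<theta>'
    using sep[OF t] k \<kappa> by (simp add: A_def field_simps)
  have "breg \<theta> \<theta>' \<le> A * (norm (mv \<theta>' - mv \<theta>))\<^sup>2" if t: "\<theta> \<in> T" "\<theta>' \<in> T" for \<theta> \<theta>'
  proof -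
    have "\<theta>' \<in> \<Theta>" "\<theta> \<in> natdom" using t T(2) Theta_natdom by auto
    then have "0 \<le> breg \<theta>' \<theta>" by (rule breg_nonneg)
    then have "breg \<theta> \<theta>' \<le> (mv \<theta>' - mv \<theta>) \<bullet> (\<theta>' - \<theta>)" using breg_sym[of \<theta> \<theta>'] by linarith
    also have "\<dots> \<le> norm (mv \<theta>' - mv \<theta>) * norm (\<theta>' - \<theta>)" by (rule norm_cauchy_schwarz)
    also have "\<dots> \<le> norm (mv \<theta>' - mv \<theta>) * (A * norm (mv \<theta>' - mv \<theta>))" using n[OF t] by (intro mult_left_mono) auto
    finally show ?thesis by (simp add: power2_eq_square mult_ac)
  qed
  then show ?thesis using that A n by blast
qed

text \<open>The three-point identity leaves the cross term \<open>(\<theta>' - \<theta>0) \<bullet>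
  (mv \<theta> - mv \<theta>0)\<close>, at most \<open>n * \<Delta>\<close>. For n up to k it is
  split into squares, and \<open>n\<^sup>2\<close> is paid for by the quadratic growth of
  \<open>breg \<theta>0\<close>; beyond, the linear growth pays for n because \<Delta> is bounded on
  T.\<close>

lemma breg_shift:
  assumes T: "compact T" "T \<subseteq> \<Theta>"
  obtains A where "0 < A"
    "\<And>\<theta> \<theta>0 \<theta>'. \<theta> \<in> T \<Longrightarrow> \<theta>0 \<in> T \<Longrightarrow> \<theta>' \<in> \<Theta> \<Longrightarrow>
       breg \<theta> \<theta>' \<le> A * ((norm (mv \<theta> - mv \<theta>0))\<^sup>2 + breg \<theta>0 \<theta>')"
proof -
  obtain k where k: "0 < k" and q: "\<And>\<theta>. \<theta> \<in> T \<Longrightarrow> quad k \<theta>" using uniform_quad[OF T] by blast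
  obtain A where A: "0 < A"
    "\<And>\<theta> \<theta>'. \<theta> \<in> T \<Longrightarrow> \<theta>' \<in> T \<Longrightarrow> breg \<theta> \<theta>' \<le> A * (norm (mv \<theta>' - mv \<theta>))\<^sup>2"
    by (rule compact_constants[OF T]) blast
  have "bounded (mv ` T)"
    using T continuous_mv by (meson compact_continuous_image compact_imp_bounded continuous_on_subset)
  then obtain D where D: "\<And>\<theta>. \<theta> \<in> T \<Longrightarrow> norm (mv \<theta>) \<le> D" by (auto simp: bounded_iff)
  define B where "B = 1 + A + 1 / k + 2 * \<bar>D\<bar> / k\<^sup>2"
  have B: "0 < B" using k A(1) by (auto simp: B_def intro!: add_pos_nonneg)
  have "breg \<theta> \<theta>' \<le> B * ((norm (mv \<theta> - mv \<theta>0))\<^sup>2 + breg \<theta>0 \<theta>')"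
    if t: "\<theta> \<in> T" "\<theta>0 \<in> T" "\<theta>' \<in> \<Theta>" for \<theta> \<theta>0 \<theta>'
  proof -
    define \<Delta> where "\<Delta> = norm (mv \<theta> - mv \<theta>0)"
    define n where "n = norm (\<theta>' - \<theta>0)"
    define b where "b = breg \<theta>0 \<theta>'"
    have nat: "\<theta>' \<in> natdom" using t(3) Theta_natdom by auto
    have b0: "0 \<le> b" unfolding b_def using t T(2) nat by (intro breg_nonneg) auto
    have n0: "0 \<le> n" "0 \<le> \<Delta>" by (auto simp: n_def \<Delta>_def)
    have "breg \<theta> \<theta>' = b + breg \<theta> \<theta>0 - (\<theta>' - \<theta>0) \<bullet> (mv \<theta> - mv \<theta>0)"
      by (simp add: b_def breg_def algebra_simps)
    also have "\<dots> \<le> b + A * \<Delta>\<^sup>2 + n * \<Delta>"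
      using A(2)[OF t(1,2)] Cauchy_Schwarz_ineq2[of "\<theta>' - \<theta>0" "mv \<theta> - mv \<theta>0"]
      by (simp add: \<Delta>_def n_def norm_minus_commute)
    also have "n * \<Delta> \<le> (1 / k + 2 * \<bar>D\<bar> / k\<^sup>2) * b + \<Delta>\<^sup>2"
    proof (cases "n \<le> k")
      case True
      have "k * n\<^sup>2 \<le> b" using quadD(3)[OF q[OF t(2)] k, of \<theta>'] True by (simp add: n_def b_def)
      then have "n\<^sup>2 \<le> 1 / k * b" using k by (simp add: field_simps)
      moreover have "n * \<Delta> \<le> n\<^sup>2 + \<Delta>\<^sup>2"
      proof -
        have "0 \<le> (n - \<Delta>)\<^sup>2" "0 \<le> n\<^sup>2" "0 \<le> \<Delta>\<^sup>2" by auto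
        then show ?thesis unfolding power2_diff by linarith
      qed
      moreover have "0 \<le> 2 * \<bar>D\<bar> / k\<^sup>2 * b" using b0 by simp
      ultimately show ?thesis unfolding distrib_right by linarith
    next
      case False
      have "k * k * n \<le> b" using breg_lower[OF q[OF t(2)] k nat] False by (simp add: n_def b_def min_def)
      then have "n \<le> b / k\<^sup>2" using k by (simp add: field_simps power2_eq_square)
      moreover have "\<Delta> \<le> 2 * \<bar>D\<bar>"
        unfolding \<Delta>_def using D[OF t(1)] D[OF t(2)] norm_triangle_ineq4[of "mv \<theta>" "mv \<theta>0"] by linarith
      ultimately have "n * \<Delta> \<le> b / k\<^sup>2 * (2 * \<bar>D\<bar>)" using n0 by (intro mult_mono) auto
      moreover have "b / k\<^sup>2 * (2 * \<bar>D\<bar>) = 2 * \<bar>D\<bar> / k\<^sup>2 * b" by simp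
      moreover have "0 \<le> 1 / k * b" "0 \<le> \<Delta>\<^sup>2" using b0 k by auto
      ultimately show ?thesis unfolding distrib_right by linarith
    qed
    also have "b + A * \<Delta>\<^sup>2 + ((1 / k + 2 * \<bar>D\<bar> / k\<^sup>2) * b + \<Delta>\<^sup>2) =
        (1 + 1 / k + 2 * \<bar>D\<bar> / k\<^sup>2) * b + (1 + A) * \<Delta>\<^sup>2" by (simp add: algebra_simps)
    also have "\<dots> \<le> B * b + B * \<Delta>\<^sup>2"
      using b0 k A(1) by (intro add_mono mult_right_mono) (auto simp: B_def)
    finally show ?thesis by (simp add: b_def \<Delta>_def algebra_simps)
  qed
  then show ?thesis using that B by blast
qed

section \<open>The midpoint gap and the Hellinger affinity\<close>

text \<open>The Bhattacharyya distance: minus the logarithm of the affinity, hence half of the Renyi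
  divergence of order 1/2.\<close>

definition bgap :: "'v \<Rightarrow> 'v \<Rightarrow> real" where
  "bgap \<theta> \<theta>' = (psi \<theta> + psi \<theta>') / 2 - psi ((1/2) *\<^sub>R (\<theta> + \<theta>'))"

lemma midpoint_natdom:
  assumes "\<theta> \<in> natdom" "\<theta>' \<in> natdom"
  shows "(1/2) *\<^sub>R (\<theta> + \<theta>') \<in> natdom"
  using convexD[OF convex_on_imp_convex[OF psi_convex] assms, of "1/2" "1/2"] by (simp add: scaleR_add_right)

lemma bgap_nonneg:
  assumes "\<theta> \<in> natdom" "\<theta>' \<in> natdom"
  shows "0 \<le> bgap \<theta> \<theta>'"
  using convex_onD[OF psi_convex, of "1/2" \<theta> \<theta>'] assms by (simp add: bgap_def scaleR_add_right field_simps)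

lemma bgap_le_breg:
  assumes "\<theta> \<in> \<Theta>" "\<theta>' \<in> natdom"
  shows "bgap \<theta> \<theta>' \<le> breg \<theta> \<theta>' / 2"
proof -
  have "0 \<le> breg \<theta> ((1/2) *\<^sub>R (\<theta> + \<theta>'))"
    using assms Theta_natdom by (intro breg_nonneg midpoint_natdom) auto
  moreover have "((1/2) *\<^sub>R (\<theta> + \<theta>') - \<theta>) \<bullet> mv \<theta> = ((\<theta>' - \<theta>) \<bullet> mv \<theta>) / 2"
    by (simp add: algebra_simps)
  ultimately show ?thesis by (simp add: breg_def bgap_def field_simps)
qed

text \<open>Midpoints with \<open>\<theta>'\<close> may leave \<open>\<Theta>\<close>, where no derivative of \<open>psi\<close> is available; extending the
  segment from \<open>\<theta>\<close> beyond \<open>\<theta>0\<close> to a point \<open>\<zeta>\<close> leaves only divergences near \<open>\<theta>0\<close> on the right.\<close>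

lemma bgap_segment:
  assumes l: "0 \<le> l" "l \<le> 1" and nd: "\<theta> \<in> natdom" "\<zeta> \<in> natdom" "\<theta>' \<in> natdom"
    and \<theta>0: "\<theta>0 = (1 - l) *\<^sub>R \<theta> + l *\<^sub>R \<zeta>"
  shows "(1 - l) * bgap \<theta> \<theta>' \<le> bgap \<theta>0 \<theta>' + ((1 - l) * breg \<theta>0 \<theta> + l * breg \<theta>0 \<zeta>) / 2"
proof -
  have e: "(1/2) *\<^sub>R (\<theta>0 + \<theta>') = (1 - l) *\<^sub>R ((1/2) *\<^sub>R (\<theta> + \<theta>')) + l *\<^sub>R ((1/2) *\<^sub>R (\<zeta> + \<theta>'))"
    unfolding \<theta>0 by (simp add: algebra_simps diff_divide_distrib)
  have 1: "psi ((1/2) *\<^sub>R (\<theta>0 + \<theta>')) \<le> (1 - l) * psi ((1/2) *\<^sub>R (\<theta> + \<theta>')) + l * psi ((1/2) *\<^sub>R (\<zeta> + \<theta>'))"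
    unfolding e using l nd by (intro convex_onD[OF psi_convex] midpoint_natdom) auto
  have "0 \<le> l * bgap \<zeta> \<theta>'" using l bgap_nonneg nd by simp
  then have 2: "l * psi ((1/2) *\<^sub>R (\<zeta> + \<theta>')) \<le> l * (psi \<zeta> + psi \<theta>') / 2"
    by (simp add: bgap_def algebra_simps)
  have "(1 - l) * ((\<theta> - \<theta>0) \<bullet> mv \<theta>0) + l * ((\<zeta> - \<theta>0) \<bullet> mv \<theta>0) = 0"
    unfolding inner_scaleR_left[symmetric] inner_add_left[symmetric] by (simp add: \<theta>0 algebra_simps)
  then have 3: "(1 - l) * breg \<theta>0 \<theta> + l * breg \<theta>0 \<zeta> = (1 - l) * psi \<theta> + l * psi \<zeta> - psi \<theta>0"
    unfolding breg_def by (simp add: algebra_simps)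
  have "(1 - l) * bgap \<theta> \<theta>' = (1 - l) * (psi \<theta> + psi \<theta>') / 2 - (1 - l) * psi ((1/2) *\<^sub>R (\<theta> + \<theta>'))"
    by (simp add: bgap_def algebra_simps)
  also have "\<dots> \<le> (1 - l) * (psi \<theta> + psi \<theta>') / 2 - psi ((1/2) *\<^sub>R (\<theta>0 + \<theta>')) + l * (psi \<zeta> + psi \<theta>') / 2"
    using 1 2 by linarith
  also have "\<dots> = bgap \<theta>0 \<theta>' + ((1 - l) * psi \<theta> + l * psi \<zeta> - psi \<theta>0) / 2"
    by (simp add: bgap_def field_simps)
  finally show ?thesis unfolding 3 .
qed

text \<open>\<open>bgap_segment\<close> for a point \<zeta> slightly beyond
  \<open>\<theta>0\<close>. On the compact set both Bregman terms are of order
  \<open>\<Delta>\<^sup>2\<close>, and dividing by \<open>1 - l\<close>, which is bounded away from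
  0, gives the claim. No bound on \<theta>' is involved.\<close>

lemma bgap_shift:
  assumes T: "compact T" "T \<subseteq> \<Theta>"
  obtains A where "0 < A"
    "\<And>\<theta> \<theta>0 \<theta>'. \<theta> \<in> T \<Longrightarrow> \<theta>0 \<in> T \<Longrightarrow> \<theta>' \<in> \<Theta> \<Longrightarrow>
       bgap \<theta> \<theta>' \<le> A * ((norm (mv \<theta> - mv \<theta>0))\<^sup>2 + bgap \<theta>0 \<theta>')"
proof -
  obtain k where k: "0 < k" and q: "\<And>\<theta>. \<theta> \<in> T \<Longrightarrow> quad k \<theta>" using uniform_quad[OF T] by blast
  obtain A where A: "0 < A"
    "\<And>\<theta> \<theta>'. \<theta> \<in> T \<Longrightarrow> \<theta>' \<in> T \<Longrightarrow> norm (\<theta>' - \<theta>) \<le> A * norm (mv \<theta>' - mv \<theta>)"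
    "\<And>\<theta> \<theta>'. \<theta> \<in> T \<Longrightarrow> \<theta>' \<in> T \<Longrightarrow> breg \<theta> \<theta>' \<le> A * (norm (mv \<theta>' - mv \<theta>))\<^sup>2"
    by (rule compact_constants[OF T]) blast
  obtain D0 where D0: "\<And>\<theta>. \<theta> \<in> T \<Longrightarrow> norm \<theta> \<le> D0" using compact_imp_bounded[OF T(1)] by (auto simp: bounded_iff)
  define D where "D = max D0 1"
  have D: "1 \<le> D" "\<And>\<theta>. \<theta> \<in> T \<Longrightarrow> norm \<theta> \<le> D" using D0 by (force simp: D_def)+
  \<comment> \<open>Points of T are at most \<open>2 * D\<close> apart, so \<zeta> stays within k of
    \<open>\<theta>0\<close>, where the quadratic upper bound for \<open>breg\<close> is available.
    The value \<open>l = 1 / (1 + s)\<close> is the position of \<open>\<theta>0\<close> on the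
    segment from \<theta> to \<zeta>.\<close>
  define s where "s = min 1 (k / (2 * D))"
  have s: "0 < s" "s \<le> 1" "s * (2 * D) \<le> k" using k D(1) by (auto simp: s_def min_def field_simps)
  define l where "l = 1 / (1 + s)"
  have l: "0 < l" "l < 1" "1 - l = s * l" "l * (1 + s) = 1" using s by (auto simp: l_def field_simps)
  define B where "B = (1 + A + A\<^sup>2 / k) / (1 - l)"
  have B: "0 < B" using l A(1) k by (auto simp: B_def intro!: divide_pos_pos add_pos_nonneg)
  have "bgap \<theta> \<theta>' \<le> B * ((norm (mv \<theta> - mv \<theta>0))\<^sup>2 + bgap \<theta>0 \<theta>')"
    if t: "\<theta> \<in> T" "\<theta>0 \<in> T" "\<theta>' \<in> \<Theta>" for \<theta> \<theta>0 \<theta>'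
  proof -
    define \<Delta> where "\<Delta> = norm (mv \<theta> - mv \<theta>0)"
    define \<zeta> where "\<zeta> = \<theta>0 + s *\<^sub>R (\<theta>0 - \<theta>)"
    have nz: "norm (\<zeta> - \<theta>0) = s * norm (\<theta>0 - \<theta>)" using s by (simp add: \<zeta>_def)
    have "norm (\<theta>0 - \<theta>) \<le> 2 * D" using D(2)[OF t(1)] D(2)[OF t(2)] norm_triangle_ineq4[of \<theta>0 \<theta>] by linarith
    then have "s * norm (\<theta>0 - \<theta>) \<le> s * (2 * D)" using s(1) by (intro mult_left_mono) auto
    then have nk: "norm (\<zeta> - \<theta>0) \<le> k" using s(3) nz by linarith
    have \<zeta>: "\<zeta> \<in> \<Theta>" using quadD(2)[OF q[OF t(2)] k] nk by (auto simp: dist_norm norm_minus_commute)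
    have nat: "\<theta> \<in> natdom" "\<zeta> \<in> natdom" "\<theta>' \<in> natdom" "\<theta>0 \<in> natdom" using t T(2) \<zeta> Theta_natdom by auto
    have "\<theta>0 = (l * (1 + s)) *\<^sub>R \<theta>0" using l(4) by simp
    also have "\<dots> = (1 - l) *\<^sub>R \<theta> + l *\<^sub>R \<zeta>"
      unfolding \<zeta>_def l(3) by (simp add: algebra_simps)
    finally have seg: "\<theta>0 = (1 - l) *\<^sub>R \<theta> + l *\<^sub>R \<zeta>" .
    have "norm (\<zeta> - \<theta>0) \<le> 1 * norm (\<theta>0 - \<theta>)" unfolding nz using s by (intro mult_right_mono) auto
    also have "\<dots> \<le> A * \<Delta>" using A(2)[OF t(1,2)] by (simp add: \<Delta>_def norm_minus_commute)
    finally have nA: "norm (\<zeta> - \<theta>0) \<le> A * \<Delta>" .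
    have "breg \<theta>0 \<zeta> \<le> (norm (\<zeta> - \<theta>0))\<^sup>2 / k" by (rule quadD(4)[OF q[OF t(2)] k nk])
    also have "\<dots> \<le> (A * \<Delta>)\<^sup>2 / k" using nA k by (intro divide_right_mono power_mono) auto
    finally have b1: "breg \<theta>0 \<zeta> \<le> A\<^sup>2 / k * \<Delta>\<^sup>2" by (simp add: power_mult_distrib)
    have b2: "breg \<theta>0 \<theta> \<le> A * \<Delta>\<^sup>2" using A(3)[OF t(2,1)] by (simp add: \<Delta>_def)
    have nn: "0 \<le> A * \<Delta>\<^sup>2" "0 \<le> A\<^sup>2 / k * \<Delta>\<^sup>2" using A k by auto
    have half: "(X + Y) / 2 \<le> a + b" if "X \<le> a" "Y \<le> b" "0 \<le> a" "0 \<le> b" for X Y a b :: real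
      using that by simp
    have "(1 - l) * breg \<theta>0 \<theta> \<le> 1 * (A * \<Delta>\<^sup>2)"
      using b2 l nn breg_nonneg[of \<theta>0 \<theta>] t T(2) nat by (intro mult_mono) auto
    moreover have "l * breg \<theta>0 \<zeta> \<le> 1 * (A\<^sup>2 / k * \<Delta>\<^sup>2)"
      using b1 l nn breg_nonneg[of \<theta>0 \<zeta>] t T(2) nat by (intro mult_mono) auto
    ultimately have "((1 - l) * breg \<theta>0 \<theta> + l * breg \<theta>0 \<zeta>) / 2 \<le> A * \<Delta>\<^sup>2 + A\<^sup>2 / k * \<Delta>\<^sup>2"
      using nn half[of "(1 - l) * breg \<theta>0 \<theta>" "A * \<Delta>\<^sup>2" "l * breg \<theta>0 \<zeta>" "A\<^sup>2 / k * \<Delta>\<^sup>2"] by simp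
    moreover have "(1 - l) * bgap \<theta> \<theta>' \<le> bgap \<theta>0 \<theta>' + ((1 - l) * breg \<theta>0 \<theta> + l * breg \<theta>0 \<zeta>) / 2"
      using l nat seg by (intro bgap_segment) auto
    ultimately have "(1 - l) * bgap \<theta> \<theta>' \<le> bgap \<theta>0 \<theta>' + (A + A\<^sup>2 / k) * \<Delta>\<^sup>2"
      unfolding distrib_right by (rule order_trans[OF _ add_left_mono, rotated])
    also have "\<dots> \<le> (1 + A + A\<^sup>2 / k) * bgap \<theta>0 \<theta>' + (1 + A + A\<^sup>2 / k) * \<Delta>\<^sup>2"
      using A k bgap_nonneg[OF nat(4,3)] by (intro add_mono mult_right_mono) (auto simp: mult_le_cancel_right1)
    also have "\<dots> = (1 - l) * (B * (\<Delta>\<^sup>2 + bgap \<theta>0 \<theta>'))"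
    proof -
      have "(1 - l) * B = 1 + A + A\<^sup>2 / k" using l(2) by (simp add: B_def)
      then show ?thesis by (simp add: mult.assoc[symmetric] distrib_left)
    qed
    finally show ?thesis using l(2) unfolding \<Delta>_def[symmetric] by (subst (asm) mult_le_cancel_left_pos) auto
  qed
  then show ?thesis using that B by blast
qed

text \<open>The geometric mean of two members of the family is a multiple of the weight at the
  midpoint of their parameters.\<close>

lemma affinity_exp:
  assumes nd: "\<theta> \<in> natdom" "\<theta>' \<in> natdom"
  shows "integrable R (\<lambda>x. sqrt (w \<theta> x * w \<theta>' x))" "(\<integral>x. sqrt (w \<theta> x * w \<theta>' x) \<partial>R) = exp (- bgap \<theta> \<theta>')"
proof -
  have eq: "sqrt (w \<theta> x * w \<theta>' x) = exp (- bgap \<theta> \<theta>') * w ((1/2) *\<^sub>R (\<theta> + \<theta>')) x" for x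
  proof (rule real_sqrt_unique)
    show "(exp (- bgap \<theta> \<theta>') * w ((1/2) *\<^sub>R (\<theta> + \<theta>')) x)\<^sup>2 = w \<theta> x * w \<theta>' x"
      by (simp add: w_def exp_add[symmetric] power2_eq_square) (simp add: bgap_def algebra_simps)
  qed auto
  show "integrable R (\<lambda>x. sqrt (w \<theta> x * w \<theta>' x))"
    unfolding eq using integrable_w[OF midpoint_natdom[OF nd]] by simp
  show "(\<integral>x. sqrt (w \<theta> x * w \<theta>' x) \<partial>R) = exp (- bgap \<theta> \<theta>')"
    unfolding eq using integral_w[OF midpoint_natdom[OF nd]] by simp
qed

text \<open>The squared Hellinger distance is a squared norm of a difference of square roots of
  weights, and the square of a sum is at most twice the sum of squares.\<close>

lemma hellinger_triangle:
  assumes nd: "\<theta> \<in> natdom" "\<theta>0 \<in> natdom" "\<theta>' \<in> natdom"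
  shows "1 - exp (- bgap \<theta> \<theta>') \<le> 2 * (1 - exp (- bgap \<theta> \<theta>0)) + 2 * (1 - exp (- bgap \<theta>0 \<theta>'))"
proof -
  define H where "H a b x = (sqrt (w a x) - sqrt (w b x))\<^sup>2" for a b x
  have H: "integrable R (H a b)" "(\<integral>x. H a b x \<partial>R) = 2 * (1 - exp (- bgap a b))" if "a \<in> natdom" "b \<in> natdom" for a b
  proof -
    have eq: "H a b = (\<lambda>x. w a x + w b x - 2 * sqrt (w a x * w b x))"
      by (auto simp: H_def power2_diff real_sqrt_mult fun_eq_iff)
    show "integrable R (H a b)" "(\<integral>x. H a b x \<partial>R) = 2 * (1 - exp (- bgap a b))"
      unfolding eq using that by (auto simp: integrable_w integral_w affinity_exp)
  qed
  have "(\<integral>x. H \<theta> \<theta>' x \<partial>R) \<le> (\<integral>x. 2 * H \<theta> \<theta>0 x + 2 * H \<theta>0 \<theta>' x \<partial>R)"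
  proof (rule integral_mono)
    fix x
    have "0 \<le> ((sqrt (w \<theta> x) - sqrt (w \<theta>0 x)) - (sqrt (w \<theta>0 x) - sqrt (w \<theta>' x)))\<^sup>2" by simp
    then show "H \<theta> \<theta>' x \<le> 2 * H \<theta> \<theta>0 x + 2 * H \<theta>0 \<theta>' x"
      unfolding H_def by (simp add: power2_eq_square algebra_simps)
  qed (use H nd in auto)
  also have "\<dots> = 2 * (\<integral>x. H \<theta> \<theta>0 x \<partial>R) + 2 * (\<integral>x. H \<theta>0 \<theta>' x \<partial>R)" using H nd by simp
  finally show ?thesis using H(2) nd by simp
qed

section \<open>Continuity of the divergences in the second argument\<close>

text \<open>A convex function is continuous on an open convex set. The hull lies in
  \<open>natdom\<close>, which is convex, and it contains the midpoints needed for
  \<open>bgap\<close>.\<close>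

lemma continuous_psi_hull: "continuous_on (convex hull \<Theta>) psi"
proof (rule convex_on_continuous)
  show "open (convex hull \<Theta>)" by (rule open_convex_hull[OF open_Theta])
  have "convex hull \<Theta> \<subseteq> natdom"
    by (rule hull_minimal[of \<Theta> natdom convex, OF Theta_natdom convex_on_imp_convex[OF psi_convex]])
  then show "convex_on (convex hull \<Theta>) psi" using psi_convex by (simp add: convex_on_subset)
qed

lemma continuous_breg: "continuous_on \<Theta> (breg \<theta>)"
  unfolding breg_def[abs_def]
  by (intro continuous_intros continuous_on_subset[OF continuous_psi_hull hull_subset])

lemma continuous_bgap:
  assumes "\<theta> \<in> \<Theta>"
  shows "continuous_on \<Theta> (bgap \<theta>)"
proof -
  have sub: "(\<lambda>\<theta>'. (1/2) *\<^sub>R (\<theta> + \<theta>')) ` \<Theta> \<subseteq> convex hull \<Theta>"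
  proof clarify
    fix y assume y: "y \<in> \<Theta>"
    have "(1/2) *\<^sub>R \<theta> + (1/2) *\<^sub>R y \<in> convex hull \<Theta>"
      using hull_subset[of \<Theta> convex] assms y by (intro convexD[OF convex_convex_hull]) auto
    then show "(1/2) *\<^sub>R (\<theta> + y) \<in> convex hull \<Theta>" by (simp add: scaleR_add_right)
  qed
  have "continuous_on \<Theta> (\<lambda>\<theta>'. psi ((1/2) *\<^sub>R (\<theta> + \<theta>')))"
    by (rule continuous_on_compose2[OF continuous_psi_hull _ sub]) (intro continuous_intros)
  then show ?thesis unfolding bgap_def[abs_def]
    by (intro continuous_on_diff continuous_on_divide continuous_on_add continuous_on_const
      continuous_on_subset[OF continuous_psi_hull hull_subset]) auto
qed

subsection \<open>Likelihood ratios and Bayes marginals\<close>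

text \<open>The exponent is the log-likelihood ratio of j observations with centred sum v. Writing N
  for the distance of the parameters, separation of the means by \<Delta> gives
  \<open>\<kappa> * \<Delta> \<le> min N k\<close>, so by \<open>breg_lower\<close> the drift is at
  least linear in N with slope proportional to \<Delta>, just like the noise term. A small s
  therefore wins for all N at once. The factor 2 in the bound on v leaves room for a difference of
  two initial sums.\<close>

lemma exponent_bound:
  assumes T: "compact T" "T \<subseteq> \<Theta>" and D: "0 \<le> D"
  obtains c s0 where "0 < c" "0 < s0"
    "\<And>s \<theta> \<theta>' \<Delta> n j v. s \<le> s0 \<Longrightarrow> \<theta> \<in> T \<Longrightarrow> \<theta>' \<in> \<Theta> \<Longrightarrow> 0 \<le> \<Delta> \<Longrightarrow> \<Delta> \<le> D \<Longrightarrow>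
       \<Delta> \<le> norm (mv \<theta>' - mv \<theta>) \<Longrightarrow> 0 \<le> n \<Longrightarrow> n / 8 \<le> j \<Longrightarrow> norm v \<le> 2 * s * n * \<Delta> \<Longrightarrow>
       (\<theta>' - \<theta>) \<bullet> v - j * breg \<theta> \<theta>' \<le> - c * (n * \<Delta>\<^sup>2)"
proof -
  obtain k where k: "0 < k" and q: "\<And>\<theta>. \<theta> \<in> T \<Longrightarrow> quad k \<theta>" using uniform_quad[OF T] by blast
  \<comment> \<open>The entry \<open>k / 4\<close> matches the Lipschitz constant of
    \<open>mv\<close> for nearby \<theta>'; the other one uses \<open>\<Delta> \<le> D\<close> for
    distant ones.\<close>
  define \<kappa> where "\<kappa> = min (k / 4) (k / (2 * (D + 1)))"
  have \<kappa>: "0 < \<kappa>" using k D by (simp add: \<kappa>_def)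
  have \<kappa>4: "\<kappa> \<le> k / 4" unfolding \<kappa>_def by (rule min.cobounded1)
  have \<kappa>D: "\<kappa> * D \<le> k / 2"
  proof -
    have "\<kappa> * D \<le> k / (2 * (D + 1)) * (D + 1)" using k D \<kappa> by (intro mult_mono) (auto simp: \<kappa>_def)
    also have "\<dots> = k / 2" using D by (simp add: field_simps)
    finally show ?thesis .
  qed
  \<comment> \<open>With these values the noise is at most half of the drift
    \<open>n / 8 * (k * (\<kappa> * \<Delta>) * N)\<close>; \<open>c\<close> comes from the
    remaining half with N replaced by its lower bound \<open>\<kappa> * \<Delta>\<close>.\<close>
  define c where "c = k * \<kappa>\<^sup>2 / 16"
  define s0 where "s0 = k * \<kappa> / 32"
  have pos: "0 < c" "0 < s0" using k \<kappa> by (auto simp: c_def s0_def)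
  have "(\<theta>' - \<theta>) \<bullet> v - j * breg \<theta> \<theta>' \<le> - c * (n * \<Delta>\<^sup>2)"
    if h: "s \<le> s0" "\<theta> \<in> T" "\<theta>' \<in> \<Theta>" "0 \<le> \<Delta>" "\<Delta> \<le> D" "\<Delta> \<le> norm (mv \<theta>' - mv \<theta>)" "0 \<le> n" "n / 8 \<le> j"
      "norm v \<le> 2 * s * n * \<Delta>" for s \<theta> \<theta>' \<Delta> n j v
  proof -
    define N where "N = norm (\<theta>' - \<theta>)"
    have N0: "0 \<le> N" by (simp add: N_def)
    have mn: "\<kappa> * \<Delta> \<le> min N k"
    proof (cases "N \<le> k / 2")
      case True
      have "\<kappa> * \<Delta> \<le> k / 4 * \<Delta>" using \<kappa>4 h by (intro mult_right_mono) auto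
      also have "\<dots> \<le> k / 4 * (4 / k * N)"
        using mv_lipschitz[OF q[OF h(2)] k, of \<theta>'] True h(6) k by (intro mult_left_mono) (auto simp: N_def)
      also have "\<dots> = N" using k by simp
      finally show ?thesis using True k by simp
    next
      case False
      have "\<kappa> * \<Delta> \<le> \<kappa> * D" using \<kappa> h by (intro mult_left_mono) auto
      then show ?thesis using \<kappa>D False k by simp
    qed
    have nat: "\<theta>' \<in> natdom" using h(3) Theta_natdom by auto
    have "k * (\<kappa> * \<Delta>) * N \<le> k * min N k * N"
      using mn k N0 by (intro mult_right_mono mult_left_mono) auto
    also have "\<dots> \<le> breg \<theta> \<theta>'" unfolding N_def by (rule breg_lower[OF q[OF h(2)] k nat])
    finally have b: "k * (\<kappa> * \<Delta>) * N \<le> breg \<theta> \<theta>'" .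
    have b0: "0 \<le> k * (\<kappa> * \<Delta>) * N" using k \<kappa> h N0 by auto
    have jb: "n / 8 * (k * (\<kappa> * \<Delta>) * N) \<le> j * breg \<theta> \<theta>'"
      using h b b0 by (intro mult_mono) auto
    have "(\<theta>' - \<theta>) \<bullet> v \<le> N * norm v" unfolding N_def by (rule norm_cauchy_schwarz)
    also have "\<dots> \<le> N * (2 * s * n * \<Delta>)" using h N0 by (intro mult_left_mono)
    also have "\<dots> = s * (2 * (N * n * \<Delta>))" by simp
    also have "\<dots> \<le> s0 * (2 * (N * n * \<Delta>))" using h N0 by (intro mult_right_mono) auto
    also have "\<dots> = n / 16 * (k * (\<kappa> * \<Delta>) * N)" by (simp add: s0_def)
    finally have "(\<theta>' - \<theta>) \<bullet> v - j * breg \<theta> \<theta>' \<le> - (n / 16 * (k * (\<kappa> * \<Delta>) * N))" using jb by simp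
    also have "\<dots> \<le> - (n / 16 * (k * (\<kappa> * \<Delta>) * (\<kappa> * \<Delta>)))"
      using mn k \<kappa> h by (simp add: mult_left_mono)
    also have "\<dots> = - c * (n * \<Delta>\<^sup>2)" by (simp add: c_def power2_eq_square)
    finally show ?thesis .
  qed
  then show ?thesis using that pos by blast
qed

text \<open>Laplace's method. Within parameter distance \<open>k / 2\<close> the exponent is bounded
  by a Gaussian exponent in the mean, up to \<open>e\<close>, and the prior is bounded; the Gaussian
  integral gives the power of n. Farther out the integrand is at most the prior times
  \<open>exp (- \<beta> * n)\<close>, which is smaller than any power of n. The bound is stated in n
  and not in j, so that it can be compared with \<open>marginal_lower\<close> at n.\<close>

lemma marginal_upper:
  fixes \<omega> :: "'v \<Rightarrow> real"
  assumes T: "compact T" "T \<subseteq> \<Theta>" and D: "0 \<le> D"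
    and \<omega>: "continuous_on (mv ` \<Theta>) \<omega>" "\<And>\<mu>. \<mu> \<in> mv ` \<Theta> \<Longrightarrow> 0 < \<omega> \<mu>"
      "(\<integral>\<^sup>+\<mu>\<in>mv ` \<Theta>. ennreal (\<omega> \<mu>) \<partial>lborel) = 1"
  obtains C s0 where "0 < C" "0 < s0"
    "\<And>s \<theta> \<Delta> n j v. 0 < s \<Longrightarrow> s \<le> s0 \<Longrightarrow> \<theta> \<in> T \<Longrightarrow> 0 \<le> \<Delta> \<Longrightarrow> \<Delta> \<le> D \<Longrightarrow> 1 \<le> n \<Longrightarrow> n / 8 \<le> j \<Longrightarrow>
       norm v \<le> s * n * \<Delta> \<Longrightarrow>
       (\<integral>\<^sup>+\<mu>\<in>mv ` \<Theta>. ennreal (\<omega> \<mu> * exp ((th \<mu> - \<theta>) \<bullet> v - j * breg \<theta> (th \<mu>))) \<partial>lborel)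
         \<le> ennreal (C * (1 / sqrt n) ^ DIM('v) * exp (C * (s * n * \<Delta>\<^sup>2)))"
proof -
  let ?M = "mv ` \<Theta>" and ?m = "DIM('v)"
  obtain k where k: "0 < k" and q: "\<And>\<theta>. \<theta> \<in> T \<Longrightarrow> quad k \<theta>" using uniform_quad[OF T] by blast
  \<comment> \<open>The closed \<open>k / 2\<close>-neighbourhood of T is compact as a sum of
    compact sets, which bounds the prior density on the near region.\<close>
  define T' where "T' = {x + y | x y. x \<in> T \<and> y \<in> cball 0 (k / 2)}"
  have T': "compact T'" unfolding T'_def by (rule compact_sums[OF T(1)]) auto
  have T's: "T' \<subseteq> \<Theta>"
  proof
    fix z assume "z \<in> T'"
    then obtain x y where xy: "z = x + y" "x \<in> T" "norm y \<le> k / 2" by (auto simp: T'_def)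
    then have "z \<in> cball x k" using k by (auto simp: dist_norm)
    then show "z \<in> \<Theta>" using quadD(2)[OF q[OF xy(2)] k] by blast
  qed
  have "continuous_on T' (\<lambda>\<theta>. \<omega> (mv \<theta>))"
    using T's by (intro continuous_on_compose2[OF \<omega>(1)] continuous_on_subset[OF continuous_mv]) auto
  then have "bounded ((\<lambda>\<theta>. \<omega> (mv \<theta>)) ` T')" using T' by (intro compact_imp_bounded compact_continuous_image)
  then obtain W0 where W0: "\<And>\<theta>. \<theta> \<in> T' \<Longrightarrow> \<bar>\<omega> (mv \<theta>)\<bar> \<le> W0" by (auto simp: bounded_iff)
  define W where "W = max W0 0"
  have W: "0 \<le> W" "\<And>\<theta>. \<theta> \<in> T' \<Longrightarrow> \<omega> (mv \<theta>) \<le> W" using W0 by (force simp: W_def)+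
  \<comment> \<open>\<open>\<alpha>\<close> is half of the quadratic drift \<open>k / 8\<close>,
    translated from parameters to means by the Lipschitz constant \<open>4 / k\<close>.
    \<open>\<beta>\<close> is half of the linear drift at the distance \<open>k / 2\<close>.\<close>
  define \<alpha> where "\<alpha> = k ^ 3 / 256"
  define \<beta> where "\<beta> = k ^ 3 / 64"
  have ab: "0 < \<alpha>" "0 < \<beta>" using k by (auto simp: \<alpha>_def \<beta>_def)
  define G where "G = enn2real (\<integral>\<^sup>+(x::'v). ennreal (exp (- \<alpha> * (norm x)\<^sup>2)) \<partial>lborel)"
  have G: "(\<integral>\<^sup>+(x::'v). ennreal (exp (- \<alpha> * (norm x)\<^sup>2)) \<partial>lborel) = ennreal G" "0 \<le> G"
    unfolding G_def using gaussian_nn_integral_finite[OF ab(1), where 'a='v] by auto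
  define C2 where "C2 = (real ?m / \<beta>) ^ ?m"
  have C20: "0 \<le> C2" using ab by (simp add: C2_def)
  define C where "C = W * G + C2 + 4 / k"
  have C: "0 < C" using W(1) G(2) C20 k by (auto simp: C_def intro!: add_nonneg_pos)
  \<comment> \<open>The 1 gives \<open>s\<^sup>2 \<le> s\<close>; the second entry makes the noise
    at most half of the drift in the far region.\<close>
  define s0 where "s0 = min 1 (k\<^sup>2 / (32 * (D + 1)))"
  have s0: "0 < s0" "s0 \<le> 1" using k D by (auto simp: s0_def)
  have s0D: "s0 * D \<le> k\<^sup>2 / 32"
  proof -
    have "s0 * D \<le> k\<^sup>2 / (32 * (D + 1)) * (D + 1)" using k D s0 by (intro mult_mono) (auto simp: s0_def)
    also have "\<dots> = k\<^sup>2 / 32" using D by (simp add: field_simps)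
    finally show ?thesis .
  qed
  have expC2: "exp (- \<beta> * n) \<le> C2 * (1 / sqrt n) ^ ?m" if n: "1 \<le> n" for n :: real
  proof -
    have "sqrt n ^ ?m \<le> n ^ ?m"
    proof (rule power_mono)
      have "n * 1 \<le> n\<^sup>2" unfolding power2_eq_square using n by (intro mult_left_mono) auto
      then show "sqrt n \<le> n" using n by (intro real_le_lsqrt) auto
    qed (use n in auto)
    also have "\<dots> \<le> C2 * exp (\<beta> * n)" unfolding C2_def using n by (intro power_le_exp ab) auto
    finally have "sqrt n ^ ?m * exp (- \<beta> * n) \<le> C2 * exp (\<beta> * n) * exp (- \<beta> * n)" by (intro mult_right_mono) auto
    also have "\<dots> = C2" by (simp add: mult.assoc exp_add[symmetric])
    finally have "exp (- \<beta> * n) \<le> C2 / sqrt n ^ ?m" using n by (simp add: pos_le_divide_eq mult.commute)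
    then show ?thesis by (simp add: power_divide)
  qed
  have "(\<integral>\<^sup>+\<mu>\<in>?M. ennreal (\<omega> \<mu> * exp ((th \<mu> - \<theta>) \<bullet> v - j * breg \<theta> (th \<mu>))) \<partial>lborel)
         \<le> ennreal (C * (1 / sqrt n) ^ ?m * exp (C * (s * n * \<Delta>\<^sup>2)))"
    if h: "0 < s" "s \<le> s0" "\<theta> \<in> T" "0 \<le> \<Delta>" "\<Delta> \<le> D" "1 \<le> n" "n / 8 \<le> j" "norm v \<le> s * n * \<Delta>"
    for s \<theta> \<Delta> n j v
  proof -
    define e where "e = 4 / k * (s * n * \<Delta>\<^sup>2)"
    have e0: "0 \<le> e" using k h by (auto simp: e_def)
    have pt: "\<omega> \<mu> * exp ((th \<mu> - \<theta>) \<bullet> v - j * breg \<theta> (th \<mu>)) \<le>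
       W * exp e * exp (- \<alpha> * n * (norm (\<mu> - mv \<theta>))\<^sup>2) + C2 * (1 / sqrt n) ^ ?m * \<omega> \<mu>" if \<mu>: "\<mu> \<in> ?M" for \<mu>
    proof -
      define N where "N = norm (th \<mu> - \<theta>)"
      have N0: "0 \<le> N" by (simp add: N_def)
      have thM: "th \<mu> \<in> \<Theta>" "mv (th \<mu>) = \<mu>" using th_in mv_th \<mu> by auto
      have nat: "th \<mu> \<in> natdom" using thM(1) Theta_natdom by auto
      have bn: "0 \<le> breg \<theta> (th \<mu>)" using h(3) T(2) nat by (intro breg_nonneg) auto
      have iv: "(th \<mu> - \<theta>) \<bullet> v \<le> N * (s * n * \<Delta>)"
        unfolding N_def by (rule order_trans[OF norm_cauchy_schwarz]) (use h in \<open>auto intro: mult_left_mono\<close>)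
      have t1: "0 \<le> W * exp e * exp (- \<alpha> * n * (norm (\<mu> - mv \<theta>))\<^sup>2)" using W(1) by simp
      have t2: "0 \<le> C2 * (1 / sqrt n) ^ ?m * \<omega> \<mu>" using C20 \<omega>(2)[OF \<mu>] h by auto
      show ?thesis
      proof (cases "N \<le> k / 2")
        case True
        have "k * N\<^sup>2 \<le> breg \<theta> (th \<mu>)"
          unfolding N_def using True k by (intro quadD(3)[OF q[OF h(3)] k]) (auto simp: N_def)
        then have jb: "n / 8 * (k * N\<^sup>2) \<le> j * breg \<theta> (th \<mu>)" using h k by (intro mult_mono) auto
        \<comment> \<open>Completing the square: half of the quadratic drift absorbs the noise up to
          a multiple of \<open>s\<^sup>2 * n * \<Delta>\<^sup>2\<close>, and the other half supplies
          the Gaussian.\<close>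
        have "0 \<le> n * k / 16 * (N - 8 / k * (s * \<Delta>))\<^sup>2" using h k by auto
        also have "\<dots> = n / 16 * (k * N\<^sup>2) - N * (s * n * \<Delta>) + 4 / k * (s\<^sup>2 * n * \<Delta>\<^sup>2)"
          using k by (simp add: power2_eq_square field_simps)
        finally have amgm: "N * (s * n * \<Delta>) \<le> n / 16 * (k * N\<^sup>2) + 4 / k * (s\<^sup>2 * n * \<Delta>\<^sup>2)" by simp
        have "s\<^sup>2 \<le> s" using h s0 by (simp add: power2_eq_square mult_left_le)
        then have "4 / k * (s\<^sup>2 * n * \<Delta>\<^sup>2) \<le> e"
          unfolding e_def using k h by (intro mult_left_mono mult_right_mono) auto
        moreover have "\<alpha> * n * (norm (\<mu> - mv \<theta>))\<^sup>2 \<le> n / 16 * (k * N\<^sup>2)"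
        proof -
          have "norm (\<mu> - mv \<theta>) \<le> 4 / k * N"
            using mv_lipschitz[OF q[OF h(3)] k, of "th \<mu>"] True thM by (simp add: N_def)
          then have "(norm (\<mu> - mv \<theta>))\<^sup>2 \<le> (4 / k * N)\<^sup>2" by (intro power_mono) auto
          then have "\<alpha> * n * (norm (\<mu> - mv \<theta>))\<^sup>2 \<le> \<alpha> * n * (4 / k * N)\<^sup>2" using ab h by (intro mult_left_mono) auto
          also have "\<dots> = n / 16 * (k * N\<^sup>2)" using k by (simp add: \<alpha>_def power2_eq_square power3_eq_cube)
          finally show ?thesis .
        qed
        ultimately have ex: "(th \<mu> - \<theta>) \<bullet> v - j * breg \<theta> (th \<mu>) \<le> e - \<alpha> * n * (norm (\<mu> - mv \<theta>))\<^sup>2"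
          using iv jb amgm by linarith
        have "th \<mu> \<in> T'"
        proof -
          have "th \<mu> = \<theta> + (th \<mu> - \<theta>)" "th \<mu> - \<theta> \<in> cball 0 (k / 2)" using True by (auto simp: N_def)
          then show ?thesis unfolding T'_def using h(3) by blast
        qed
        then have "\<omega> \<mu> \<le> W" using W(2)[of "th \<mu>"] thM by simp
        then have "\<omega> \<mu> * exp ((th \<mu> - \<theta>) \<bullet> v - j * breg \<theta> (th \<mu>)) \<le> W * exp (e - \<alpha> * n * (norm (\<mu> - mv \<theta>))\<^sup>2)"
          using ex W(1) by (intro mult_mono) auto
        also have "\<dots> = W * exp e * exp (- \<alpha> * n * (norm (\<mu> - mv \<theta>))\<^sup>2)"
          by (simp add: exp_diff exp_minus divide_inverse)
        finally show ?thesis using t2 by linarith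
      next
        case False
        have "k * (k / 2) * N \<le> k * min N k * N" using False k N0 by (intro mult_right_mono mult_left_mono) auto
        also have "\<dots> \<le> breg \<theta> (th \<mu>)" unfolding N_def by (rule breg_lower[OF q[OF h(3)] k nat])
        finally have jb: "n / 8 * (k * (k / 2) * N) \<le> j * breg \<theta> (th \<mu>)" using h k N0 by (intro mult_mono) auto
        have "s * \<Delta> \<le> s0 * D" using h s0 by (intro mult_mono) auto
        then have "N * n * (s * \<Delta>) \<le> N * n * (k\<^sup>2 / 32)" using s0D h N0 by (intro mult_left_mono) auto
        then have "(th \<mu> - \<theta>) \<bullet> v - j * breg \<theta> (th \<mu>) \<le> N * n * (k\<^sup>2 / 32) - n / 8 * (k * (k / 2) * N)"
          using iv jb by (simp add: mult_ac)
        also have "\<dots> = - (N * (n * k\<^sup>2 / 32))" by (simp add: power2_eq_square)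
        also have "\<dots> \<le> - (k / 2 * (n * k\<^sup>2 / 32))"
          using False h k by (intro le_imp_neg_le mult_right_mono) auto
        also have "\<dots> = - \<beta> * n" by (simp add: \<beta>_def power2_eq_square power3_eq_cube)
        finally have "exp ((th \<mu> - \<theta>) \<bullet> v - j * breg \<theta> (th \<mu>)) \<le> exp (- \<beta> * n)" by simp
        also have "\<dots> \<le> C2 * (1 / sqrt n) ^ ?m" by (rule expC2[OF h(6)])
        finally have "\<omega> \<mu> * exp ((th \<mu> - \<theta>) \<bullet> v - j * breg \<theta> (th \<mu>)) \<le> \<omega> \<mu> * (C2 * (1 / sqrt n) ^ ?m)"
          using \<omega>(2)[OF \<mu>] by (intro mult_left_mono) auto
        then show ?thesis using t1 by (simp add: mult_ac)
      qed
    qed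
    have M[measurable]: "?M \<in> sets borel" using open_mv by simp
    have "(\<lambda>\<mu>. indicator ?M \<mu> *\<^sub>R \<omega> \<mu>) \<in> borel_measurable borel"
      by (rule borel_measurable_continuous_on_indicator[OF M \<omega>(1)])
    then have "(\<lambda>\<mu>. ennreal (indicator ?M \<mu> *\<^sub>R \<omega> \<mu>)) \<in> borel_measurable borel" by measurable
    also have "(\<lambda>\<mu>. ennreal (indicator ?M \<mu> *\<^sub>R \<omega> \<mu>)) = (\<lambda>\<mu>. ennreal (\<omega> \<mu>) * indicator ?M \<mu>)"
      by (auto simp: indicator_def)
    finally have m\<omega>[measurable]: "(\<lambda>\<mu>. ennreal (\<omega> \<mu>) * indicator ?M \<mu>) \<in> borel_measurable borel" .
    let ?r = "(1 / sqrt n) ^ ?m"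
    have r0: "0 \<le> ?r" using h by simp
    have "(\<integral>\<^sup>+\<mu>\<in>?M. ennreal (\<omega> \<mu> * exp ((th \<mu> - \<theta>) \<bullet> v - j * breg \<theta> (th \<mu>))) \<partial>lborel) \<le>
      (\<integral>\<^sup>+\<mu>. ennreal (W * exp e) * ennreal (exp (- \<alpha> * n * (norm (\<mu> - mv \<theta>))\<^sup>2)) +
             ennreal (C2 * ?r) * (ennreal (\<omega> \<mu>) * indicator ?M \<mu>) \<partial>lborel)"
    proof (rule nn_integral_mono)
      fix \<mu>
      show "ennreal (\<omega> \<mu> * exp ((th \<mu> - \<theta>) \<bullet> v - j * breg \<theta> (th \<mu>))) * indicator ?M \<mu> \<le>
        ennreal (W * exp e) * ennreal (exp (- \<alpha> * n * (norm (\<mu> - mv \<theta>))\<^sup>2)) +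
             ennreal (C2 * ?r) * (ennreal (\<omega> \<mu>) * indicator ?M \<mu>)"
      proof (cases "\<mu> \<in> ?M")
        case True
        have "ennreal (\<omega> \<mu> * exp ((th \<mu> - \<theta>) \<bullet> v - j * breg \<theta> (th \<mu>))) \<le>
           ennreal (W * exp e * exp (- \<alpha> * n * (norm (\<mu> - mv \<theta>))\<^sup>2) + C2 * ?r * \<omega> \<mu>)"
          by (rule ennreal_leI[OF pt[OF True]])
        then show ?thesis using True W(1) C20 r0 \<omega>(2)[OF True]
          by (simp add: ennreal_plus ennreal_mult less_imp_le)
      qed simp
    qed
    also have "\<dots> = ennreal (W * exp e) * (\<integral>\<^sup>+\<mu>. ennreal (exp (- \<alpha> * n * (norm (\<mu> - mv \<theta>))\<^sup>2)) \<partial>lborel) +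
        ennreal (C2 * ?r) * (\<integral>\<^sup>+\<mu>. ennreal (\<omega> \<mu>) * indicator ?M \<mu> \<partial>lborel)"
      by (subst nn_integral_add) (auto simp: nn_integral_cmult)
    also have "\<dots> = ennreal (W * exp e) * (ennreal ?r * ennreal G) + ennreal (C2 * ?r)"
      unfolding \<omega>(3) using gaussian_nn_integral_scaled[OF ab(1), of n "mv \<theta>"] h G(1) by simp
    also have "\<dots> = ennreal (W * exp e * (?r * G) + C2 * ?r)"
      using W(1) G(2) C20 r0 by (simp add: ennreal_mult ennreal_plus)
    also have "\<dots> \<le> ennreal (C * ?r * exp (C * (s * n * \<Delta>\<^sup>2)))"
    proof (rule ennreal_leI)
      have "C2 * ?r * 1 \<le> C2 * ?r * exp e" using e0 C20 r0 by (intro mult_left_mono) auto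
      then have "W * exp e * (?r * G) + C2 * ?r \<le> (W * G + C2) * ?r * exp e" by (simp add: algebra_simps)
      also have "\<dots> \<le> C * ?r * exp (C * (s * n * \<Delta>\<^sup>2))"
      proof (intro mult_mono)
        show "W * G + C2 \<le> C" using k by (simp add: C_def)
        have "e \<le> C * (s * n * \<Delta>\<^sup>2)" unfolding e_def
          using W(1) G(2) C20 h by (intro mult_right_mono) (auto simp: C_def)
        then show "exp e \<le> exp (C * (s * n * \<Delta>\<^sup>2))" by simp
      qed (use C r0 in auto)
      finally show "W * exp e * (?r * G) + C2 * ?r \<le> C * ?r * exp (C * (s * n * \<Delta>\<^sup>2))" .
    qed
    finally show ?thesis .
  qed
  then show ?thesis using that C s0(1) by blast
qed

text \<open>Restrict the integral to the ball of radius \<open>\<rho> / sqrt n\<close> around the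
  mean of \<theta>, whose volume is the power of n. There \<open>n * breg\<close> stays bounded,
  while the noise is at most a multiple of \<open>s * sqrt n * \<Delta>\<close>; this is at most
  \<open>s * n * \<Delta>\<^sup>2\<close> because
  \<open>n * \<Delta>\<^sup>2 \<ge> 1\<close>.\<close>

lemma marginal_lower:
  fixes \<omega> :: "'v \<Rightarrow> real"
  assumes T: "compact T" "T \<subseteq> \<Theta>"
    and \<omega>: "continuous_on (mv ` \<Theta>) \<omega>" "\<And>\<mu>. \<mu> \<in> mv ` \<Theta> \<Longrightarrow> 0 < \<omega> \<mu>"
  obtains c C where "0 < c" "0 < C"
    "\<And>s \<theta> \<Delta> n v. 0 < s \<Longrightarrow> \<theta> \<in> T \<Longrightarrow> 0 \<le> \<Delta> \<Longrightarrow> 1 \<le> n \<Longrightarrow> 1 \<le> n * \<Delta>\<^sup>2 \<Longrightarrow>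
       norm v \<le> s * n * \<Delta> \<Longrightarrow>
       ennreal (c * (1 / sqrt n) ^ DIM('v) * exp (- C * (s * n * \<Delta>\<^sup>2))) \<le>
       (\<integral>\<^sup>+\<mu>\<in>mv ` \<Theta>. ennreal (\<omega> \<mu> * exp ((th \<mu> - \<theta>) \<bullet> v - n * breg \<theta> (th \<mu>))) \<partial>lborel)"
proof (cases "T = {}")
  case True
  then show ?thesis using that[of 1 1] by simp
next
  case False
  let ?M = "mv ` \<Theta>" and ?m = "DIM('v)"
  have cT: "compact (mv ` T)" using T continuous_mv by (meson compact_continuous_image continuous_on_subset)
  obtain \<rho> where \<rho>: "0 < \<rho>" "(\<Union>x\<in>mv ` T. cball x \<rho>) \<subseteq> ?M"
    using compact_subset_open_imp_cball_epsilon_subset[OF cT open_mv] T(2) by blast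
  define S where "S = {x + y | x y. x \<in> mv ` T \<and> y \<in> cball 0 \<rho>}"
  have S: "compact S" unfolding S_def by (rule compact_sums[OF cT]) auto
  have inS: "\<mu> \<in> S" if "\<theta> \<in> T" "norm (\<mu> - mv \<theta>) \<le> \<rho>" for \<mu> \<theta>
  proof -
    have "\<mu> = mv \<theta> + (\<mu> - mv \<theta>)" "mv \<theta> \<in> mv ` T" "\<mu> - mv \<theta> \<in> cball 0 \<rho>" using that by auto
    then show ?thesis unfolding S_def by blast
  qed
  have SM: "S \<subseteq> ?M"
  proof
    fix z assume "z \<in> S"
    then obtain x y where xy: "z = x + y" "x \<in> mv ` T" "norm y \<le> \<rho>" by (auto simp: S_def)
    then have "z \<in> cball x \<rho>" by (auto simp: dist_norm)
    then show "z \<in> ?M" using \<rho>(2) xy(2) by blast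
  qed
  obtain t where t: "t \<in> T" using False by blast
  have Sne: "S \<noteq> {}" using inS[OF t, of "mv t"] \<rho>(1) by auto
  obtain z where z: "z \<in> S" "\<And>\<mu>. \<mu> \<in> S \<Longrightarrow> \<omega> z \<le> \<omega> \<mu>"
    using continuous_attains_inf[OF S Sne continuous_on_subset[OF \<omega>(1) SM]] by blast
  have \<omega>0: "0 < \<omega> z" using \<omega>(2) z(1) SM by blast
  have cS: "compact (th ` S)" "th ` S \<subseteq> \<Theta>"
    using S SM th_in by (auto intro!: compact_continuous_image continuous_on_subset[OF continuous_th])
  obtain A where A: "0 < A"
    "\<And>\<theta> \<theta>'. \<theta> \<in> th ` S \<Longrightarrow> \<theta>' \<in> th ` S \<Longrightarrow> norm (\<theta>' - \<theta>) \<le> A * norm (mv \<theta>' - mv \<theta>)"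
    "\<And>\<theta> \<theta>'. \<theta> \<in> th ` S \<Longrightarrow> \<theta>' \<in> th ` S \<Longrightarrow> breg \<theta> \<theta>' \<le> A * (norm (mv \<theta>' - mv \<theta>))\<^sup>2"
    by (rule compact_constants[OF cS]) blast
  define V where "V = measure lborel (ball (0::'v) 1)"
  have V: "0 < V" unfolding V_def by (rule content_ball_pos) simp
  define c where "c = \<omega> z * exp (- (A * \<rho>\<^sup>2)) * \<rho> ^ ?m * V"
  define C where "C = A * \<rho>"
  have cC: "0 < c" "0 < C" using \<omega>0 \<rho>(1) V A(1) by (auto simp: c_def C_def)
  have "ennreal (c * (1 / sqrt n) ^ ?m * exp (- C * (s * n * \<Delta>\<^sup>2))) \<le>
       (\<integral>\<^sup>+\<mu>\<in>?M. ennreal (\<omega> \<mu> * exp ((th \<mu> - \<theta>) \<bullet> v - n * breg \<theta> (th \<mu>))) \<partial>lborel)"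
    if h: "0 < s" "\<theta> \<in> T" "0 \<le> \<Delta>" "1 \<le> n" "1 \<le> n * \<Delta>\<^sup>2" "norm v \<le> s * n * \<Delta>" for s \<theta> \<Delta> n v
  proof -
    define B where "B = ball (mv \<theta>) (\<rho> / sqrt n)"
    have sq: "1 \<le> sqrt n" using h by simp
    have rn: "0 \<le> \<rho> / sqrt n" "\<rho> / sqrt n \<le> \<rho>" using \<rho>(1) sq by (auto simp: divide_le_eq)
    let ?K = "\<omega> z * (exp (- (A * \<rho>\<^sup>2)) * exp (- C * (s * n * \<Delta>\<^sup>2)))"
    have K0: "0 \<le> ?K" using \<omega>0 by simp
    have pt: "?K \<le> \<omega> \<mu> * exp ((th \<mu> - \<theta>) \<bullet> v - n * breg \<theta> (th \<mu>))" and BM: "\<mu> \<in> ?M" if \<mu>: "\<mu> \<in> B" for \<mu>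
    proof -
      have d: "norm (\<mu> - mv \<theta>) \<le> \<rho> / sqrt n" using \<mu> by (simp add: B_def dist_norm norm_minus_commute)
      have \<mu>S: "\<mu> \<in> S" "mv \<theta> \<in> S" using inS[OF h(2)] d rn \<rho>(1) by auto
      have "th (mv \<theta>) \<in> th ` S" "th (mv \<theta>) = \<theta>" using \<mu>S(2) h(2) T(2) th_mv[of \<theta>] by auto
      then have thS: "th \<mu> \<in> th ` S" "\<theta> \<in> th ` S" using \<mu>S(1) by auto
      show "\<mu> \<in> ?M" using \<mu>S SM by blast
      then have m: "mv (th \<mu>) = \<mu>" by (rule mv_th)
      have "norm (th \<mu> - \<theta>) \<le> A * (\<rho> / sqrt n)"
        using A(2)[OF thS(2,1)] mult_left_mono[OF d less_imp_le[OF A(1)]] m by simp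
      then have "norm (th \<mu> - \<theta>) * norm v \<le> A * (\<rho> / sqrt n) * (s * n * \<Delta>)"
        using h(6) mult_nonneg_nonneg[OF less_imp_le[OF A(1)] rn(1)] by (intro mult_mono) auto
      also have "\<dots> = C * (s * (sqrt n * \<Delta>))"
      proof -
        have "A * (\<rho> / sqrt n) * (s * n * \<Delta>) = C * (s * (n / sqrt n * \<Delta>))" by (simp add: C_def)
        also have "n / sqrt n = sqrt n" using h by (simp add: real_div_sqrt)
        finally show ?thesis .
      qed
      also have "\<dots> \<le> C * (s * (n * \<Delta>\<^sup>2))"
      proof -
        have e: "(sqrt n * \<Delta>)\<^sup>2 = n * \<Delta>\<^sup>2" using h(4) by (simp add: power_mult_distrib)
        have p: "0 \<le> sqrt n * \<Delta>" using h(3,4) by simp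
        have "1 \<le> sqrt n * \<Delta>"
        proof (rule power2_le_imp_le[OF _ p])
          show "1\<^sup>2 \<le> (sqrt n * \<Delta>)\<^sup>2" unfolding e using h(5) by simp
        qed
        then have "sqrt n * \<Delta> * 1 \<le> sqrt n * \<Delta> * (sqrt n * \<Delta>)" using p by (rule mult_left_mono)
        also have "\<dots> = n * \<Delta>\<^sup>2" unfolding e[symmetric] by (simp add: power2_eq_square)
        finally show ?thesis using cC(2) h(1) by (intro mult_left_mono) auto
      qed
      finally have iv: "- (C * (s * n * \<Delta>\<^sup>2)) \<le> (th \<mu> - \<theta>) \<bullet> v"
        using Cauchy_Schwarz_ineq2[of "th \<mu> - \<theta>" v] by (simp add: mult.assoc)
      have "breg \<theta> (th \<mu>) \<le> A * (norm (\<mu> - mv \<theta>))\<^sup>2" using A(3)[OF thS(2,1)] m by simp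
      also have "\<dots> \<le> A * (\<rho> / sqrt n)\<^sup>2" using d A(1) by (intro mult_left_mono power_mono) auto
      also have "\<dots> = A * \<rho>\<^sup>2 / n" using h by (simp add: power_divide)
      finally have "n * breg \<theta> (th \<mu>) \<le> A * \<rho>\<^sup>2" using h by (simp add: field_simps)
      then have "exp (- (A * \<rho>\<^sup>2)) * exp (- C * (s * n * \<Delta>\<^sup>2)) \<le> exp ((th \<mu> - \<theta>) \<bullet> v - n * breg \<theta> (th \<mu>))"
        using iv by (simp add: exp_add[symmetric])
      then show "?K \<le> \<omega> \<mu> * exp ((th \<mu> - \<theta>) \<bullet> v - n * breg \<theta> (th \<mu>))"
        using z(2)[OF \<mu>S(1)] \<omega>0 by (intro mult_mono) auto
    qed
    have "c * (1 / sqrt n) ^ ?m * exp (- C * (s * n * \<Delta>\<^sup>2)) = ?K * measure lborel B"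
      unfolding B_def using content_ball_conv_unit_ball[OF rn(1), of "mv \<theta>"]
      by (simp add: c_def V_def power_divide)
    then have "ennreal (c * (1 / sqrt n) ^ ?m * exp (- C * (s * n * \<Delta>\<^sup>2))) = ennreal ?K * ennreal (measure lborel B)"
      by (simp only: ennreal_mult[OF K0 measure_nonneg])
    also have "ennreal (measure lborel B) = emeasure lborel B"
      using emeasure_bounded_finite[of B] by (simp add: B_def emeasure_eq_ennreal_measure)
    also have "ennreal ?K * emeasure lborel B = (\<integral>\<^sup>+\<mu>. ennreal ?K * indicator B \<mu> \<partial>lborel)" by (simp add: nn_integral_cmult_indicator B_def)
    also have "\<dots> \<le> (\<integral>\<^sup>+\<mu>\<in>?M. ennreal (\<omega> \<mu> * exp ((th \<mu> - \<theta>) \<bullet> v - n * breg \<theta> (th \<mu>))) \<partial>lborel)"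
    proof (rule nn_integral_mono)
      fix \<mu>
      show "ennreal ?K * indicator B \<mu> \<le> ennreal (\<omega> \<mu> * exp ((th \<mu> - \<theta>) \<bullet> v - n * breg \<theta> (th \<mu>))) * indicator ?M \<mu>"
        using pt[of \<mu>] BM[of \<mu>] by (cases "\<mu> \<in> B") (auto intro!: ennreal_leI)
    qed
    finally show ?thesis .
  qed
  then show ?thesis using that cC by blast
qed

end

section \<open>Mean-value densities and losses\<close>

locale density_family =
  fixes \<Lambda> :: "'x measure" and \<phi> :: "'x \<Rightarrow> real ^ 'm::finite" and r :: "'x \<Rightarrow> real" and \<Theta> :: "(real ^ 'm) set"
  assumes family: "exponential_family UNIV \<Lambda> \<phi> r \<Theta>"
begin

abbreviation R :: "'x measure" where "R \<equiv> density \<Lambda> (\<lambda>x. ennreal (r x))"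

section \<open>From densities to weights over the base measure\<close>

lemma r_measurable [measurable]: "r \<in> borel_measurable \<Lambda>"
  and phi_measurable_base [measurable]: "\<phi> \<in> borel_measurable \<Lambda>"
  and r_nonneg: "x \<in> space \<Lambda> \<Longrightarrow> 0 \<le> r x"
  using family by (auto simp: exponential_family_def)

lemma AE_r_nonneg: "AE x in \<Lambda>. 0 \<le> r x"
  using r_nonneg by (intro AE_I2)

lemma integral_R:
  fixes f :: "'x \<Rightarrow> 'b::{banach, second_countable_topology}"
  shows "f \<in> borel_measurable \<Lambda> \<Longrightarrow> (\<integral>x. f x \<partial>R) = (\<integral>x. r x *\<^sub>R f x \<partial>\<Lambda>)"
  and integrable_R: "f \<in> borel_measurable \<Lambda> \<Longrightarrow> integrable R f \<longleftrightarrow> integrable \<Lambda> (\<lambda>x. r x *\<^sub>R f x)"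
  using AE_r_nonneg by (simp_all add: integral_density integrable_density)

sublocale exp_family R \<phi> \<Theta>
proof
  show "\<phi> \<in> borel_measurable R" by simp
  show "open \<Theta>" using family by (simp add: exponential_family_def coord_space_def)
  show "\<Theta> \<noteq> {}" using family by (simp add: exponential_family_def)
  show "integrable R (\<lambda>x. exp (\<theta> \<bullet> \<phi> x))" if "\<theta> \<in> \<Theta>" for \<theta>
    using family that by (auto simp: integrable_R exponential_family_def mult.commute)
  show "0 < (\<integral>x. exp (\<theta> \<bullet> \<phi> x) \<partial>R)" if "\<theta> \<in> \<Theta>" for \<theta>
    using family that by (auto simp: integral_R exponential_family_def mult.commute)
  show "a = 0" if "AE x in R. a \<bullet> \<phi> x = c" for a c
    using family that unfolding exponential_family_def coord_space_def by blast
qed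

abbreviation M :: "(real ^ 'm) set" where "M \<equiv> mv ` \<Theta>"
abbreviation p :: "real ^ 'm \<Rightarrow> 'x \<Rightarrow> real" where "p \<equiv> mean_density UNIV \<Lambda> \<phi> r \<Theta>"

lemma canonical_density_eq: "canonical_density \<Lambda> \<phi> r \<theta> x = w \<theta> x * r x"
  by (simp add: canonical_density_def w_def log_partition_def psi_def integral_R mult.commute)

lemma mean_value_eq:
  assumes "\<theta> \<in> \<Theta>"
  shows "mean_value UNIV \<Lambda> \<phi> r \<theta> = mv \<theta>"
proof (rule vec_eq_iff[THEN iffD2], rule allI)
  fix i
  have "(\<lambda>x. axis i 1 \<bullet> \<phi> x) \<in> borel_measurable \<Lambda>" by measurable
  then have [measurable]: "(\<lambda>x. \<phi> x $ i) \<in> borel_measurable \<Lambda>" by (simp add: inner_axis')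
  have "mv \<theta> $ i = axis i 1 \<bullet> mv \<theta>" by (simp add: inner_axis')
  also have "\<dots> = (\<integral>x. axis i 1 \<bullet> (w \<theta> x *\<^sub>R \<phi> x) \<partial>R)"
    unfolding mv_def by (rule integral_inner_right[symmetric]) (use integrable_phi[OF assms] in auto)
  also have "\<dots> = (\<integral>x. w \<theta> x * \<phi> x $ i \<partial>R)" by (simp add: inner_axis')
  also have "\<dots> = (\<integral>x. canonical_density \<Lambda> \<phi> r \<theta> x * \<phi> x $ i \<partial>\<Lambda>)"
    by (subst integral_R) (auto simp: canonical_density_eq mult_ac w_def)
  finally show "mean_value UNIV \<Lambda> \<phi> r \<theta> $ i = mv \<theta> $ i" by (simp add: mean_value_def)
qed

text \<open>The inverse of the mean map refers only to its values on \<Theta>, where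
  \<open>mean_value\<close> and \<open>mv\<close> agree.\<close>

lemma p_eq: "p \<mu> x = w (th \<mu>) x * r x"
proof -
  have "the_inv_into \<Theta> (mean_value UNIV \<Lambda> \<phi> r) \<mu> = th \<mu>"
    unfolding th_def the_inv_into_def by (rule arg_cong[where f=The]) (auto simp: mean_value_eq fun_eq_iff)
  then show ?thesis by (simp add: mean_density_def canonical_density_eq)
qed

lemma p_measurable [measurable]: "p \<mu> \<in> borel_measurable \<Lambda>"
  unfolding p_eq[abs_def] w_def by measurable

lemma model_measure_eq: "model_measure \<Lambda> p \<mu> = density R (\<lambda>x. ennreal (w (th \<mu>) x))"
  unfolding model_measure_def p_eq
  by (subst density_density_eq) (auto simp: ennreal_mult'' mult.commute w_def)

lemma sets_model [simp, measurable_cong]: "sets (model_measure \<Lambda> p \<mu>) = sets \<Lambda>"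
  and space_model [simp]: "space (model_measure \<Lambda> p \<mu>) = space \<Lambda>"
  by (simp_all add: model_measure_def)

lemma integral_model:
  fixes f :: "'x \<Rightarrow> 'b::{banach, second_countable_topology}"
  shows "f \<in> borel_measurable \<Lambda> \<Longrightarrow> (\<integral>x. f x \<partial>model_measure \<Lambda> p \<mu>) = (\<integral>x. w (th \<mu>) x *\<^sub>R f x \<partial>R)"
  and integrable_model: "f \<in> borel_measurable \<Lambda> \<Longrightarrow>
    integrable (model_measure \<Lambda> p \<mu>) f \<longleftrightarrow> integrable R (\<lambda>x. w (th \<mu>) x *\<^sub>R f x)"
  unfolding model_measure_eq by (simp_all add: integral_density integrable_density)

lemma prob_space_model:
  assumes "\<mu> \<in> M"
  shows "prob_space (model_measure \<Lambda> p \<mu>)"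
proof (rule prob_spaceI)
  have "emeasure (model_measure \<Lambda> p \<mu>) (space (model_measure \<Lambda> p \<mu>)) = (\<integral>\<^sup>+x. ennreal (w (th \<mu>) x) \<partial>R)"
    unfolding model_measure_eq by (subst emeasure_density) (auto intro!: nn_integral_cong)
  also have "\<dots> = ennreal (\<integral>x. w (th \<mu>) x \<partial>R)"
    using integrable_w_Theta[OF th_in[OF assms]] by (intro nn_integral_eq_integral) auto
  also have "\<dots> = 1" using integral_w_Theta[OF th_in[OF assms]] by simp
  finally show "emeasure (model_measure \<Lambda> p \<mu>) (space (model_measure \<Lambda> p \<mu>)) = 1" .
qed

text \<open>Points with \<open>r x = 0\<close> are null for the base measure, so quotients of
  densities reduce to quotients of weights.\<close>

lemma AE_R_pos: "AE x in R. 0 < r x"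
  by (subst AE_density) auto

lemma AE_model_pos: "AE x in model_measure \<Lambda> p \<mu>. 0 < r x"
  unfolding model_measure_eq using AE_R_pos by (subst AE_density) auto

lemma affinity_eq:
  assumes "\<mu> \<in> M" "\<mu>' \<in> M"
  shows "affinity \<Lambda> p \<mu> \<mu>' = exp (- bgap (th \<mu>) (th \<mu>'))"
proof -
  have "affinity \<Lambda> p \<mu> \<mu>' = (\<integral>x. w (th \<mu>) x *\<^sub>R sqrt (p \<mu>' x / p \<mu> x) \<partial>R)"
    unfolding affinity_def by (rule integral_model) measurable
  also have "\<dots> = (\<integral>x. sqrt (w (th \<mu>) x * w (th \<mu>') x) \<partial>R)"
  proof (rule integral_cong_AE)
    show "AE x in R. w (th \<mu>) x *\<^sub>R sqrt (p \<mu>' x / p \<mu> x) = sqrt (w (th \<mu>) x * w (th \<mu>') x)"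
      using AE_R_pos
    proof eventually_elim
      fix x assume "0 < r x"
      then have "w (th \<mu>) x *\<^sub>R sqrt (p \<mu>' x / p \<mu> x) = (sqrt (w (th \<mu>) x))\<^sup>2 * (sqrt (w (th \<mu>') x) / sqrt (w (th \<mu>) x))"
        by (simp add: p_eq real_sqrt_divide)
      also have "\<dots> = sqrt (w (th \<mu>) x * w (th \<mu>') x)"
      proof -
        have "a\<^sup>2 * (b / a) = a * b" if "0 < a" for a b :: real using that by (simp add: power2_eq_square)
        from this[of "sqrt (w (th \<mu>) x)"] show ?thesis using w_pos[of "th \<mu>" x] by (simp only: real_sqrt_mult real_sqrt_gt_0_iff)
      qed
      finally show "w (th \<mu>) x *\<^sub>R sqrt (p \<mu>' x / p \<mu> x) = sqrt (w (th \<mu>) x * w (th \<mu>') x)" .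
    qed
  qed measurable
  also have "\<dots> = exp (- bgap (th \<mu>) (th \<mu>'))"
    using assms th_in Theta_natdom by (intro affinity_exp) auto
  finally show ?thesis .
qed

lemma kullback_leibler_eq:
  assumes \<mu>: "\<mu> \<in> M" "\<mu>' \<in> M"
  shows "kullback_leibler \<Lambda> p \<mu> \<mu>' = breg (th \<mu>) (th \<mu>')"
proof -
  let ?t = "th \<mu>" and ?t' = "th \<mu>'"
  note T = th_in[OF \<mu>(1)]
  have "kullback_leibler \<Lambda> p \<mu> \<mu>' = (\<integral>x. w ?t x *\<^sub>R ln (p \<mu> x / p \<mu>' x) \<partial>R)"
    unfolding kullback_leibler_def by (rule integral_model) measurable
  also have "\<dots> = (\<integral>x. w ?t x * ((?t - ?t') \<bullet> (\<phi> x - mv ?t)) + breg ?t ?t' * w ?t x \<partial>R)"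
  proof (rule integral_cong_AE)
    show "AE x in R. w ?t x *\<^sub>R ln (p \<mu> x / p \<mu>' x) = w ?t x * ((?t - ?t') \<bullet> (\<phi> x - mv ?t)) + breg ?t ?t' * w ?t x"
      using AE_R_pos
    proof eventually_elim
      fix x assume "0 < r x"
      then have "ln (p \<mu> x / p \<mu>' x) = ln (w ?t x / w ?t' x)" by (simp add: p_eq)
      also have "\<dots> = (?t - ?t') \<bullet> \<phi> x - (psi ?t - psi ?t')"
        by (simp add: w_def exp_diff[symmetric] inner_diff_left)
      also have "\<dots> = (?t - ?t') \<bullet> (\<phi> x - mv ?t) + breg ?t ?t'"
        by (simp add: breg_def algebra_simps)
      finally show "w ?t x *\<^sub>R ln (p \<mu> x / p \<mu>' x) = w ?t x * ((?t - ?t') \<bullet> (\<phi> x - mv ?t)) + breg ?t ?t' * w ?t x"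
        by (simp only: real_scaleR_def distrib_left mult.commute)
    qed
  qed measurable
  also have "\<dots> = breg ?t ?t'"
    using centered[OF T, of "?t - ?t'"] integrable_w_Theta[OF T] integral_w_Theta[OF T] by simp
  finally show ?thesis .
qed

text \<open>By the chain rule the score in direction i is \<open>J (axis i 1)\<close> paired with
  the centred statistic, J being the derivative of \<open>th\<close>. The entries of the Fisher
  matrix are thus covariances of such pairings, and since J inverts \<open>cov\<close> they are the
  entries of J. The loss is then the quadratic form of J, that is, \<open>var\<close> at the image
  under J.\<close>

lemma standardized_squared_error_eq:
  assumes \<mu>: "\<mu> \<in> M"
  obtains J where "\<And>v. cov (th \<mu>) (J v) = v"
    "\<And>\<mu>'. standardized_squared_error \<Lambda> p \<mu> \<mu>' = var (th \<mu>) (J (\<mu>' - \<mu>))"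
proof -
  let ?t = "th \<mu>"
  note T = th_in[OF \<mu>]
  obtain J where J: "linear J" "(th has_derivative J) (at \<mu>)" "\<And>v. cov ?t (J v) = v"
    by (rule th_has_derivative[OF \<mu>]) blast
  have score: "score p \<mu> i x = J (axis i 1) \<bullet> (\<phi> x - mv ?t)" if "0 < r x" for i x
  proof -
    have ln: "ln (p \<mu>' x) = th \<mu>' \<bullet> \<phi> x - psi (th \<mu>') + ln (r x)" for \<mu>'
      using that w_pos[of "th \<mu>'" x] by (simp add: p_eq ln_mult) (simp add: w_def)
    have "((\<lambda>t::real. \<mu> + t *\<^sub>R axis i 1) has_derivative (\<lambda>t. t *\<^sub>R axis i 1)) (at 0)"
      by (auto intro!: derivative_eq_intros)
    moreover have "(th has_derivative J) (at (\<mu> + (0::real) *\<^sub>R axis i 1))" using J(2) by simp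
    ultimately have 1: "((\<lambda>t::real. th (\<mu> + t *\<^sub>R axis i 1)) has_derivative (\<lambda>t. J (t *\<^sub>R axis i 1))) (at 0)"
      by (rule has_derivative_compose)
    have "(psi has_derivative (\<lambda>u. u \<bullet> mv ?t)) (at (th (\<mu> + (0::real) *\<^sub>R axis i 1)))"
      using psi_has_derivative[OF T] by simp
    then have 2: "((\<lambda>t::real. psi (th (\<mu> + t *\<^sub>R axis i 1))) has_derivative (\<lambda>t. J (t *\<^sub>R axis i 1) \<bullet> mv ?t)) (at 0)"
      by (rule has_derivative_compose[OF 1])
    have "((\<lambda>t::real. ln (p (\<mu> + t *\<^sub>R axis i 1) x)) has_derivative
        (\<lambda>t. J (t *\<^sub>R axis i 1) \<bullet> \<phi> x - J (t *\<^sub>R axis i 1) \<bullet> mv ?t + 0)) (at 0)"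
      unfolding ln by (intro has_derivative_add has_derivative_diff has_derivative_inner_left 1 2 has_derivative_const)
    then have "((\<lambda>t::real. ln (p (\<mu> + t *\<^sub>R axis i 1) x)) has_derivative (\<lambda>t. (J (axis i 1) \<bullet> (\<phi> x - mv ?t)) * t)) (at 0)"
      by (rule has_derivative_eq_rhs) (simp add: fun_eq_iff linear_scale[OF J(1)] algebra_simps)
    then show ?thesis
      unfolding score_def by (intro DERIV_imp_deriv) (simp add: has_field_derivative_def)
  qed
  \<comment> \<open>Where \<open>r x = 0\<close> the function under \<open>deriv\<close> is
    constant. This settles the score on all of the space, which its measurability requires.\<close>
  have score0: "score p \<mu> i x = 0" if "r x = 0" for i x
    using that by (simp add: score_def p_eq DERIV_imp_deriv)
  have score_eq: "score p \<mu> i x = (if 0 < r x then J (axis i 1) \<bullet> (\<phi> x - mv ?t) else 0)" if "x \<in> space \<Lambda>" for i x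
    using score[of x i] score0[of x i] r_nonneg[OF that] by (cases "r x = 0") auto
  have [measurable]: "score p \<mu> i \<in> borel_measurable \<Lambda>" for i
    by (subst measurable_cong[OF score_eq]) measurable
  have fi: "fisher_information \<Lambda> p \<mu> $ i $ j = J (axis i 1) $ j" for i j
  proof -
    have "fisher_information \<Lambda> p \<mu> $ i $ j = (\<integral>x. score p \<mu> i x * score p \<mu> j x \<partial>model_measure \<Lambda> p \<mu>)"
      by (simp add: fisher_information_def)
    also have "\<dots> = (\<integral>x. (J (axis i 1) \<bullet> (\<phi> x - mv ?t)) * (J (axis j 1) \<bullet> (\<phi> x - mv ?t)) \<partial>model_measure \<Lambda> p \<mu>)"
    proof (rule integral_cong_AE)
      show "AE x in model_measure \<Lambda> p \<mu>. score p \<mu> i x * score p \<mu> j x =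
        (J (axis i 1) \<bullet> (\<phi> x - mv ?t)) * (J (axis j 1) \<bullet> (\<phi> x - mv ?t))"
        using AE_model_pos by eventually_elim (simp add: score)
    qed measurable
    also have "\<dots> = J (axis i 1) \<bullet> cov ?t (J (axis j 1))"
      unfolding inner_cov[OF T] by (subst integral_model) auto
    also have "\<dots> = J (axis i 1) $ j" by (simp add: J(3) inner_axis)
    finally show ?thesis .
  qed
  have "standardized_squared_error \<Lambda> p \<mu> \<mu>' = var ?t (J (\<mu>' - \<mu>))" for \<mu>'
  proof -
    define v where "v = \<mu>' - \<mu>"
    have "v \<bullet> (fisher_information \<Lambda> p \<mu> *v v) = (\<Sum>i\<in>UNIV. v $ i * (J (axis i 1) \<bullet> v))"
      by (simp add: inner_vec_def matrix_vector_mult_def fi)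
    also have "\<dots> = (\<Sum>i\<in>UNIV. v $ i *\<^sub>R J (axis i 1)) \<bullet> v" by (simp add: inner_sum_left)
    also have "(\<Sum>i\<in>UNIV. v $ i *\<^sub>R J (axis i 1)) = J (\<Sum>i\<in>UNIV. v $ i *\<^sub>R axis i 1)"
      by (simp add: linear_sum[OF J(1)] linear_scale[OF J(1)])
    also have "(\<Sum>i\<in>UNIV. v $ i *\<^sub>R axis i 1) = v"
      using basis_expansion[of v] by (simp add: scalar_mult_eq_scaleR)
    finally show ?thesis
      by (simp add: standardized_squared_error_def v_def var_cov[OF T] J(3))
  qed
  then show ?thesis using that J(3) by blast
qed

section \<open>Comparison and continuity of the losses\<close>

text \<open>Squared error and Hellinger distance satisfy a triangle inequality up to a factor 2; the
  standardized error is comparable to squared error on K; Kullback-Leibler and Renyi are covered by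
  \<open>breg_shift\<close> and \<open>bgap_shift\<close>. The third point \<mu>' is not confined to
  K, because an estimate may fall anywhere in its range.\<close>

lemma loss_shift:
  assumes d: "d \<in> {squared_error, standardized_squared_error \<Lambda> p, renyi_half \<Lambda> p, squared_hellinger \<Lambda> p, kullback_leibler \<Lambda> p}"
    and K: "compact K" "K \<subseteq> M"
  obtains A where "0 < A"
    "\<And>\<mu> \<mu>0 \<mu>'. \<mu> \<in> K \<Longrightarrow> \<mu>0 \<in> K \<Longrightarrow> \<mu>' \<in> M \<Longrightarrow>
       0 \<le> d \<mu>0 \<mu>' \<and> d \<mu> \<mu>' \<le> A * ((norm (\<mu> - \<mu>0))\<^sup>2 + d \<mu>0 \<mu>')"
proof -
  have T: "compact (th ` K)" "th ` K \<subseteq> \<Theta>"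
    using K th_in by (auto intro!: compact_continuous_image continuous_on_subset[OF continuous_th])
  have mvK: "mv (th \<mu>) = \<mu>" "th \<mu> \<in> th ` K" "th \<mu> \<in> \<Theta>" if "\<mu> \<in> K" for \<mu>
    using that K mv_th th_in by auto
  have sq: "squared_error \<mu> \<mu>' \<le> 2 * ((norm (\<mu> - \<mu>0))\<^sup>2 + squared_error \<mu>0 \<mu>')" for \<mu> \<mu>0 \<mu>' :: "real ^ 'm"
  proof -
    have "norm (\<mu> - \<mu>') \<le> norm (\<mu> - \<mu>0) + norm (\<mu>0 - \<mu>')" using norm_triangle_ineq[of "\<mu> - \<mu>0" "\<mu>0 - \<mu>'"] by simp
    then have "(norm (\<mu> - \<mu>'))\<^sup>2 \<le> (norm (\<mu> - \<mu>0) + norm (\<mu>0 - \<mu>'))\<^sup>2" by (intro power_mono) auto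
    also have "\<dots> \<le> 2 * ((norm (\<mu> - \<mu>0))\<^sup>2 + (norm (\<mu>0 - \<mu>'))\<^sup>2)"
      using sum_squares_bound[of "norm (\<mu> - \<mu>0)" "norm (\<mu>0 - \<mu>')"] by (simp add: power2_sum)
    finally show ?thesis by (simp add: squared_error_def)
  qed
  from d consider (eucl) "d = squared_error" | (st) "d = standardized_squared_error \<Lambda> p" | (re) "d = renyi_half \<Lambda> p"
    | (he) "d = squared_hellinger \<Lambda> p" | (kl) "d = kullback_leibler \<Lambda> p" by blast
  then show ?thesis
  proof cases
    case eucl
    have "0 \<le> d \<mu>0 \<mu>' \<and> d \<mu> \<mu>' \<le> 2 * ((norm (\<mu> - \<mu>0))\<^sup>2 + d \<mu>0 \<mu>')" for \<mu> \<mu>0 \<mu>'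
      using sq[of \<mu> \<mu>' \<mu>0] unfolding eucl by (simp add: squared_error_def)
    then show ?thesis by (intro that[of 2]) auto
  next
    case st
    obtain k where k: "0 < k" and q: "\<And>\<theta>. \<theta> \<in> th ` K \<Longrightarrow> quad k \<theta>" using uniform_quad[OF T] by blast
    have b: "k * squared_error \<mu> \<mu>' \<le> d \<mu> \<mu>'" "d \<mu> \<mu>' \<le> squared_error \<mu> \<mu>' / k" if \<mu>: "\<mu> \<in> K" for \<mu> \<mu>'
    proof -
      have "\<mu> \<in> M" using \<mu> K by blast
      then obtain J where J: "\<And>v. cov (th \<mu>) (J v) = v"
        "\<And>\<mu>'. standardized_squared_error \<Lambda> p \<mu> \<mu>' = var (th \<mu>) (J (\<mu>' - \<mu>))"
        by (rule standardized_squared_error_eq) blast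
      show "k * squared_error \<mu> \<mu>' \<le> d \<mu> \<mu>'" "d \<mu> \<mu>' \<le> squared_error \<mu> \<mu>' / k"
        using var_bounds_cov[OF q[OF mvK(2)[OF \<mu>]] k, of "J (\<mu>' - \<mu>)"]
        by (auto simp: st J squared_error_def norm_minus_commute)
    qed
    define A where "A = 2 / k + 2 / k\<^sup>2"
    have "0 \<le> d \<mu>0 \<mu>' \<and> d \<mu> \<mu>' \<le> A * ((norm (\<mu> - \<mu>0))\<^sup>2 + d \<mu>0 \<mu>')"
      if h: "\<mu> \<in> K" "\<mu>0 \<in> K" "\<mu>' \<in> M" for \<mu> \<mu>0 \<mu>'
    proof
      have "0 \<le> k * squared_error \<mu>0 \<mu>'" using k by (simp add: squared_error_def)
      then show d0: "0 \<le> d \<mu>0 \<mu>'" using b(1)[OF h(2), of \<mu>'] by linarith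
      have "squared_error \<mu>0 \<mu>' \<le> d \<mu>0 \<mu>' / k" using b(1)[OF h(2), of \<mu>'] k by (simp add: field_simps)
      then have "squared_error \<mu> \<mu>' \<le> 2 * ((norm (\<mu> - \<mu>0))\<^sup>2 + d \<mu>0 \<mu>' / k)" using sq[of \<mu> \<mu>' \<mu>0] by simp
      then have "squared_error \<mu> \<mu>' / k \<le> 2 * ((norm (\<mu> - \<mu>0))\<^sup>2 + d \<mu>0 \<mu>' / k) / k" using k by (intro divide_right_mono) auto
      also have "\<dots> = 2 / k * (norm (\<mu> - \<mu>0))\<^sup>2 + 2 / k\<^sup>2 * d \<mu>0 \<mu>'"
        using k by (simp add: power2_eq_square field_simps)
      also have "\<dots> \<le> A * (norm (\<mu> - \<mu>0))\<^sup>2 + A * d \<mu>0 \<mu>'"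
        using k d0 by (intro add_mono mult_right_mono) (auto simp: A_def)
      finally show "d \<mu> \<mu>' \<le> A * ((norm (\<mu> - \<mu>0))\<^sup>2 + d \<mu>0 \<mu>')"
        using b(2)[OF h(1), of \<mu>'] by (simp add: distrib_left)
    qed
    moreover have "0 < A" using k by (simp add: A_def add_pos_pos)
    ultimately show ?thesis using that by blast
  next
    case re
    obtain A where A: "0 < A"
      "\<And>\<theta> \<theta>0 \<theta>'. \<theta> \<in> th ` K \<Longrightarrow> \<theta>0 \<in> th ` K \<Longrightarrow> \<theta>' \<in> \<Theta> \<Longrightarrow> bgap \<theta> \<theta>' \<le> A * ((norm (mv \<theta> - mv \<theta>0))\<^sup>2 + bgap \<theta>0 \<theta>')"
      by (rule bgap_shift[OF T]) blast
    have "0 \<le> d \<mu>0 \<mu>' \<and> d \<mu> \<mu>' \<le> (2 * A) * ((norm (\<mu> - \<mu>0))\<^sup>2 + d \<mu>0 \<mu>')"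
      if h: "\<mu> \<in> K" "\<mu>0 \<in> K" "\<mu>' \<in> M" for \<mu> \<mu>0 \<mu>'
    proof -
      have hM: "\<mu> \<in> M" "\<mu>0 \<in> M" using h K by auto
      have e: "d \<mu> \<mu>' = 2 * bgap (th \<mu>) (th \<mu>')" "d \<mu>0 \<mu>' = 2 * bgap (th \<mu>0) (th \<mu>')"
        using hM h(3) by (simp_all add: re renyi_half_def affinity_eq)
      have n: "0 \<le> bgap (th \<mu>0) (th \<mu>')" using th_in hM h(3) Theta_natdom by (intro bgap_nonneg) auto
      have "bgap (th \<mu>) (th \<mu>') \<le> A * ((norm (\<mu> - \<mu>0))\<^sup>2 + bgap (th \<mu>0) (th \<mu>'))"
        using A(2)[of "th \<mu>" "th \<mu>0" "th \<mu>'"] h mvK th_in by auto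
      also have "\<dots> \<le> A * ((norm (\<mu> - \<mu>0))\<^sup>2 + d \<mu>0 \<mu>')" using A(1) n e(2) by (intro mult_left_mono) auto
      finally show ?thesis using n e by simp
    qed
    then show ?thesis using that[of "2 * A"] A(1) by simp
  next
    case he
    obtain A where A: "0 < A"
      "\<And>\<theta> \<theta>'. \<theta> \<in> th ` K \<Longrightarrow> \<theta>' \<in> th ` K \<Longrightarrow> breg \<theta> \<theta>' \<le> A * (norm (mv \<theta>' - mv \<theta>))\<^sup>2"
      by (rule compact_constants[OF T]) blast
    have "0 \<le> d \<mu>0 \<mu>' \<and> d \<mu> \<mu>' \<le> (2 + 2 * A) * ((norm (\<mu> - \<mu>0))\<^sup>2 + d \<mu>0 \<mu>')"
      if h: "\<mu> \<in> K" "\<mu>0 \<in> K" "\<mu>' \<in> M" for \<mu> \<mu>0 \<mu>'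
    proof -
      have hM: "\<mu> \<in> M" "\<mu>0 \<in> M" using h K by auto
      have nat: "th \<mu> \<in> natdom" "th \<mu>0 \<in> natdom" "th \<mu>' \<in> natdom" using th_in hM h(3) Theta_natdom by auto
      have e: "d \<mu> \<mu>' = 2 * (1 - exp (- bgap (th \<mu>) (th \<mu>')))" "d \<mu>0 \<mu>' = 2 * (1 - exp (- bgap (th \<mu>0) (th \<mu>')))"
        using hM h(3) by (simp_all add: he squared_hellinger_def affinity_eq)
      have d0: "0 \<le> d \<mu>0 \<mu>'" unfolding e using bgap_nonneg[OF nat(2,3)] by simp
      have "1 - exp (- bgap (th \<mu>) (th \<mu>0)) \<le> bgap (th \<mu>) (th \<mu>0)"
        using exp_ge_add_one_self[of "- bgap (th \<mu>) (th \<mu>0)"] by linarith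
      also have "\<dots> \<le> breg (th \<mu>) (th \<mu>0) / 2" using h mvK nat by (intro bgap_le_breg) auto
      also have "\<dots> \<le> A * (norm (\<mu> - \<mu>0))\<^sup>2 / 2"
        using A(2)[of "th \<mu>" "th \<mu>0"] h mvK by (auto simp: norm_minus_commute)
      finally have "d \<mu> \<mu>' \<le> 2 * (A * (norm (\<mu> - \<mu>0))\<^sup>2) + 2 * d \<mu>0 \<mu>'"
        using hellinger_triangle[OF nat] unfolding e by simp
      also have "\<dots> = (2 * A) * (norm (\<mu> - \<mu>0))\<^sup>2 + 2 * d \<mu>0 \<mu>'" by simp
      also have "\<dots> \<le> (2 + 2 * A) * (norm (\<mu> - \<mu>0))\<^sup>2 + (2 + 2 * A) * d \<mu>0 \<mu>'"
        using A(1) d0 by (intro add_mono mult_right_mono) auto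
      finally show ?thesis using d0 by (simp add: distrib_left)
    qed
    then show ?thesis using that[of "2 + 2 * A"] A(1) by simp
  next
    case kl
    obtain A where A: "0 < A"
      "\<And>\<theta> \<theta>0 \<theta>'. \<theta> \<in> th ` K \<Longrightarrow> \<theta>0 \<in> th ` K \<Longrightarrow> \<theta>' \<in> \<Theta> \<Longrightarrow> breg \<theta> \<theta>' \<le> A * ((norm (mv \<theta> - mv \<theta>0))\<^sup>2 + breg \<theta>0 \<theta>')"
      by (rule breg_shift[OF T]) blast
    have "0 \<le> d \<mu>0 \<mu>' \<and> d \<mu> \<mu>' \<le> A * ((norm (\<mu> - \<mu>0))\<^sup>2 + d \<mu>0 \<mu>')"
      if h: "\<mu> \<in> K" "\<mu>0 \<in> K" "\<mu>' \<in> M" for \<mu> \<mu>0 \<mu>'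
    proof -
      have hM: "\<mu> \<in> M" "\<mu>0 \<in> M" using h K by auto
      have e: "d \<mu> \<mu>' = breg (th \<mu>) (th \<mu>')" "d \<mu>0 \<mu>' = breg (th \<mu>0) (th \<mu>')"
        using hM h(3) by (simp_all add: kl kullback_leibler_eq)
      have "0 \<le> breg (th \<mu>0) (th \<mu>')" using th_in hM h(3) Theta_natdom by (intro breg_nonneg) auto
      then show ?thesis
        unfolding e using A(2)[of "th \<mu>" "th \<mu>0" "th \<mu>'"] h mvK th_in by auto
    qed
    then show ?thesis using that A(1) by blast
  qed
qed

text \<open>Serves to make the loss of a measurable estimator a measurable function of the
  sample.\<close>

lemma loss_continuous:
  assumes d: "d \<in> {squared_error, standardized_squared_error \<Lambda> p, renyi_half \<Lambda> p, squared_hellinger \<Lambda> p, kullback_leibler \<Lambda> p}"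
    and \<mu>: "\<mu> \<in> M"
  shows "continuous_on M (d \<mu>)"
proof -
  have th: "th ` M \<subseteq> \<Theta>" using th_in by auto
  have g: "continuous_on M (\<lambda>\<mu>'. bgap (th \<mu>) (th \<mu>'))"
    by (rule continuous_on_compose2[OF continuous_bgap[OF th_in[OF \<mu>]] continuous_th th])
  have b: "continuous_on M (\<lambda>\<mu>'. breg (th \<mu>) (th \<mu>'))"
    by (rule continuous_on_compose2[OF continuous_breg continuous_th th])
  from d consider (sq) "d = squared_error" | (st) "d = standardized_squared_error \<Lambda> p" | (re) "d = renyi_half \<Lambda> p"
    | (he) "d = squared_hellinger \<Lambda> p" | (kl) "d = kullback_leibler \<Lambda> p" by blast
  then show ?thesis
  proof cases
    case sq
    then show ?thesis unfolding squared_error_def[abs_def] by (auto intro!: continuous_intros)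
  next
    case st
    have "continuous_on M (\<lambda>\<mu>'. (\<mu>' - \<mu>) \<bullet> (fisher_information \<Lambda> p \<mu> *v (\<mu>' - \<mu>)))"
      by (intro continuous_intros continuous_on_compose2[OF matrix_vector_mult_linear_continuous_on]) auto
    then show ?thesis by (simp add: st standardized_squared_error_def[abs_def])
  next
    case re
    have "continuous_on M (\<lambda>\<mu>'. 2 * bgap (th \<mu>) (th \<mu>'))" using g by (intro continuous_intros)
    then show ?thesis
      by (rule continuous_on_cong[OF refl, THEN iffD1, rotated]) (simp add: re renyi_half_def affinity_eq \<mu>)
  next
    case he
    have "continuous_on M (\<lambda>\<mu>'. 2 * (1 - exp (- bgap (th \<mu>) (th \<mu>'))))" using g by (intro continuous_intros)
    then show ?thesis
      by (rule continuous_on_cong[OF refl, THEN iffD1, rotated]) (simp add: he squared_hellinger_def affinity_eq \<mu>)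
  next
    case kl
    show ?thesis
      using b by (rule continuous_on_cong[OF refl, THEN iffD1, rotated]) (simp add: kl kullback_leibler_eq \<mu>)
  qed
qed

end

section \<open>The switch criterion\<close>

text \<open>A likelihood bound with one factor q for all elements of the null model survives mixing
  over a prior; a point null model is the case of an empty F. It is applied to the block from j to
  n, and to the segment from 0 to j, where it shows that the marginal is finite.\<close>

lemma bayes0_block:
  assumes q: "0 < q" and M0: "\<And>\<mu>. \<mu> \<in> M0 \<Longrightarrow> likelihood p \<mu> n x \<le> q * likelihood p \<mu> j x"
    and proj: "\<And>\<mu>. \<mu> \<in> restrict_coords F ` M0 \<Longrightarrow> proj0 F \<nu> \<mu> \<in> M0" and \<nu>: "F = {} \<Longrightarrow> \<nu> \<in> M0"
    and \<omega>: "\<And>\<mu>. F \<noteq> {} \<Longrightarrow> \<mu> \<in> restrict_coords F ` M0 \<Longrightarrow> 0 < \<omega>0 \<mu>"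
  shows "bayes0 p F \<nu> M0 \<omega>0 n x \<le> ennreal q * bayes0 p F \<nu> M0 \<omega>0 j x"
proof (cases "F = {}")
  case True
  then show ?thesis using M0[OF \<nu>[OF True]] q
    by (simp add: bayes0_def ennreal_mult'[symmetric] ennreal_leI)
next
  case False
  let ?S = "restrict_coords F ` M0"
  have "(\<integral>\<^sup>+\<mu>\<in>?S. ennreal (\<omega>0 \<mu> * likelihood p (proj0 F \<nu> \<mu>) n x) \<partial>lborel_coords F) \<le>
    (\<integral>\<^sup>+\<mu>. ennreal q * (ennreal (\<omega>0 \<mu> * likelihood p (proj0 F \<nu> \<mu>) j x) * indicator ?S \<mu>) \<partial>lborel_coords F)"
  proof (rule nn_integral_mono)
    fix \<mu>
    show "ennreal (\<omega>0 \<mu> * likelihood p (proj0 F \<nu> \<mu>) n x) * indicator ?S \<mu> \<le>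
      ennreal q * (ennreal (\<omega>0 \<mu> * likelihood p (proj0 F \<nu> \<mu>) j x) * indicator ?S \<mu>)"
    proof (cases "\<mu> \<in> ?S")
      case True
      have "\<omega>0 \<mu> * likelihood p (proj0 F \<nu> \<mu>) n x \<le> \<omega>0 \<mu> * (q * likelihood p (proj0 F \<nu> \<mu>) j x)"
        using M0[OF proj[OF True]] \<omega>[OF False True] by (intro mult_left_mono) auto
      then have "ennreal (\<omega>0 \<mu> * likelihood p (proj0 F \<nu> \<mu>) n x) \<le> ennreal (q * (\<omega>0 \<mu> * likelihood p (proj0 F \<nu> \<mu>) j x))"
        by (intro ennreal_leI) (simp add: mult.left_commute)
      then show ?thesis using True q by (simp add: ennreal_mult')
    qed simp
  qed
  also have "\<dots> = ennreal q * (\<integral>\<^sup>+\<mu>\<in>?S. ennreal (\<omega>0 \<mu> * likelihood p (proj0 F \<nu> \<mu>) j x) \<partial>lborel_coords F)"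
    by (rule nn_integral_cmult_pos[OF q])
  finally show ?thesis using False by (simp add: bayes0_def)
qed

lemma bayes0_zero:
  assumes "F \<noteq> {} \<Longrightarrow> positive_prior (lborel_coords F) (restrict_coords F ` M0) \<omega>0"
  shows "bayes0 p F \<nu> M0 \<omega>0 0 x = 1"
  using assms by (simp add: bayes0_def likelihood_def positive_prior_def)

lemma bayes1_zero: "positive_prior lborel M1 \<omega>1 \<Longrightarrow> bayes1 p M1 \<omega>1 0 x = 1"
  by (simp add: bayes1_def likelihood_def positive_prior_def)

lemma le_imp_inverse_le_ennreal:
  fixes a b :: ennreal
  assumes ab: "a \<le> b"
  shows "inverse b \<le> inverse a"
proof (cases "a = 0 \<or> b = top")
  case False
  then obtain x where x: "b = ennreal x" "0 \<le> x" by (cases b) auto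
  obtain y where y: "a = ennreal y" "0 \<le> y" using ab False by (cases a) (auto simp: top_unique)
  have "0 < y" "y \<le> x" using False ab x y by (auto simp: less_le)
  then show ?thesis by (simp add: x y inverse_ennreal ennreal_leI le_imp_inverse_le)
qed auto

lemma switch_distribution_ge:
  assumes "1 \<le> t"
  shows "ennreal (pmf \<pi> t) * switch_component pB0 pB1 t n x \<le> switch_distribution \<pi> pB0 pB1 n x"
proof -
  have "(\<Sum>k\<in>{t - 1}. ennreal (pmf \<pi> (Suc k)) * switch_component pB0 pB1 (Suc k) n x) \<le> switch_distribution \<pi> pB0 pB1 n x"
    unfolding switch_distribution_def by (rule sum_le_suminf) auto
  then show ?thesis using assms by simp
qed

text \<open>Only the term t of the mixture is kept. The value of \<open>pB0\<close> on the initial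
  segment appears in it as well as in the bound for \<open>pB0 n x\<close>, so it cancels, being
  finite; what remains is \<open>\<pi>(t)\<close> times the conditional density of the block under
  \<open>pB1\<close> against q.\<close>

lemma switch_criterion_eq_1:
  assumes t: "1 \<le> t" "t \<le> n" and j: "j = t - 1"
    and B0n: "pB0 n x \<le> ennreal q * pB0 j x" and B0j: "pB0 j x < \<infinity>"
    and B1: "ennreal lo \<le> pB1 n x" "pB1 j x \<le> ennreal up" "0 < lo" "0 < up"
    and q: "0 \<le> q" "q < pmf \<pi> t * (lo / up)"
    and init: "0 < pmf \<pi> 1" "pB0 0 x = 1" "pB1 0 x = 1"
  shows "switch_criterion \<pi> pB0 pB1 n x = 1"
proof -
  let ?sw = "switch_distribution \<pi> pB0 pB1 n x"
  obtain \<beta> where \<beta>: "pB0 j x = ennreal \<beta>" "0 \<le> \<beta>" using B0j by (cases "pB0 j x") auto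
  have B0n': "pB0 n x \<le> ennreal (q * \<beta>)" using B0n q(1) by (simp add: \<beta> ennreal_mult')
  then obtain y where y: "pB0 n x = ennreal y" "0 \<le> y" by (cases "pB0 n x") (auto simp: top_unique)
  have yq: "y \<le> q * \<beta>" using B0n' y \<beta>(2) q(1) by (simp add: ennreal_le_iff)
  have "1 < ?sw / pB0 n x"
  proof (cases "y = 0")
    \<comment> \<open>Here the quotient is infinite, since \<open>z / 0 = top\<close> for \<open>z \<noteq> 0\<close>; the term \<open>t = 1\<close> shows \<open>z \<noteq> 0\<close>.\<close>
    case True
    have "ennreal (pmf \<pi> 1) * switch_component pB0 pB1 1 n x \<le> ?sw" by (rule switch_distribution_ge) simp
    moreover have "switch_component pB0 pB1 1 n x = pB1 n x"
      using t init by (simp add: switch_component_def divide_ennreal_def)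
    moreover have "0 < pB1 n x" using B1(1,3) by (meson ennreal_less_zero_iff less_le_trans)
    moreover have "0 < ennreal (pmf \<pi> 1) * pB1 n x"
      using init(1) calculation(3) by (simp add: ennreal_zero_less_mult_iff)
    ultimately have "0 < ?sw" by (metis less_le_trans)
    then show ?thesis using True y by simp
  next
    case False
    then have ypos: "0 < y" using y by simp
    have \<beta>pos: "0 < \<beta>" using ypos yq \<beta>(2) by (cases "\<beta> = 0") auto
    have "ennreal (lo / up) = ennreal lo / ennreal up" using B1 by (simp add: divide_ennreal)
    also have "\<dots> \<le> pB1 n x / pB1 j x"
      unfolding divide_ennreal_def using B1 by (intro mult_mono le_imp_inverse_le_ennreal) auto
    finally have r: "ennreal (lo / up) \<le> pB1 n x / pB1 j x" .
    have "ennreal (pmf \<pi> t * (\<beta> * (lo / up))) = ennreal (pmf \<pi> t) * (ennreal \<beta> * ennreal (lo / up))"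
      by (simp only: ennreal_mult'[OF pmf_nonneg] ennreal_mult'[OF \<beta>(2)])
    also have "\<dots> \<le> ennreal (pmf \<pi> t) * (pB0 j x * (pB1 n x / pB1 j x))"
      unfolding \<beta> using r by (intro mult_left_mono) auto
    also have "\<dots> = ennreal (pmf \<pi> t) * switch_component pB0 pB1 t n x"
      using t by (simp add: switch_component_def j)
    also have "\<dots> \<le> ?sw" by (rule switch_distribution_ge[OF t(1)])
    finally have ge: "ennreal (pmf \<pi> t * (\<beta> * (lo / up))) \<le> ?sw" .
    have "y \<le> q * \<beta>" by (rule yq)
    also have "\<dots> < pmf \<pi> t * (lo / up) * \<beta>" by (rule mult_strict_right_mono[OF q(2) \<beta>pos])
    finally have lt: "y < pmf \<pi> t * (\<beta> * (lo / up))" by (simp add: mult_ac)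
    have nn: "0 \<le> pmf \<pi> t * (\<beta> * (lo / up))" using \<beta>(2) B1 by simp
    have "1 < pmf \<pi> t * (\<beta> * (lo / up)) / y" using lt ypos by (subst less_divide_eq_1_pos)
    then have "1 < ennreal (pmf \<pi> t * (\<beta> * (lo / up)) / y)" by (simp only: ennreal_1[symmetric] ennreal_less_iff zero_le_one)
    also have "\<dots> = ennreal (pmf \<pi> t * (\<beta> * (lo / up))) / ennreal y" by (rule divide_ennreal[symmetric, OF nn ypos])
    also have "\<dots> \<le> ?sw / pB0 n x" unfolding y(1) by (rule divide_right_mono_ennreal[OF ge])
    finally show ?thesis .
  qed
  then show ?thesis by (simp add: switch_criterion_def)
qed

section \<open>Deviations and likelihood ratios of samples\<close>

context density_family
begin

text \<open>Summed over the coordinates, independence leaves j times the variances, each at most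
  \<open>1 / k\<close>. The bound is written with n so that it serves both segments, and depends on
  \<mu> only through k.\<close>

lemma second_moment_centered:
  assumes \<mu>: "\<mu> \<in> M" and q: "quad k (th \<mu>)" and k: "0 < k" and j: "j \<le> n"
  shows "(\<integral>\<^sup>+x. ennreal ((norm (\<Sum>i\<in>{1..j}. \<phi> (x i) - \<mu>))\<^sup>2) \<partial>Pi\<^sub>M {1..n} (\<lambda>_. model_measure \<Lambda> p \<mu>))
     \<le> ennreal (real n * DIM(real ^ 'm) / k)"
proof -
  let ?N = "model_measure \<Lambda> p \<mu>"
  note T = th_in[OF \<mu>]
  define f where "f b y = b \<bullet> (\<phi> y - \<mu>)" for b y
  have mt: "mv (th \<mu>) = \<mu>" by (rule mv_th[OF \<mu>])
  have fm: "f b \<in> borel_measurable \<Lambda>" for b unfolding f_def by measurable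
  have f1: "integrable ?N (f b)" "(\<integral>y. f b y \<partial>?N) = 0" for b
    using centered[OF T, of b] by (simp_all add: integrable_model integral_model fm) (simp_all add: f_def mt)
  have f2: "integrable ?N (\<lambda>y. (f b y)\<^sup>2)" "(\<integral>y. (f b y)\<^sup>2 \<partial>?N) = var (th \<mu>) b" for b
  proof -
    have [measurable]: "(\<lambda>y. (f b y)\<^sup>2) \<in> borel_measurable \<Lambda>" using fm[of b] by measurable
    show "integrable ?N (\<lambda>y. (f b y)\<^sup>2)" "(\<integral>y. (f b y)\<^sup>2 \<partial>?N) = var (th \<mu>) b"
      using integrable_inner_cov[OF T, of b b]
      by (simp_all add: integrable_model integral_model) (simp_all add: f_def mt var_def power2_eq_square)
  qed
  note S = second_moment_sum[OF prob_space_model[OF \<mu>] finite_atLeastAtMost[of 1 n], of "{1..j}", OF _ f1 f2(1)]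
  have eq: "(norm (\<Sum>i\<in>{1..j}. \<phi> (x i) - \<mu>))\<^sup>2 = (\<Sum>b\<in>Basis. (\<Sum>i\<in>{1..j}. f b (x i))\<^sup>2)" for x
  proof -
    have "(norm v)\<^sup>2 = (\<Sum>b\<in>Basis. (b \<bullet> v)\<^sup>2)" for v :: "real ^ 'm"
      unfolding power2_norm_eq_inner by (subst euclidean_inner) (simp add: power2_eq_square inner_commute)
    from this[of "\<Sum>i\<in>{1..j}. \<phi> (x i) - \<mu>"] show ?thesis unfolding f_def inner_sum_right .
  qed
  have i: "integrable (Pi\<^sub>M {1..n} (\<lambda>_. ?N)) (\<lambda>x. (norm (\<Sum>i\<in>{1..j}. \<phi> (x i) - \<mu>))\<^sup>2)"
    unfolding eq using S(1) j by (intro Bochner_Integration.integrable_sum) auto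
  have "(\<integral>\<^sup>+x. ennreal ((norm (\<Sum>i\<in>{1..j}. \<phi> (x i) - \<mu>))\<^sup>2) \<partial>Pi\<^sub>M {1..n} (\<lambda>_. ?N)) =
    ennreal (\<integral>x. (norm (\<Sum>i\<in>{1..j}. \<phi> (x i) - \<mu>))\<^sup>2 \<partial>Pi\<^sub>M {1..n} (\<lambda>_. ?N))"
    by (rule nn_integral_eq_integral[OF i]) auto
  also have "(\<integral>x. (norm (\<Sum>i\<in>{1..j}. \<phi> (x i) - \<mu>))\<^sup>2 \<partial>Pi\<^sub>M {1..n} (\<lambda>_. ?N)) = (\<Sum>b\<in>Basis. real j * var (th \<mu>) b)"
    unfolding eq using S j by (subst Bochner_Integration.integral_sum) (auto simp: f2(2))
  also have "\<dots> \<le> (\<Sum>b\<in>(Basis :: (real ^ 'm) set). real n * (1 / k))"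
  proof (intro sum_mono mult_mono)
    fix b :: "real ^ 'm" assume "b \<in> Basis"
    then show "var (th \<mu>) b \<le> 1 / k" using quadD(6)[OF q k, of b] by simp
    show "0 \<le> var (th \<mu>) b" unfolding var_def by (auto intro!: integral_nonneg_AE)
  qed (use j in auto)
  also have "\<dots> = real n * DIM(real ^ 'm) / k" by simp
  finally show ?thesis by (simp add: ennreal_leI)
qed

text \<open>The sample enters a likelihood ratio only through the centred sum of \<phi>. Smallness
  of that sum is hence all that the deterministic part of the argument has to know about the
  sample.\<close>

lemma likelihood_eq:
  "likelihood p \<mu>' n x = likelihood p \<mu> n x *
     exp ((th \<mu>' - th \<mu>) \<bullet> (\<Sum>i\<in>{1..n}. \<phi> (x i) - mv (th \<mu>)) - real n * breg (th \<mu>) (th \<mu>'))"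
proof -
  have "p \<mu>' y = p \<mu> y * exp ((th \<mu>' - th \<mu>) \<bullet> (\<phi> y - mv (th \<mu>)) - breg (th \<mu>) (th \<mu>'))" for y
    unfolding p_eq by (subst w_ratio[of _ _ "th \<mu>"]) (simp add: breg_def inner_diff_right)
  then have "likelihood p \<mu>' n x = likelihood p \<mu> n x *
     exp (\<Sum>i\<in>{1..n}. (th \<mu>' - th \<mu>) \<bullet> (\<phi> (x i) - mv (th \<mu>)) - breg (th \<mu>) (th \<mu>'))"
    by (simp add: likelihood_def prod.distrib exp_sum)
  also have "(\<Sum>i\<in>{1..n}. (th \<mu>' - th \<mu>) \<bullet> (\<phi> (x i) - mv (th \<mu>)) - breg (th \<mu>) (th \<mu>')) =
      (th \<mu>' - th \<mu>) \<bullet> (\<Sum>i\<in>{1..n}. \<phi> (x i) - mv (th \<mu>)) - real n * breg (th \<mu>) (th \<mu>')"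
    unfolding inner_sum_right sum_subtractf[of "\<lambda>i. (th \<mu>' - th \<mu>) \<bullet> (\<phi> (x i) - mv (th \<mu>))"] by simp
  finally show ?thesis .
qed

lemma likelihood_pos: "(\<And>i. i \<in> {1..n} \<Longrightarrow> 0 < r (x i)) \<Longrightarrow> 0 < likelihood p \<mu> n x"
  unfolding likelihood_def p_eq by (intro prod_pos) (auto simp: w_pos)

lemma bayes1_eq:
  assumes L: "0 < likelihood p \<mu> n x"
  shows "bayes1 p M \<omega> n x = ennreal (likelihood p \<mu> n x) *
    (\<integral>\<^sup>+\<mu>'\<in>M. ennreal (\<omega> \<mu>' * exp ((th \<mu>' - th \<mu>) \<bullet> (\<Sum>i\<in>{1..n}. \<phi> (x i) - mv (th \<mu>)) - real n * breg (th \<mu>) (th \<mu>'))) \<partial>lborel)"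
  unfolding bayes1_def
proof (subst nn_integral_cmult_pos[OF L, symmetric], rule nn_integral_cong)
  fix \<mu>'
  show "ennreal (\<omega> \<mu>' * likelihood p \<mu>' n x) * indicator M \<mu>' = ennreal (likelihood p \<mu> n x) *
    (ennreal (\<omega> \<mu>' * exp ((th \<mu>' - th \<mu>) \<bullet> (\<Sum>i\<in>{1..n}. \<phi> (x i) - mv (th \<mu>)) - real n * breg (th \<mu>) (th \<mu>'))) * indicator M \<mu>')"
    unfolding likelihood_eq[of \<mu>' n x \<mu>] using L
    by (simp add: mult.assoc[symmetric] ennreal_mult'[symmetric]) (simp add: mult_ac)
qed

section \<open>Deterministic selection of the larger model\<close>

text \<open>The quantifier order matters: j depends on n alone and not on the sample, so the two
  deviations are sums over fixed index sets, to which the second-moment bound applies.\<close>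

lemma switch_selects:
  fixes F :: "'m set" and \<nu> :: "real ^ 'm" and \<pi> :: "nat pmf"
  assumes K: "compact K" "K \<subseteq> M" and M0: "M0 \<subseteq> M"
    and sep: "\<And>\<mu> \<mu>'. \<mu> \<in> K \<Longrightarrow> \<mu>' \<in> M0 \<Longrightarrow> norm (\<mu> - proj0 F \<nu> \<mu>) \<le> norm (\<mu>' - \<mu>)"
    and D: "0 \<le> D" "\<And>\<mu>. \<mu> \<in> K \<Longrightarrow> norm (\<mu> - proj0 F \<nu> \<mu>) \<le> D"
    and proj: "\<And>\<mu>. \<mu> \<in> restrict_coords F ` M0 \<Longrightarrow> proj0 F \<nu> \<mu> \<in> M0" and \<nu>: "F = {} \<Longrightarrow> \<nu> \<in> M0"
    and prior0: "F \<noteq> {} \<Longrightarrow> positive_prior (lborel_coords F) (restrict_coords F ` M0) \<omega>0"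
    and prior1: "positive_prior lborel M \<omega>1"
    and \<pi>1: "0 < pmf \<pi> 1" and \<kappa>: "0 < \<kappa>" and a: "0 < a"
    and order: "\<And>i::nat. 1 \<le> i \<Longrightarrow> a * real i powr - \<kappa> \<le> pmf \<pi> (2 ^ i)"
  obtains s A N where "0 < s" "0 < A"
    "\<And>n. N \<le> n \<Longrightarrow> \<exists>j\<le>n. \<forall>\<mu>\<in>K. \<forall>x. (\<forall>i\<in>{1..n}. 0 < r (x i)) \<longrightarrow>
        A * ln (ln (real n)) \<le> real n * (norm (\<mu> - proj0 F \<nu> \<mu>))\<^sup>2 \<longrightarrow>
        norm (\<Sum>i\<in>{1..j}. \<phi> (x i) - \<mu>) \<le> s * real n * norm (\<mu> - proj0 F \<nu> \<mu>) \<longrightarrow>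
        norm (\<Sum>i\<in>{1..n}. \<phi> (x i) - \<mu>) \<le> s * real n * norm (\<mu> - proj0 F \<nu> \<mu>) \<longrightarrow>
        switch_criterion \<pi> (bayes0 p F \<nu> M0 \<omega>0) (bayes1 p M \<omega>1) n x = 1"
proof -
  let ?m = "DIM(real ^ 'm)"
  have T: "compact (th ` K)" "th ` K \<subseteq> \<Theta>"
    using K th_in by (auto intro!: compact_continuous_image continuous_on_subset[OF continuous_th])
  have \<omega>1: "continuous_on M \<omega>1" "\<And>\<mu>. \<mu> \<in> M \<Longrightarrow> 0 < \<omega>1 \<mu>" "(\<integral>\<^sup>+\<mu>\<in>M. ennreal (\<omega>1 \<mu>) \<partial>lborel) = 1"
    using prior1 by (auto simp: positive_prior_def)
  obtain c s1 where c: "0 < c" "0 < s1" and ex: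
    "\<And>s \<theta> \<theta>' \<Delta> n j v. s \<le> s1 \<Longrightarrow> \<theta> \<in> th ` K \<Longrightarrow> \<theta>' \<in> \<Theta> \<Longrightarrow> 0 \<le> \<Delta> \<Longrightarrow> \<Delta> \<le> D \<Longrightarrow>
       \<Delta> \<le> norm (mv \<theta>' - mv \<theta>) \<Longrightarrow> 0 \<le> n \<Longrightarrow> n / 8 \<le> j \<Longrightarrow> norm v \<le> 2 * s * n * \<Delta> \<Longrightarrow>
       (\<theta>' - \<theta>) \<bullet> v - j * breg \<theta> \<theta>' \<le> - c * (n * \<Delta>\<^sup>2)"
    by (rule exponent_bound[OF T D(1)]) blast
  obtain C1 s2 where C1: "0 < C1" "0 < s2" and up:
    "\<And>s \<theta> \<Delta> n j v. 0 < s \<Longrightarrow> s \<le> s2 \<Longrightarrow> \<theta> \<in> th ` K \<Longrightarrow> 0 \<le> \<Delta> \<Longrightarrow> \<Delta> \<le> D \<Longrightarrow> 1 \<le> n \<Longrightarrow> n / 8 \<le> j \<Longrightarrow>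
       norm v \<le> s * n * \<Delta> \<Longrightarrow>
       (\<integral>\<^sup>+\<mu>\<in>M. ennreal (\<omega>1 \<mu> * exp ((th \<mu> - \<theta>) \<bullet> v - j * breg \<theta> (th \<mu>))) \<partial>lborel)
         \<le> ennreal (C1 * (1 / sqrt n) ^ ?m * exp (C1 * (s * n * \<Delta>\<^sup>2)))"
    by (rule marginal_upper[OF T D(1) \<omega>1]) blast+
  obtain c2 C2 where c2: "0 < c2" "0 < C2" and lo:
    "\<And>s \<theta> \<Delta> n v. 0 < s \<Longrightarrow> \<theta> \<in> th ` K \<Longrightarrow> 0 \<le> \<Delta> \<Longrightarrow> 1 \<le> n \<Longrightarrow> 1 \<le> n * \<Delta>\<^sup>2 \<Longrightarrow>
       norm v \<le> s * n * \<Delta> \<Longrightarrow>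
       ennreal (c2 * (1 / sqrt n) ^ ?m * exp (- C2 * (s * n * \<Delta>\<^sup>2))) \<le>
       (\<integral>\<^sup>+\<mu>\<in>M. ennreal (\<omega>1 \<mu> * exp ((th \<mu> - \<theta>) \<bullet> v - n * breg \<theta> (th \<mu>))) \<partial>lborel)"
    by (rule marginal_lower[OF T \<omega>1(1,2)]) blast+
  \<comment> \<open>The last entry limits the fluctuation of the two marginals,
    \<open>(C1 + C2) * s * X\<close> in the exponent, to half of the gain \<open>c * X\<close> on
    the block.\<close>
  define s where "s = min (min s1 s2) (c / (2 * (C1 + C2)))"
  have s: "0 < s" "s \<le> s1" "s \<le> s2" "s \<le> c / (2 * (C1 + C2))"
    using c C1 c2 by (auto simp: s_def)
  have sC: "(C1 + C2) * s \<le> c / 2" using s(4) C1 c2 by (simp add: field_simps)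
  \<comment> \<open>The constants that remain after all exponentials are separated: from
    \<open>\<pi>(t)\<close> the factor \<open>a\<close> and 2 to the power
    \<open>- \<kappa>\<close>, from the marginals the quotient \<open>c2 / C1\<close>.\<close>
  define b0 where "b0 = a * exp (- \<kappa> * ln 2) * (c2 / C1)"
  have b0: "0 < b0" using a c2 C1 by (simp add: b0_def)
  \<comment> \<open>The other half of the gain, \<open>c / 2 * X\<close>, must exceed
    \<open>\<kappa>\<close> times the iterated logarithm plus \<open>\<bar>ln b0\<bar>\<close>; the
    final 1 makes the inequality strict.\<close>
  define A where "A = max 1 (2 / c * (\<kappa> + \<bar>ln b0\<bar> + 1))"
  have A: "1 \<le> A" "\<kappa> + \<bar>ln b0\<bar> + 1 \<le> c / 2 * A"
  proof -
    show "1 \<le> A" by (simp add: A_def)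
    have "c / 2 * (2 / c * (\<kappa> + \<bar>ln b0\<bar> + 1)) \<le> c / 2 * A" using c(1) by (intro mult_left_mono) (auto simp: A_def)
    then show "\<kappa> + \<bar>ln b0\<bar> + 1 \<le> c / 2 * A" using c(1) by simp
  qed
  \<comment> \<open>Ensures that the iterated logarithm is at least 1; the summand 16 leaves room
    for the loss of one in \<open>j = t - 1\<close>.\<close>
  define N where "N = nat \<lceil>exp (exp 1 :: real)\<rceil> + 16"
  have "\<exists>j\<le>n. \<forall>\<mu>\<in>K. \<forall>x. (\<forall>i\<in>{1..n}. 0 < r (x i)) \<longrightarrow>
        A * ln (ln (real n)) \<le> real n * (norm (\<mu> - proj0 F \<nu> \<mu>))\<^sup>2 \<longrightarrow>
        norm (\<Sum>i\<in>{1..j}. \<phi> (x i) - \<mu>) \<le> s * real n * norm (\<mu> - proj0 F \<nu> \<mu>) \<longrightarrow>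
        norm (\<Sum>i\<in>{1..n}. \<phi> (x i) - \<mu>) \<le> s * real n * norm (\<mu> - proj0 F \<nu> \<mu>) \<longrightarrow>
        switch_criterion \<pi> (bayes0 p F \<nu> M0 \<omega>0) (bayes1 p M \<omega>1) n x = 1"
    if n: "N \<le> n" for n
  proof -
    have n16: "16 \<le> n" using n by (simp add: N_def)
    have "exp (exp 1) \<le> real n" using n by (simp add: N_def) linarith
    then have "exp 1 \<le> ln (real n)" using n16 by (subst ln_ge_iff) auto
    moreover from this have lnpos: "0 < ln (real n)" using less_le_trans[OF exp_gt_zero] by blast
    ultimately have l1: "1 \<le> ln (ln (real n))" by (subst ln_ge_iff) auto
    have half: "1 \<le> n div 2" using n16 by linarith
    \<comment> \<open>The largest power of two not above n/2. Both the segment before t and the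
      block from t on then have at least n/8 observations.\<close>
    obtain i where i: "2 ^ i \<le> n div 2" "n div 2 < 2 ^ (i + 1)"
      using ex_power_ivl1[OF order_refl, of "n div 2"] half by blast
    define t where "t = (2::nat) ^ i"
    define j where "j = t - 1"
    have t1: "1 \<le> t" by (simp add: t_def)
    have t2: "2 * t \<le> n" using i(1) by (simp add: t_def)
    have t3: "n < 4 * t" using i(2) by (simp add: t_def)
    have i1: "1 \<le> i" using t3 n16 by (cases i) (auto simp: t_def)
    have jn: "j \<le> n" "real j = real t - 1" using t1 t2 by (auto simp: j_def)
    have j8: "real n / 8 \<le> real j" using t3 n16 jn(2) by linarith
    have k8: "real n / 8 \<le> real n - real j" using t2 jn(2) by linarith
    \<comment> \<open>The index i of the switch point is at most \<open>2 * ln n\<close>, because ln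
      2 exceeds 1/2; so the decay of \<pi> costs only a power of ln n.\<close>
    have pt: "a * exp (- \<kappa> * ln 2) * exp (- \<kappa> * ln (ln (real n))) \<le> pmf \<pi> t"
    proof -
      have "real i * ln 2 = ln (real t)" by (simp add: t_def ln_realpow)
      also have "\<dots> \<le> ln (real n)" using t1 t2 by (subst ln_le_cancel_iff) auto
      finally have "real i * ln 2 \<le> ln (real n)" .
      moreover have "real i * (1/2) \<le> real i * ln 2" using ln2_ge_two_thirds by (intro mult_left_mono) auto
      ultimately have i2: "real i \<le> 2 * ln (real n)" by linarith
      have "exp (- \<kappa> * ln 2) * exp (- \<kappa> * ln (ln (real n))) = (2 * ln (real n)) powr - \<kappa>"
        using lnpos by (simp add: powr_def ln_mult exp_add[symmetric] algebra_simps)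
      also have "\<dots> \<le> real i powr - \<kappa>" using i1 i2 \<kappa> by (intro powr_mono2') auto
      finally have "a * (exp (- \<kappa> * ln 2) * exp (- \<kappa> * ln (ln (real n)))) \<le> a * real i powr - \<kappa>"
        using a by (intro mult_left_mono) auto
      also have "\<dots> \<le> pmf \<pi> t" using order[OF i1] by (simp add: t_def)
      finally show ?thesis by (simp add: mult.assoc)
    qed
    show ?thesis
    proof (intro exI[of _ j] conjI jn(1) ballI allI impI)
      fix \<mu> x
      assume \<mu>K: "\<mu> \<in> K" and rpos: "\<forall>i\<in>{1..n}. 0 < r (x i)"
      define \<Delta> where "\<Delta> = norm (\<mu> - proj0 F \<nu> \<mu>)"
      define S where "S j = (\<Sum>i\<in>{1..j}. \<phi> (x i) - \<mu>)" for j
      define X where "X = real n * \<Delta>\<^sup>2"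
      assume "A * ln (ln (real n)) \<le> real n * (norm (\<mu> - proj0 F \<nu> \<mu>))\<^sup>2"
      then have AX: "A * ln (ln (real n)) \<le> X" by (simp add: X_def \<Delta>_def)
      assume "norm (\<Sum>i\<in>{1..j}. \<phi> (x i) - \<mu>) \<le> s * real n * norm (\<mu> - proj0 F \<nu> \<mu>)"
        "norm (\<Sum>i\<in>{1..n}. \<phi> (x i) - \<mu>) \<le> s * real n * norm (\<mu> - proj0 F \<nu> \<mu>)"
      then have Sj: "norm (S j) \<le> s * real n * \<Delta>" and Sn: "norm (S n) \<le> s * real n * \<Delta>"
        by (simp_all add: S_def \<Delta>_def)
      have "1 * 1 \<le> A * ln (ln (real n))" using A(1) l1 by (intro mult_mono) auto
      then have X1: "1 \<le> X" using AX by simp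
      let ?t = "th \<mu>"
      have \<mu>M: "\<mu> \<in> M" using \<mu>K K by blast
      have mt: "mv ?t = \<mu>" by (rule mv_th[OF \<mu>M])
      have tT: "?t \<in> th ` K" using \<mu>K by blast
      have \<Delta>: "0 \<le> \<Delta>" "\<Delta> \<le> D" using D(2)[OF \<mu>K] by (auto simp: \<Delta>_def)
      define L where "L j = likelihood p \<mu> j x" for j
      have Lpos: "0 < L n" "0 < L j" unfolding L_def using rpos jn(1) by (auto intro!: likelihood_pos)
      have lik: "likelihood p \<mu>' k x = L k * exp ((th \<mu>' - ?t) \<bullet> S k - real k * breg ?t (th \<mu>'))" for \<mu>' k
        unfolding L_def S_def using likelihood_eq[of \<mu>' k x \<mu>] by (simp add: mt)
      \<comment> \<open>\<open>L n / L j\<close> is the likelihood of \<mu> on the block, and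
        \<open>exp (- c * X)\<close> is what every element of M0 loses against it there.\<close>
      define q where "q = L n / L j * exp (- c * X)"
      have q0: "0 < q" using Lpos by (simp add: q_def)
      have alt: "th \<mu>' \<in> \<Theta>" "\<Delta> \<le> norm (mv (th \<mu>') - mv ?t)" if "\<mu>' \<in> M0" for \<mu>'
        using that M0 th_in sep[OF \<mu>K that] by (auto simp: mt mv_th \<Delta>_def subset_iff)
      have block: "likelihood p \<mu>' n x \<le> q * likelihood p \<mu>' j x" if \<mu>': "\<mu>' \<in> M0" for \<mu>'
      proof -
        have "norm (S n - S j) \<le> 2 * s * real n * \<Delta>" using norm_triangle_ineq4[of "S n" "S j"] Sj Sn by simp
        then have "(th \<mu>' - ?t) \<bullet> (S n - S j) - (real n - real j) * breg ?t (th \<mu>') \<le> - c * X"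
          unfolding X_def using s(2) tT alt[OF \<mu>'] \<Delta> k8 by (intro ex) auto
        then have "(th \<mu>' - ?t) \<bullet> S n - real n * breg ?t (th \<mu>') \<le>
            - c * X + ((th \<mu>' - ?t) \<bullet> S j - real j * breg ?t (th \<mu>'))"
          by (simp add: inner_diff_right algebra_simps)
        then have "L n * exp ((th \<mu>' - ?t) \<bullet> S n - real n * breg ?t (th \<mu>')) \<le>
            L n * (exp (- c * X) * exp ((th \<mu>' - ?t) \<bullet> S j - real j * breg ?t (th \<mu>')))"
          unfolding exp_add[symmetric] using Lpos by (intro mult_left_mono) auto
        then show ?thesis unfolding lik q_def using Lpos by simp
      qed
      \<comment> \<open>The same exponent bound, now on the first segment: elements of M0 cannot
        exceed the likelihood of \<mu>. The factor for the empty sample brings this into the form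
        that \<open>bayes0_block\<close> expects.\<close>
      have init: "likelihood p \<mu>' j x \<le> L j * likelihood p \<mu>' 0 x" if \<mu>': "\<mu>' \<in> M0" for \<mu>'
      proof -
        have "0 \<le> s * real n * \<Delta>" using s(1) \<Delta> by simp
        then have "norm (S j) \<le> 2 * s * real n * \<Delta>" using Sj by linarith
        then have "(th \<mu>' - ?t) \<bullet> S j - real j * breg ?t (th \<mu>') \<le> - c * X"
          unfolding X_def using s(2) tT alt[OF \<mu>'] \<Delta> j8 by (intro ex) auto
        also have "\<dots> \<le> 0" using c(1) X1 by simp
        finally have "L j * exp ((th \<mu>' - ?t) \<bullet> S j - real j * breg ?t (th \<mu>')) \<le> L j * 1"
          using Lpos by (intro mult_left_mono) auto
        then show ?thesis unfolding lik[of _ j] by (simp add: likelihood_def)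
      qed
      have \<omega>0: "0 < \<omega>0 v" if "F \<noteq> {}" "v \<in> restrict_coords F ` M0" for v
        using prior0[OF that(1)] that(2) by (auto simp: positive_prior_def)
      have B00: "bayes0 p F \<nu> M0 \<omega>0 0 x = 1" by (rule bayes0_zero[OF prior0])
      have B0n: "bayes0 p F \<nu> M0 \<omega>0 n x \<le> ennreal q * bayes0 p F \<nu> M0 \<omega>0 j x"
        by (rule bayes0_block[OF q0 block proj \<nu> \<omega>0])
      have "bayes0 p F \<nu> M0 \<omega>0 j x \<le> ennreal (L j) * bayes0 p F \<nu> M0 \<omega>0 0 x"
        by (rule bayes0_block[OF Lpos(2) init proj \<nu> \<omega>0])
      then have B0j: "bayes0 p F \<nu> M0 \<omega>0 j x < \<infinity>" unfolding B00 by (auto intro: le_less_trans)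
      \<comment> \<open>One and the same power of n occurs in the bounds for both segments, so it
        cancels in their quotient.\<close>
      define \<rho> where "\<rho> = (1 / sqrt (real n)) ^ ?m"
      have \<rho>: "0 < \<rho>" using n16 by (simp add: \<rho>_def)
      have Xs: "s * real n * \<Delta>\<^sup>2 = s * X" by (simp add: X_def)
      have B1n: "ennreal (L n * (c2 * \<rho> * exp (- C2 * (s * X)))) \<le> bayes1 p M \<omega>1 n x"
        unfolding bayes1_eq[of \<mu> n x, folded L_def, OF Lpos(1)] mt S_def[symmetric]
          ennreal_mult'[OF less_imp_le[OF Lpos(1)]]
      proof (rule mult_left_mono)
        have "1 \<le> real n" using n16 by simp
        from lo[OF s(1) tT \<Delta>(1) this _ Sn] X1
        show "ennreal (c2 * \<rho> * exp (- C2 * (s * X))) \<le>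
          (\<integral>\<^sup>+\<mu>'\<in>M. ennreal (\<omega>1 \<mu>' * exp ((th \<mu>' - ?t) \<bullet> S n - real n * breg ?t (th \<mu>'))) \<partial>lborel)"
          unfolding \<rho>_def[symmetric] Xs X_def[symmetric] by blast
      qed simp
      have B1j: "bayes1 p M \<omega>1 j x \<le> ennreal (L j * (C1 * \<rho> * exp (C1 * (s * X))))"
        unfolding bayes1_eq[of \<mu> j x, folded L_def, OF Lpos(2)] mt S_def[symmetric]
          ennreal_mult'[OF less_imp_le[OF Lpos(2)]]
      proof (rule mult_left_mono)
        have "1 \<le> real n" using n16 by simp
        from up[OF s(1,3) tT \<Delta> this j8 Sj]
        show "(\<integral>\<^sup>+\<mu>'\<in>M. ennreal (\<omega>1 \<mu>' * exp ((th \<mu>' - ?t) \<bullet> S j - real j * breg ?t (th \<mu>'))) \<partial>lborel) \<le>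
          ennreal (C1 * \<rho> * exp (C1 * (s * X)))"
          unfolding \<rho>_def[symmetric] Xs .
      qed simp
      have final: "q < pmf \<pi> t * (L n * (c2 * \<rho> * exp (- C2 * (s * X))) / (L j * (C1 * \<rho> * exp (C1 * (s * X)))))"
      proof -
        let ?l = "ln (ln (real n))"
        have "(\<kappa> + \<bar>ln b0\<bar> + 1) * ?l \<le> c / 2 * A * ?l" using A(2) l1 by (intro mult_right_mono) auto
        also have "\<dots> \<le> c / 2 * X" using mult_left_mono[OF AX, of "c / 2"] c(1) by (simp add: mult.assoc)
        finally have "(\<kappa> + \<bar>ln b0\<bar> + 1) * ?l \<le> c / 2 * X" .
        then have 1: "\<kappa> * ?l + (\<bar>ln b0\<bar> + 1) * ?l \<le> c / 2 * X" by (simp add: algebra_simps)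
        have 2: "\<bar>ln b0\<bar> + 1 \<le> (\<bar>ln b0\<bar> + 1) * ?l"
          using mult_left_mono[OF l1, of "\<bar>ln b0\<bar> + 1"] by simp
        \<comment> \<open>Here the extra 1 in the choice of \<open>A\<close> becomes the strictness
          required by the criterion.\<close>
        have "P - z < Y" if "P + g \<le> Y" "h + 1 \<le> g" "- z \<le> h" for P Y g h z :: real
          using that by linarith
        from this[OF 1 2 abs_ge_minus_self] have "\<kappa> * ?l - ln b0 < c / 2 * X" .
        then have "- c * X < ln b0 - \<kappa> * ?l - c / 2 * X" by (simp add: field_simps)
        then have "exp (- c * X) < exp (ln b0 + - \<kappa> * ?l + - (c / 2 * X))" by simp
        also have "\<dots> = b0 * exp (- \<kappa> * ?l) * exp (- (c / 2 * X))" unfolding exp_add using b0 by simp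
        also have "\<dots> \<le> b0 * exp (- \<kappa> * ?l) * exp (- ((C1 + C2) * s * X))"
          using mult_right_mono[OF sC, of X] X1 b0 by (intro mult_left_mono) auto
        also have "\<dots> = (a * exp (- \<kappa> * ln 2) * exp (- \<kappa> * ?l)) * (c2 / C1 * exp (- ((C1 + C2) * s * X)))"
          by (simp add: b0_def)
        also have "\<dots> \<le> pmf \<pi> t * (c2 / C1 * exp (- ((C1 + C2) * s * X)))"
          using pt c2 C1 by (intro mult_right_mono) auto
        finally have "q < L n / L j * (pmf \<pi> t * (c2 / C1 * exp (- ((C1 + C2) * s * X))))"
          unfolding q_def using Lpos by (intro mult_strict_left_mono) auto
        also have "exp (- ((C1 + C2) * s * X)) = exp (- C2 * (s * X)) / exp (C1 * (s * X))"
          by (simp add: exp_diff[symmetric] algebra_simps)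
        also have "L n / L j * (pmf \<pi> t * (c2 / C1 * (exp (- C2 * (s * X)) / exp (C1 * (s * X))))) =
          pmf \<pi> t * (L n * (c2 * \<rho> * exp (- C2 * (s * X))) / (L j * (C1 * \<rho> * exp (C1 * (s * X)))))"
          using \<rho> by simp
        finally show ?thesis .
      qed
      show "switch_criterion \<pi> (bayes0 p F \<nu> M0 \<omega>0) (bayes1 p M \<omega>1) n x = 1"
      proof (rule switch_criterion_eq_1[where t=t and j=j and q=q])
        show "t \<le> n" using t2 by simp
        show "0 < L n * (c2 * \<rho> * exp (- C2 * (s * X)))" "0 < L j * (C1 * \<rho> * exp (C1 * (s * X)))"
          using Lpos c2 C1 \<rho> by auto
        show "bayes1 p M \<omega>1 0 x = 1" by (rule bayes1_zero[OF prior1])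
      qed (use t1 j_def B0n B0j B1n B1j q0 final \<pi>1 B00 in auto)
    qed
  qed
  then show ?thesis using that[of s A N] s(1) A(1) by simp
qed

section \<open>Integration of the pointwise bound\<close>

text \<open>The left integrand contains \<delta>, on which no measurability is imposed. Monotonicity
  of the integral passes to a majorant built from the losses of the single estimators and the
  squared deviations, and only this majorant has to be measurable.\<close>

lemma post_selection_risk_le:
  assumes \<mu>: "\<mu> \<in> M" "continuous_on M (d \<mu>)" "continuous_on M (d \<mu>0)"
    and est: "estimator \<Lambda> M e0" "estimator \<Lambda> M e1"
    and q: "quad k (th \<mu>)" "0 < k" and j: "j \<le> n"
    and nonneg: "0 \<le> A" "0 \<le> B" "0 \<le> G"
    and pt: "AE x in Pi\<^sub>M {1..n} (\<lambda>_. model_measure \<Lambda> p \<mu>).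
      ennreal (d \<mu> (if \<delta> n x = 0 then e0 n x else e1 n x)) \<le>
        ennreal (d \<mu> (e1 n x)) + ennreal A * ennreal (d \<mu>0 (e0 n x)) + ennreal B +
        ennreal G * (ennreal ((norm (\<Sum>i\<in>{1..j}. \<phi> (x i) - \<mu>))\<^sup>2) + ennreal ((norm (\<Sum>i\<in>{1..n}. \<phi> (x i) - \<mu>))\<^sup>2))"
  shows "post_selection_risk \<Lambda> p d e0 e1 \<mu> \<delta> n \<le>
    sample_expectation \<Lambda> p \<mu> n (\<lambda>x. d \<mu> (e1 n x)) + ennreal A * sample_expectation \<Lambda> p \<mu> n (\<lambda>x. d \<mu>0 (e0 n x)) +
    ennreal (B + G * (2 * (real n * DIM(real ^ 'm) / k)))"
proof -
  let ?P = "Pi\<^sub>M {1..n} (\<lambda>_. model_measure \<Lambda> p \<mu>)"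
  interpret P: prob_space ?P by (intro prob_space_PiM prob_space_model \<mu>(1))
  have sP: "sets ?P = sets (Pi\<^sub>M {1..n} (\<lambda>_. \<Lambda>))" by (intro sets_PiM_cong) auto
  have spP: "space ?P = space (Pi\<^sub>M {1..n} (\<lambda>_. \<Lambda>))" by (rule sets_eq_imp_space_eq[OF sP])
  have loss_meas: "(\<lambda>x. f (e n x)) \<in> borel_measurable ?P"
    if "continuous_on M f" "estimator \<Lambda> M e" for f :: "real ^ 'm \<Rightarrow> real" and e
  proof -
    have "e n \<in> borel_measurable (Pi\<^sub>M {1..n} (\<lambda>_. \<Lambda>))" "\<And>x. x \<in> space (Pi\<^sub>M {1..n} (\<lambda>_. \<Lambda>)) \<Longrightarrow> e n x \<in> M"
      using that(2) unfolding estimator_def by blast+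
    then have "e n \<in> borel_measurable ?P" "e n \<in> space ?P \<rightarrow> M"
      using measurable_cong_sets[OF sP refl, of borel] spP by blast+
    then have "e n \<in> measurable ?P (restrict_space borel M)" by (intro measurable_restrict_space2)
    then show ?thesis
      by (rule measurable_compose) (rule borel_measurable_continuous_on_restrict[OF that(1)])
  qed
  have m_loss: "(\<lambda>x. d \<mu> (e1 n x)) \<in> borel_measurable ?P" "(\<lambda>x. d \<mu>0 (e0 n x)) \<in> borel_measurable ?P"
    by (rule loss_meas[OF \<mu>(2) est(2)], rule loss_meas[OF \<mu>(3) est(1)])
  have comp: "(\<lambda>x. \<phi> (x i) - \<mu>) \<in> borel_measurable ?P" if "i \<in> {1..n}" for i
  proof -
    have "(\<lambda>x. x i) \<in> measurable ?P (model_measure \<Lambda> p \<mu>)" by (rule measurable_component_singleton[OF that])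
    moreover have "(\<lambda>y. \<phi> y - \<mu>) \<in> borel_measurable (model_measure \<Lambda> p \<mu>)" by measurable
    ultimately show ?thesis by (rule measurable_compose)
  qed
  have m_dev: "(\<lambda>x. ennreal ((norm (\<Sum>i\<in>{1..l}. \<phi> (x i) - \<mu>))\<^sup>2)) \<in> borel_measurable ?P" if "l \<le> n" for l
  proof -
    have "(\<lambda>x. \<Sum>i\<in>{1..l}. \<phi> (x i) - \<mu>) \<in> borel_measurable ?P"
      using that by (intro borel_measurable_sum comp) auto
    then show ?thesis by measurable
  qed
  let ?I = "\<lambda>l. \<integral>\<^sup>+x. ennreal ((norm (\<Sum>i\<in>{1..l}. \<phi> (x i) - \<mu>))\<^sup>2) \<partial>?P"
  have "post_selection_risk \<Lambda> p d e0 e1 \<mu> \<delta> n \<le> (\<integral>\<^sup>+x. ennreal (d \<mu> (e1 n x)) + ennreal A * ennreal (d \<mu>0 (e0 n x)) + ennreal B +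
        ennreal G * (ennreal ((norm (\<Sum>i\<in>{1..j}. \<phi> (x i) - \<mu>))\<^sup>2) + ennreal ((norm (\<Sum>i\<in>{1..n}. \<phi> (x i) - \<mu>))\<^sup>2)) \<partial>?P)"
    unfolding post_selection_risk_def sample_expectation_def by (rule nn_integral_mono_AE[OF pt])
  also have "\<dots> = sample_expectation \<Lambda> p \<mu> n (\<lambda>x. d \<mu> (e1 n x)) + ennreal A * sample_expectation \<Lambda> p \<mu> n (\<lambda>x. d \<mu>0 (e0 n x)) +
      ennreal B + ennreal G * (?I j + ?I n)"
    unfolding sample_expectation_def
    by (rule P.nn_integral_affine) (rule measurable_compose[OF m_loss(1) measurable_ennreal]
      measurable_compose[OF m_loss(2) measurable_ennreal] m_dev[OF j] m_dev[OF order_refl])+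
  also have "\<dots> \<le> sample_expectation \<Lambda> p \<mu> n (\<lambda>x. d \<mu> (e1 n x)) + ennreal A * sample_expectation \<Lambda> p \<mu> n (\<lambda>x. d \<mu>0 (e0 n x)) +
      ennreal B + ennreal G * (ennreal (real n * DIM(real ^ 'm) / k) + ennreal (real n * DIM(real ^ 'm) / k))"
    by (intro add_mono mult_left_mono second_moment_centered \<mu>(1) q j order_refl) simp
  also have "\<dots> = sample_expectation \<Lambda> p \<mu> n (\<lambda>x. d \<mu> (e1 n x)) + ennreal A * sample_expectation \<Lambda> p \<mu> n (\<lambda>x. d \<mu>0 (e0 n x)) +
      ennreal (B + G * (2 * (real n * DIM(real ^ 'm) / k)))"
  proof -
    define z where "z = real n * DIM(real ^ 'm) / k"
    have z: "0 \<le> z" using q(2) by (simp add: z_def)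
    have "ennreal B + ennreal G * (ennreal z + ennreal z) = ennreal (B + G * (2 * z))"
      using z nonneg by (simp add: ennreal_plus[symmetric] ennreal_mult'[symmetric] del: ennreal_plus)
    then show ?thesis unfolding z_def[symmetric] by (simp add: add.assoc)
  qed
  finally show ?thesis .
qed

end

section \<open>The risk bound\<close>

theorem theorem1:
  fixes \<Lambda> :: "'x measure"
    and \<phi> \<phi>0 :: "'x \<Rightarrow> (real, 'm::{finite,linorder}) vec"
    and r r0 :: "'x \<Rightarrow> real"
    and \<Theta> \<Theta>0 M1 M0 :: "(real, 'm) vec set"
    and m0 :: nat
    and F :: "'m set"
    and \<zeta>1 \<eta>1 \<zeta>0 \<eta>0 :: "'m \<Rightarrow> ereal"
    and \<nu> :: "(real, 'm) vec"
    and p :: "(real, 'm) vec \<Rightarrow> 'x \<Rightarrow> real"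
    and d :: "(real, 'm) vec \<Rightarrow> (real, 'm) vec \<Rightarrow> real"
    and e0 e1 :: "nat \<Rightarrow> (nat \<Rightarrow> 'x) \<Rightarrow> (real, 'm) vec"
    and \<omega>0 \<omega>1 :: "(real, 'm) vec \<Rightarrow> real"
    and \<pi> :: "nat pmf"
    and \<kappa> a b :: real
    and pB0 pB1 :: "nat \<Rightarrow> (nat \<Rightarrow> 'x) \<Rightarrow> ennreal"
    and \<delta>sw :: "nat \<Rightarrow> (nat \<Rightarrow> 'x) \<Rightarrow> nat"
  assumes m0: "m0 < CARD('m)"
    and F: "F = first_coords m0"
    and bounds_free: "\<And>j. j \<in> F \<Longrightarrow> \<zeta>1 j \<le> \<zeta>0 j \<and> \<zeta>0 j < \<eta>0 j \<and> \<eta>0 j \<le> \<eta>1 j"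
    and bounds_fixed: "\<And>j. j \<notin> F \<Longrightarrow> \<zeta>1 j < ereal (\<nu> $ j) \<and> ereal (\<nu> $ j) < \<eta>1 j"
    and M1: "M1 = open_box \<zeta>1 \<eta>1"
    and M0: "M0 = flat_box F \<zeta>0 \<eta>0 \<nu>"
    and family1: "exponential_family UNIV \<Lambda> \<phi> r \<Theta>"
    and range1: "mean_value UNIV \<Lambda> \<phi> r ` \<Theta> = M1"
    and p: "p = mean_density UNIV \<Lambda> \<phi> r \<Theta>"
    and family0: "exponential_family F \<Lambda> \<phi>0 r0 \<Theta>0"
    and range0: "mean_value F \<Lambda> \<phi>0 r0 ` \<Theta>0 = restrict_coords F ` M0"
    and coincide: "\<And>\<mu>. \<mu> \<in> M0 \<Longrightarrow>
          (AE x in \<Lambda>. p \<mu> x = mean_density F \<Lambda> \<phi>0 r0 \<Theta>0 (restrict_coords F \<mu>) x)"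
    and loss: "d \<in> {squared_error, standardized_squared_error \<Lambda> p, renyi_half \<Lambda> p,
                    squared_hellinger \<Lambda> p, kullback_leibler \<Lambda> p}"
    and est0: "estimator \<Lambda> M0 e0"
    and est1: "estimator \<Lambda> M1 e1"
    and efficient: "sufficiently_efficient \<Lambda> p d F \<nu> M1 e0 e1"
    and prior1: "positive_prior lborel M1 \<omega>1"
    and prior0: "0 < m0 \<Longrightarrow> positive_prior (lborel_coords F) (restrict_coords F ` M0) \<omega>0"
    and pB1: "pB1 = bayes1 p M1 \<omega>1"
    and pB0: "pB0 = bayes0 p F \<nu> M0 \<omega>0"
    and supp: "set_pmf \<pi> = range (\<lambda>i::nat. 2 ^ i)"
    and kappa: "1 < \<kappa>"
    and ab: "0 < a" "a \<le> b"
    and order: "\<And>i::nat. 1 \<le> i \<Longrightarrow>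
          a * real i powr - \<kappa> \<le> pmf \<pi> (2 ^ i) \<and> pmf \<pi> (2 ^ i) \<le> b * real i powr - \<kappa>"
    and sw: "\<delta>sw = switch_criterion \<pi> pB0 pB1"
  shows "\<forall>K. cinecsi K M1 \<longrightarrow>
           (\<exists>C>0. \<forall>\<^sub>F n in sequentially.
              (SUP \<mu>\<in>K. post_selection_risk \<Lambda> p d e0 e1 \<mu> \<delta>sw n)
                \<le> ennreal (C * (ln (ln (real n)) / real n)))"
proof (intro allI impI)
  fix K assume cin: "cinecsi K M1"
  interpret density_family \<Lambda> \<phi> r \<Theta> by unfold_locales (rule family1)
  have MM: "mv ` \<Theta> = M1" unfolding range1[symmetric] by (intro image_cong refl mean_value_eq[symmetric])
  let ?p = "mean_density UNIV \<Lambda> \<phi> r \<Theta>"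
  let ?\<delta> = "switch_criterion \<pi> (bayes0 ?p F \<nu> M0 \<omega>0) (bayes1 ?p M1 \<omega>1)"
  have \<delta>: "\<delta>sw = ?\<delta>" by (simp add: sw pB0 pB1 p)
  have K: "compact K" "K \<subseteq> M1" using cin interior_subset[of M1] by (auto simp: cinecsi_def)
  have M0M1: "M0 \<subseteq> M1"
  proof
    fix \<mu> assume "\<mu> \<in> M0"
    then have h: "\<And>i. i \<in> F \<Longrightarrow> \<zeta>0 i < ereal (\<mu> $ i) \<and> ereal (\<mu> $ i) < \<eta>0 i" "\<And>i. i \<notin> F \<Longrightarrow> \<mu> $ i = \<nu> $ i"
      by (auto simp: M0 flat_box_def)
    have "\<zeta>1 i < ereal (\<mu> $ i) \<and> ereal (\<mu> $ i) < \<eta>1 i" for i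
      using h[of i] bounds_free[of i] bounds_fixed[of i]
      by (cases "i \<in> F") (auto intro: le_less_trans less_le_trans)
    then show "\<mu> \<in> M1" by (simp add: M1 open_box_def)
  qed
  \<comment> \<open>The projection belongs to M1 but not always to M0, whose free coordinates may
    range over smaller intervals. It is used only as a centre for the losses and as a measure of
    distance.\<close>
  have projM1: "proj0 F \<nu> \<mu> \<in> M1" if "\<mu> \<in> M1" for \<mu>
    using that bounds_fixed by (auto simp: M1 open_box_def proj0_def)
  have cproj: "continuous_on S (proj0 F \<nu>)" for S
  proof -
    have "continuous_on S (\<lambda>\<mu>. if i \<in> F then \<mu> $ i else \<nu> $ i)" for i
      by (cases "i \<in> F") (auto intro!: continuous_intros)
    then show ?thesis unfolding proj0_def[abs_def] by (intro continuous_on_vec_lambda)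
  qed
  \<comment> \<open>Every element of M0 has the fixed coordinates of \<open>\<nu>\<close>, and the
    projection changes no others; so componentwise it is at least as close to \<mu>.\<close>
  have sep: "norm (\<mu> - proj0 F \<nu> \<mu>) \<le> norm (\<mu>' - \<mu>)" if "\<mu>' \<in> M0" for \<mu> \<mu>'
    using that by (intro norm_le_componentwise_cart) (auto simp: M0 flat_box_def proj0_def)
  \<comment> \<open>Adding the projections lets one compact set serve for both \<mu> and its
    projection in \<open>loss_shift\<close>.\<close>
  define K' where "K' = K \<union> proj0 F \<nu> ` K"
  have K': "compact K'" "K' \<subseteq> M1"
    using K projM1 by (auto simp: K'_def intro!: compact_Un compact_continuous_image cproj)
  have "bounded ((\<lambda>\<mu>. norm (\<mu> - proj0 F \<nu> \<mu>)) ` K)"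
    by (intro compact_imp_bounded compact_continuous_image K continuous_intros cproj)
  then obtain D0 where D0: "\<And>\<mu>. \<mu> \<in> K \<Longrightarrow> norm (\<mu> - proj0 F \<nu> \<mu>) \<le> D0" by (auto simp: bounded_iff)
  have proj_inv: "proj0 F \<nu> v \<in> M0" if v: "v \<in> restrict_coords F ` M0" for v
  proof -
    obtain \<mu>' where \<mu>': "\<mu>' \<in> M0" "v = restrict_coords F \<mu>'" using v by blast
    have "proj0 F \<nu> v = \<mu>'" using \<mu>' by (auto simp: vec_eq_iff proj0_def restrict_coords_def M0 flat_box_def)
    then show ?thesis using \<mu>'(1) by simp
  qed
  have \<nu>M0: "\<nu> \<in> M0" if "F = {}" using that by (simp add: M0 flat_box_def)
  have pr0: "positive_prior (lborel_coords F) (restrict_coords F ` M0) \<omega>0" if "F \<noteq> {}"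
    using that prior0 by (cases "m0 = 0") (auto simp: F first_coords_def)
  \<comment> \<open>The order condition starts at i = 1; positivity at \<open>2 ^ 0\<close> comes
    from the support.\<close>
  have "1 \<in> set_pmf \<pi>" unfolding supp by (rule range_eqI[of _ _ 0]) simp
  then have \<pi>1: "0 < pmf \<pi> 1" by (simp add: pmf_positive)
  have ord: "a * real i powr - \<kappa> \<le> pmf \<pi> (2 ^ i)" if "1 \<le> i" for i :: nat using order[OF that] by simp
  obtain s A2 N where s: "0 < s" and A2: "0 < A2" and sel:
    "\<And>n. N \<le> n \<Longrightarrow> \<exists>j\<le>n. \<forall>\<mu>\<in>K. \<forall>x. (\<forall>i\<in>{1..n}. 0 < r (x i)) \<longrightarrow>
        A2 * ln (ln (real n)) \<le> real n * (norm (\<mu> - proj0 F \<nu> \<mu>))\<^sup>2 \<longrightarrow>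
        norm (\<Sum>i\<in>{1..j}. \<phi> (x i) - \<mu>) \<le> s * real n * norm (\<mu> - proj0 F \<nu> \<mu>) \<longrightarrow>
        norm (\<Sum>i\<in>{1..n}. \<phi> (x i) - \<mu>) \<le> s * real n * norm (\<mu> - proj0 F \<nu> \<mu>) \<longrightarrow>
        ?\<delta> n x = 1"
  proof (rule switch_selects[of K M0 F \<nu> "max D0 0" \<omega>0 \<omega>1 \<pi> \<kappa> a], unfold MM)
    show "norm (\<mu> - proj0 F \<nu> \<mu>) \<le> max D0 0" if "\<mu> \<in> K" for \<mu> using D0[OF that] by simp
  qed (use K M0M1 sep proj_inv \<nu>M0 pr0 prior1 \<pi>1 kappa ab ord in auto)
  have loss': "d \<in> {squared_error, standardized_squared_error \<Lambda> ?p, renyi_half \<Lambda> ?p, squared_hellinger \<Lambda> ?p, kullback_leibler \<Lambda> ?p}"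
    using loss by (simp add: p)
  obtain A1 where A1: "0 < A1" and shift:
    "\<And>\<mu> \<mu>0 \<mu>'. \<mu> \<in> K' \<Longrightarrow> \<mu>0 \<in> K' \<Longrightarrow> \<mu>' \<in> M1 \<Longrightarrow>
       0 \<le> d \<mu>0 \<mu>' \<and> d \<mu> \<mu>' \<le> A1 * ((norm (\<mu> - \<mu>0))\<^sup>2 + d \<mu>0 \<mu>')"
    using loss_shift[OF loss' K'(1)] K'(2) unfolding MM by blast
  have thK: "compact (th ` K)" "th ` K \<subseteq> \<Theta>"
    using K th_in MM by (auto intro!: compact_continuous_image continuous_on_subset[OF continuous_th])
  obtain k where k: "0 < k" "\<And>\<mu>. \<mu> \<in> K \<Longrightarrow> quad k (th \<mu>)" using uniform_quad[OF thK] by blast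
  obtain C C' where C: "0 < C" "0 < C'" and eff: "\<And>n. 3 \<le> n \<Longrightarrow>
      (SUP \<mu>\<in>K. sample_expectation \<Lambda> p \<mu> n (\<lambda>x. d (proj0 F \<nu> \<mu>) (e0 n x)))
        \<le> ennreal C * (SUP \<mu>\<in>K. sample_expectation \<Lambda> p \<mu> n (\<lambda>x. d \<mu> (e1 n x))) \<and>
      ennreal C * (SUP \<mu>\<in>K. sample_expectation \<Lambda> p \<mu> n (\<lambda>x. d \<mu> (e1 n x))) \<le> ennreal (C' / real n)"
    using efficient cin unfolding sufficiently_efficient_def by blast
  define m where "m = real DIM((real, 'm) vec)"
  define Q where "Q = C' / C + A1 * C' + A1 * A2 + A1 / s\<^sup>2 * (2 * (m / k))"
  have Q: "0 < Q" unfolding Q_def m_def using C A1 A2 s k by (auto intro!: add_pos_nonneg divide_pos_pos)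
  have est0': "estimator \<Lambda> M1 e0" using est0 M0M1 unfolding estimator_def by blast
  have "\<forall>\<^sub>F n in sequentially. (SUP \<mu>\<in>K. post_selection_risk \<Lambda> p d e0 e1 \<mu> \<delta>sw n) \<le> ennreal (Q * (ln (ln (real n)) / real n))"
    using eventually_ge_at_top[of N] eventually_ge_at_top[of 3] eventually_ge_at_top[of "nat \<lceil>exp (exp 1 :: real)\<rceil>"]
  proof eventually_elim
    case (elim n)
    have n0: "0 < real n" using elim(2) by simp
    have "exp (exp 1) \<le> real n" using elim(3) by linarith
    then have "exp 1 \<le> ln (real n)" using n0 by (subst ln_ge_iff) auto
    moreover from this have lnpos: "0 < ln (real n)" using less_le_trans[OF exp_gt_zero] by blast
    ultimately have l1: "1 \<le> ln (ln (real n))" by (subst ln_ge_iff) auto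
    define l where "l = ln (ln (real n))"
    have l: "1 \<le> l" using l1 by (simp add: l_def)
    obtain j where j: "j \<le> n" and selj: "\<And>\<mu> x. \<mu> \<in> K \<Longrightarrow> (\<forall>i\<in>{1..n}. 0 < r (x i)) \<Longrightarrow>
        A2 * l \<le> real n * (norm (\<mu> - proj0 F \<nu> \<mu>))\<^sup>2 \<Longrightarrow>
        norm (\<Sum>i\<in>{1..j}. \<phi> (x i) - \<mu>) \<le> s * real n * norm (\<mu> - proj0 F \<nu> \<mu>) \<Longrightarrow>
        norm (\<Sum>i\<in>{1..n}. \<phi> (x i) - \<mu>) \<le> s * real n * norm (\<mu> - proj0 F \<nu> \<mu>) \<Longrightarrow> ?\<delta> n x = 1"
      using sel[OF elim(1)] unfolding l_def by blast
    show ?case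
    proof (rule SUP_least)
      fix \<mu> assume \<mu>: "\<mu> \<in> K"
      define \<mu>0 where "\<mu>0 = proj0 F \<nu> \<mu>"
      define \<Delta> where "\<Delta> = norm (\<mu> - \<mu>0)"
      define B where "B = A1 * (A2 * l / real n)"
      \<comment> \<open>Chebyshev's factor: when a deviation exceeds
        \<open>s * n * \<Delta>\<close>, its square divided by \<open>(s * n)\<^sup>2\<close> is at
        least \<open>\<Delta>\<^sup>2\<close>.\<close>
      define G where "G = A1 / (s * real n)\<^sup>2"
      have BG: "0 \<le> B" "0 \<le> G" using A1 A2 l n0 by (auto simp: B_def G_def)
      have \<mu>M: "\<mu> \<in> M1" "\<mu>0 \<in> M1" using \<mu> K projM1 by (auto simp: \<mu>0_def)
      have \<mu>K': "\<mu> \<in> K'" "\<mu>0 \<in> K'" using \<mu> by (auto simp: K'_def \<mu>0_def)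
      let ?P = "Pi\<^sub>M {1..n} (\<lambda>_. model_measure \<Lambda> ?p \<mu>)"
      let ?S = "\<lambda>j x. norm (\<Sum>i\<in>{1..j}. \<phi> (x i) - \<mu>)"
      \<comment> \<open>Outside this null set all likelihoods are positive, as the deterministic
        selection result demands.\<close>
      have "AE x in ?P. \<forall>i\<in>{1..n}. 0 < r (x i)"
        using \<mu>M MM by (intro AE_finite_allI finite_atLeastAtMost AE_PiM_component prob_space_model AE_model_pos) auto
      then have pt: "AE x in ?P. ennreal (d \<mu> (if \<delta>sw n x = 0 then e0 n x else e1 n x)) \<le>
        ennreal (d \<mu> (e1 n x)) + ennreal A1 * ennreal (d \<mu>0 (e0 n x)) + ennreal B +
        ennreal G * (ennreal ((?S j x)\<^sup>2) + ennreal ((?S n x)\<^sup>2))"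
        using AE_space
      proof eventually_elim
        fix x assume rp: "\<forall>i\<in>{1..n}. 0 < r (x i)" and sp: "x \<in> space ?P"
        have "space ?P = space (Pi\<^sub>M {1..n} (\<lambda>_. \<Lambda>))" by (intro sets_eq_imp_space_eq sets_PiM_cong) auto
        then have e0M: "e0 n x \<in> M1" using est0' sp unfolding estimator_def by auto
        show "ennreal (d \<mu> (if \<delta>sw n x = 0 then e0 n x else e1 n x)) \<le>
          ennreal (d \<mu> (e1 n x)) + ennreal A1 * ennreal (d \<mu>0 (e0 n x)) + ennreal B +
          ennreal G * (ennreal ((?S j x)\<^sup>2) + ennreal ((?S n x)\<^sup>2))"
        proof (cases "\<delta>sw n x = 0")
          case False
          then show ?thesis by (simp add: add.assoc add_increasing2)
        next
          case True
          have d0: "0 \<le> d \<mu>0 (e0 n x)" and dle: "d \<mu> (e0 n x) \<le> A1 * (\<Delta>\<^sup>2 + d \<mu>0 (e0 n x))"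
            using shift[OF \<mu>K' e0M] by (auto simp: \<Delta>_def)
          \<comment> \<open>Chebyshev in pointwise form. Since \<delta> is 0 here, either \<Delta>
            is below the threshold or one of the two deviations is large, by the contrapositive of
            \<open>selj\<close>.\<close>
          have "\<Delta>\<^sup>2 \<le> A2 * l / real n + ((?S j x)\<^sup>2 + (?S n x)\<^sup>2) / (s * real n)\<^sup>2"
          proof (cases "A2 * l \<le> real n * \<Delta>\<^sup>2")
            case False
            then have "\<Delta>\<^sup>2 \<le> A2 * l / real n" using n0 by (simp add: field_simps)
            then show ?thesis by (rule order_trans) simp
          next
            case big: True
            have "\<not> (?S j x \<le> s * real n * \<Delta> \<and> ?S n x \<le> s * real n * \<Delta>)"
              using selj[OF \<mu> rp] big True \<delta> by (auto simp: \<Delta>_def \<mu>0_def)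
            then have "(s * real n * \<Delta>)\<^sup>2 \<le> (?S j x)\<^sup>2 \<or> (s * real n * \<Delta>)\<^sup>2 \<le> (?S n x)\<^sup>2"
              using s n0 by (auto simp: \<Delta>_def not_le intro!: power_mono)
            then have "(s * real n)\<^sup>2 * \<Delta>\<^sup>2 \<le> (?S j x)\<^sup>2 + (?S n x)\<^sup>2"
              unfolding power_mult_distrib[of "s * real n"] by (auto intro: order_trans)
            then have "\<Delta>\<^sup>2 \<le> ((?S j x)\<^sup>2 + (?S n x)\<^sup>2) / (s * real n)\<^sup>2"
              using s n0 by (simp add: pos_le_divide_eq mult.commute)
            moreover have "0 \<le> A2 * l / real n" using A2 l n0 by simp
            ultimately show ?thesis by linarith
          qed
          then have "A1 * (\<Delta>\<^sup>2 + d \<mu>0 (e0 n x)) \<le>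
            A1 * (A2 * l / real n + ((?S j x)\<^sup>2 + (?S n x)\<^sup>2) / (s * real n)\<^sup>2 + d \<mu>0 (e0 n x))"
            using A1 by (intro mult_left_mono) auto
          also have "\<dots> = A1 * d \<mu>0 (e0 n x) + B + G * ((?S j x)\<^sup>2 + (?S n x)\<^sup>2)"
            by (simp add: B_def G_def algebra_simps add_divide_distrib)
          finally have "ennreal (d \<mu> (e0 n x)) \<le> ennreal (A1 * d \<mu>0 (e0 n x) + B + G * ((?S j x)\<^sup>2 + (?S n x)\<^sup>2))"
            using dle by (intro ennreal_leI) linarith
          also have "\<dots> = ennreal A1 * ennreal (d \<mu>0 (e0 n x)) + ennreal B + ennreal G * (ennreal ((?S j x)\<^sup>2) + ennreal ((?S n x)\<^sup>2))"
            using A1 d0 BG by (simp add: ennreal_mult)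
          also have "\<dots> \<le> ennreal (d \<mu> (e1 n x)) + ennreal A1 * ennreal (d \<mu>0 (e0 n x)) + ennreal B +
            ennreal G * (ennreal ((?S j x)\<^sup>2) + ennreal ((?S n x)\<^sup>2))"
            by (simp add: add.assoc add_increasing)
          finally show ?thesis using True by simp
        qed
      qed
      let ?E1 = "sample_expectation \<Lambda> ?p \<mu> n (\<lambda>x. d \<mu> (e1 n x))"
      let ?E0 = "sample_expectation \<Lambda> ?p \<mu> n (\<lambda>x. d \<mu>0 (e0 n x))"
      have cont: "continuous_on (mv ` \<Theta>) (d \<mu>)" "continuous_on (mv ` \<Theta>) (d \<mu>0)"
        using \<mu>M loss_continuous[OF loss'] by (auto simp: MM)
      have risk: "post_selection_risk \<Lambda> ?p d e0 e1 \<mu> \<delta>sw n \<le> ?E1 + ennreal A1 * ?E0 +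
          ennreal (B + G * (2 * (real n * DIM((real, 'm) vec) / k)))"
      proof (rule post_selection_risk_le[where j=j])
        show "AE x in ?P. ennreal (d \<mu> (if \<delta>sw n x = 0 then e0 n x else e1 n x)) \<le>
          ennreal (d \<mu> (e1 n x)) + ennreal A1 * ennreal (d \<mu>0 (e0 n x)) + ennreal B +
          ennreal G * (ennreal ((?S j x)\<^sup>2) + ennreal ((?S n x)\<^sup>2))" by (rule pt)
        show "\<mu> \<in> mv ` \<Theta>" "estimator \<Lambda> (mv ` \<Theta>) e0" "estimator \<Lambda> (mv ` \<Theta>) e1"
          using \<mu>M(1) est0' est1 by (simp_all add: MM)
      qed (use cont k(1) k(2)[OF \<mu>] BG A1 j in auto)
      \<comment> \<open>Efficiency bounds the supremum for \<open>e1\<close> only after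
        multiplication by C; hence the later factor \<open>1 / C\<close>.\<close>
      have "ennreal C * ?E1 \<le> ennreal C * (SUP \<mu>\<in>K. sample_expectation \<Lambda> p \<mu> n (\<lambda>x. d \<mu> (e1 n x)))"
        unfolding p using \<mu> by (intro mult_left_mono SUP_upper) auto
      also have "\<dots> \<le> ennreal (C' / real n)" using eff[OF elim(2)] by blast
      finally have "ennreal (1 / C) * (ennreal C * ?E1) \<le> ennreal (1 / C) * ennreal (C' / real n)"
        by (rule mult_left_mono) simp
      then have E1: "?E1 \<le> ennreal (C' / C / real n)"
        using C by (simp add: mult.assoc[symmetric] ennreal_mult'[symmetric])
      have "?E0 \<le> (SUP \<mu>\<in>K. sample_expectation \<Lambda> p \<mu> n (\<lambda>x. d (proj0 F \<nu> \<mu>) (e0 n x)))"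
        unfolding p \<mu>0_def using \<mu> by (rule SUP_upper)
      also have "\<dots> \<le> ennreal (C' / real n)" using eff[OF elim(2)] by (blast intro: order_trans)
      finally have E0: "?E0 \<le> ennreal (C' / real n)" .
      have "post_selection_risk \<Lambda> p d e0 e1 \<mu> \<delta>sw n \<le> ennreal (C' / C / real n) + ennreal A1 * ennreal (C' / real n) +
          ennreal (B + G * (2 * (real n * m / k)))"
        unfolding p m_def by (rule order_trans[OF risk]) (intro add_mono mult_left_mono E1 E0 order_refl zero_le)
      also have "\<dots> = ennreal (C' / C / real n + A1 * (C' / real n) + (B + G * (2 * (real n * m / k))))"
        using C A1 BG k(1) by (simp add: ennreal_mult'[symmetric] ennreal_plus[symmetric] m_def del: ennreal_plus)
      also have "\<dots> \<le> ennreal (Q * (ln (ln (real n)) / real n))"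
      proof (rule ennreal_leI)
        have g: "G * (2 * (real n * m / k)) = A1 / s\<^sup>2 * (2 * (m / k)) / real n"
          using n0 by (simp add: G_def power_mult_distrib power2_eq_square)
        have nn: "0 \<le> C' / C" "0 \<le> A1 * C'" "0 \<le> A1 / s\<^sup>2 * (2 * (m / k))"
          using C A1 k(1) by (auto simp: m_def)
        \<comment> \<open>The O(1/n) terms are absorbed using \<open>l \<ge> 1\<close>.\<close>
        have grow: "z \<le> z * l" if "0 \<le> z" for z using mult_left_mono[OF l that] by simp
        have "C' / C / real n + A1 * (C' / real n) + (B + G * (2 * (real n * m / k))) =
          (C' / C + A1 * C' + A1 * A2 * l + A1 / s\<^sup>2 * (2 * (m / k))) / real n"
          unfolding g B_def by (simp add: add_divide_distrib)
        also have "\<dots> \<le> (Q * l) / real n"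
          unfolding Q_def distrib_right using grow[OF nn(1)] grow[OF nn(2)] grow[OF nn(3)] n0
          by (intro divide_right_mono) linarith+
        finally show "C' / C / real n + A1 * (C' / real n) + (B + G * (2 * (real n * m / k))) \<le> Q * (ln (ln (real n)) / real n)"
          by (simp add: l_def)
      qed
      finally show "post_selection_risk \<Lambda> p d e0 e1 \<mu> \<delta>sw n \<le> ennreal (Q * (ln (ln (real n)) / real n))" .
    qed
  qed
  then show "\<exists>C>0. \<forall>\<^sub>F n in sequentially.
      (SUP \<mu>\<in>K. post_selection_risk \<Lambda> p d e0 e1 \<mu> \<delta>sw n) \<le> ennreal (C * (ln (ln (real n)) / real n))"
    using Q by blast
qed

end
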